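(* Let $X$ be a non-negative continuous random variable with density $f$ such that: (i) $f(t) \le C e^{-\lambda t}$ for all $t \ge 0$, for some constants $C,\lambda>0$; (ii) the support of $f$ can be partitioned into finitely many intervals, on each of which $f$ is differentiable and monotone (non-decreasing or non-increasing); (iii) there exist $C', \epsilon_0>0$ such that $x \le C'\,\mathbb{E}[X_{\le x}]$ for all $x \in (\chi_{\min}, \chi_{\min}+\epsilon_0)$. For every $n \ge 1$, let $x_1,\ldots,x_n$ be independent samples of $X$, considered as the weights of a weighted voting game with $n$ agents, and let $\varphi_{\max}(Q)$ (resp. $\varphi_{\min}(Q)$) denote the Shapley value, at quota $Q$, of the agent with the largest (resp. smallest) weight. Then for every $\epsilon>0$ there exists $\xi<1$ (and an implied constant, depending on $X$ and $\epsilon$ but not on $n$ or $Q$) such that: for all $n$ and all $Q \in [n^{1/4}, (1-\epsilon)\, n\,\mathbb{E}[X]]$, \[ \mathbb{E}[\varphi_{\max}(Q)] = \frac{1}{n}\, \mathbb{E}_{x \sim X^n_{\max}}\Big[\frac{x}{\mathbb{E}[X_{\le x}]}\Big] \pm O(\xi^{n^{1/4}}), \] and for all $n$ and all $Q \in [n^{1/4}, (n-n^{2/3})\,\mathbb{E}[X]]$, \[ \mathbb{E}[\varphi_{\min}(Q)] = \frac{1}{n}\, \mathbb{E}_{x \sim X^n_{\min}}\Big[\frac{x}{\mathbb{E}[X_{\ge x}]}\Big] \pm O(\xi^{n^{1/4}}). \] The outer expectations on the left are over the random weights.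
   Context: Weighted voting game: agents $1,\ldots,n$ with non-negative weights $w_1,\ldots,w_n$ and a quota $Q \ge 0$. The Shapley value of agent $i$ at quota $Q$ is $\varphi_i(Q) = \Pr_{\pi}\big[Q - w_i \le \sum_{j \text{ precedes } i \text{ in } \pi} w_j < Q\big]$, where $\pi$ is a uniformly random ordering of the $n$ agents. For a random variable $Z$ and real $t$, $Z_{\le t}$ denotes $Z$ conditioned on $Z \le t$ and $Z_{\ge t}$ denotes $Z$ conditioned on $Z \ge t$. $Z^n_{\max}$ (resp. $Z^n_{\min}$) denotes the maximum (resp. minimum) of $n$ independent copies of $Z$. $\chi_{\min} = \inf\{x : \Pr[X \ge x]>0\}$. *)

theory Defs
  imports "HOL-Probability.Probability" "HOL-Combinatorics.Permutations"
begin

definition Xdist :: "(real \<Rightarrow> real) \<Rightarrow> real measure" where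
  "Xdist f = density lborel (\<lambda>t. ennreal (f t))"

definition mean_X :: "(real \<Rightarrow> real) \<Rightarrow> real" where
  "mean_X f = (\<integral>t. t \<partial>Xdist f)"

definition cond_exp_le :: "(real \<Rightarrow> real) \<Rightarrow> real \<Rightarrow> real" where
  "cond_exp_le f x = (\<integral>t. t * indicator {..x} t \<partial>Xdist f) / measure (Xdist f) {..x}"

definition cond_exp_ge :: "(real \<Rightarrow> real) \<Rightarrow> real \<Rightarrow> real" where
  "cond_exp_ge f x = (\<integral>t. t * indicator {x..} t \<partial>Xdist f) / measure (Xdist f) {x..}"

definition chi_min :: "(real \<Rightarrow> real) \<Rightarrow> real" where
  "chi_min f = Inf {x. 0 < measure (Xdist f) {..x}}"

text \<open>Shapley value of agent i (i < n) in the weighted voting game with weights w 0, ..., w (n-1)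
  and quota Q. A uniformly random ordering is encoded by a uniformly random permutation
  sigma of the agents, sigma j being the position of agent j.\<close>
definition shapley :: "nat \<Rightarrow> (nat \<Rightarrow> real) \<Rightarrow> real \<Rightarrow> nat \<Rightarrow> real" where
  "shapley n w Q i =
     real (card {\<sigma>. \<sigma> permutes {..<n} \<and>
        Q - w i \<le> (\<Sum>j\<in>{j. j < n \<and> \<sigma> j < \<sigma> i}. w j) \<and>
        (\<Sum>j\<in>{j. j < n \<and> \<sigma> j < \<sigma> i}. w j) < Q}) / fact n"

text \<open>Shapley value of an agent with largest / smallest weight (ties have probability 0).\<close>
definition phi_max :: "nat \<Rightarrow> (nat \<Rightarrow> real) \<Rightarrow> real \<Rightarrow> real" where
  "phi_max n w Q = shapley n w Q (SOME i. i < n \<and> (\<forall>j<n. w j \<le> w i))"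

definition phi_min :: "nat \<Rightarrow> (nat \<Rightarrow> real) \<Rightarrow> real \<Rightarrow> real" where
  "phi_min n w Q = shapley n w Q (SOME i. i < n \<and> (\<forall>j<n. w i \<le> w j))"

definition samples :: "(real \<Rightarrow> real) \<Rightarrow> nat \<Rightarrow> (nat \<Rightarrow> real) measure" where
  "samples f n = PiM {..<n} (\<lambda>_. Xdist f)"

end

theory Submission
  imports Defs
begin

text \<open>
  Condition on the weight \<open>x\<close> of the largest agent. The others are then i.i.d. copies of \<open>X\<close> given \<open>X \<le> x\<close>,
  and the position of the agent in the ordering is uniform, so \<open>n\<close> times its Shapley value is the expected
  number of \<open>k < n\<close> for which the partial sum of \<open>k\<close> of them lies in \<open>[Q - x, Q)\<close>. Summing over all \<open>k\<close> instead
  costs an exponentially small Chernoff term, and the complete sum \<open>Z(Q)\<close> is \<open>x / E[X | X \<le> x]\<close> up to an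
  exponentially small error by a renewal theorem that is uniform in \<open>x\<close>. The smallest agent is treated alike,
  with \<open>X \<ge> x\<close>.

  The renewal theorem: let \<open>f\<close> be the density of the summands, \<open>\<mu>\<close> its mean, \<open>b(s)\<close> the tail probability
  \<open>P(Y > s)\<close> for \<open>s \<ge> 0\<close>, and \<open>D = Z - x / \<mu>\<close>. Up to exponentially small terms \<open>D = f\<^sup>*\<^sup>N * D\<close> and \<open>b * D = 0\<close>,
  hence \<open>D = (f\<^sup>*\<^sup>N - c b(\<cdot> - y)) * D\<close> for all \<open>c\<close>, \<open>y\<close>. Since \<open>f\<close> is bounded below on an interval, for large \<open>N\<close>
  its convolution power is at least \<open>c > 0\<close> on an interval \<open>[y, y + L]\<close> carrying nearly all the mass of
  \<open>b(\<cdot> - y)\<close>, so the signed kernel has total variation less than 1, also after a small exponential tilt.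
  This contraction makes \<open>D\<close> decay exponentially, with constants depending only on the lower bound of \<open>f\<close>
  and on one exponential moment.
\<close>

section \<open>Convolution of non-negative functions\<close>

text \<open>A convolution power of \<open>f\<close> alone has mass 1 and fixes every constant, so it
  cannot contract. The second identity removes this mode: \<open>b * Z\<close> equals
  \<open>x\<close> beyond \<open>x\<close> while \<open>b\<close> has mass \<open>\<mu>\<close>, so
  only the constant \<open>x / \<mu>\<close> is compatible with it. The obstacle is uniformity.
  Every extremal weight gives its own conditional density, and these degenerate near one end of the
  support. The renewal theorem is therefore applied only to weights whose conditional law keeps a
  fixed interval where \<open>f\<close> is bounded below. For any other extremal weight the
  remaining \<open>n - 1\<close> weights lie in a set of probability at most
  \<open>\<rho> < 1\<close>; this is exponentially rare, and a crude bound on the ratio of weight to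
  conditional mean suffices. The upper limits for \<open>Q\<close> come from cutting the series at
  \<open>n\<close>. For the largest agent the conditional mean is only close to \<open>E[X]\<close>,
  and a fixed Chernoff parameter needs slack proportional to \<open>n\<close>. For the smallest
  agent it is at least \<open>E[X]\<close>, and a parameter of order \<open>n powr (-1/3)\<close>
  gets by with slack of order \<open>n powr (2/3)\<close>.\<close>

definition conv :: "(real \<Rightarrow> ennreal) \<Rightarrow> (real \<Rightarrow> ennreal) \<Rightarrow> real \<Rightarrow> ennreal" where
  "conv f h t = (\<integral>\<^sup>+ s. f s * h (t - s) \<partial>lborel)"

lemma conv_measurable [measurable (raw)]:
  assumes [measurable]: "f \<in> borel_measurable borel" "h \<in> borel_measurable borel" "g \<in> borel_measurable M"
  shows "(\<lambda>w. conv f h (g w)) \<in> borel_measurable M"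
proof -
  have "(\<lambda>t. conv f h t) \<in> borel_measurable borel"
    unfolding conv_def by measurable
  then show ?thesis by measurable
qed

lemma conv_measurable' [measurable]:
  assumes [measurable]: "f \<in> borel_measurable borel" "h \<in> borel_measurable borel"
  shows "conv f h \<in> borel_measurable borel"
  using conv_measurable[OF assms measurable_ident_sets[of borel borel]] by simp

lemma nn_integral_reflect:
  fixes g :: "real \<Rightarrow> ennreal"
  assumes [measurable]: "g \<in> borel_measurable borel"
  shows "(\<integral>\<^sup>+ s. g (t - s) \<partial>lborel) = (\<integral>\<^sup>+ s. g s \<partial>lborel)"
  using nn_integral_real_affine[OF assms, of "-1" t] by simp

lemma nn_integral_shift:
  fixes g :: "real \<Rightarrow> ennreal"
  assumes [measurable]: "g \<in> borel_measurable borel"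
  shows "(\<integral>\<^sup>+ s. g (s - t) \<partial>lborel) = (\<integral>\<^sup>+ s. g s \<partial>lborel)"
  using nn_integral_real_affine[OF assms, of "1" "-t"] by simp

lemma conv_commute:
  assumes [measurable]: "f \<in> borel_measurable borel" "h \<in> borel_measurable borel"
  shows "conv f h = conv h f"
proof
  fix t
  have "conv f h t = (\<integral>\<^sup>+ s. (\<lambda>s. h s * f (t - s)) (t - s) \<partial>lborel)"
    unfolding conv_def by (simp add: mult.commute)
  also have "\<dots> = conv h f t"
    unfolding conv_def by (rule nn_integral_reflect) measurable
  finally show "conv f h t = conv h f t" .
qed

lemma conv_assoc:
  assumes [measurable]: "f \<in> borel_measurable borel" "g \<in> borel_measurable borel" "h \<in> borel_measurable borel"
  shows "conv f (conv g h) = conv (conv f g) h"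
proof
  fix t
  have "conv f (conv g h) t = (\<integral>\<^sup>+ s. \<integral>\<^sup>+ u. f s * (g u * h (t - s - u)) \<partial>lborel \<partial>lborel)"
    unfolding conv_def by (intro nn_integral_cong nn_integral_cmult[symmetric]) measurable
  also have "\<dots> = (\<integral>\<^sup>+ s. \<integral>\<^sup>+ v. f s * (g (v - s) * h (t - v)) \<partial>lborel \<partial>lborel)"
  proof (rule nn_integral_cong)
    fix s
    have "(\<integral>\<^sup>+ v. f s * (g (v - s) * h (t - v)) \<partial>lborel)
       = (\<integral>\<^sup>+ v. (\<lambda>u. f s * (g u * h (t - s - u))) (v - s) \<partial>lborel)" by simp
    also have "\<dots> = (\<integral>\<^sup>+ u. f s * (g u * h (t - s - u)) \<partial>lborel)"
      by (rule nn_integral_shift) measurable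
    finally have "(\<integral>\<^sup>+ v. f s * (g (v - s) * h (t - v)) \<partial>lborel) = (\<integral>\<^sup>+ u. f s * (g u * h (t - s - u)) \<partial>lborel)" .
    then show "(\<integral>\<^sup>+ u. f s * (g u * h (t - s - u)) \<partial>lborel) = (\<integral>\<^sup>+ v. f s * (g (v - s) * h (t - v)) \<partial>lborel)" by simp
  qed
  also have "\<dots> = (\<integral>\<^sup>+ v. \<integral>\<^sup>+ s. f s * (g (v - s) * h (t - v)) \<partial>lborel \<partial>lborel)"
    by (rule lborel_pair.Fubini') measurable
  also have "\<dots> = conv (conv f g) h t"
    unfolding conv_def by (auto simp: mult.assoc[symmetric] intro!: nn_integral_cong nn_integral_multc)
  finally show "conv f (conv g h) t = conv (conv f g) h t" .
qed

lemma conv_mono: "(\<And>t. h t \<le> h' t) \<Longrightarrow> conv f h t \<le> conv f h' t"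
  unfolding conv_def by (intro nn_integral_mono mult_left_mono) auto

lemma conv_add:
  assumes [measurable]: "f \<in> borel_measurable borel" "g \<in> borel_measurable borel" "h \<in> borel_measurable borel"
  shows "conv f (\<lambda>t. g t + h t) = (\<lambda>t. conv f g t + conv f h t)"
  unfolding conv_def by (auto simp: distrib_left fun_eq_iff intro!: nn_integral_add)

lemma conv_suminf:
  assumes [measurable]: "f \<in> borel_measurable borel" "\<And>k. g k \<in> borel_measurable borel"
  shows "conv f (\<lambda>t. \<Sum>k. g k t) = (\<lambda>t. \<Sum>k. conv f (g k) t)"
  unfolding conv_def by (auto simp: fun_eq_iff ennreal_suminf_cmult[symmetric] nn_integral_suminf[symmetric] simp del: ennreal_suminf_cmult)

lemma conv_cmult:
  assumes [measurable]: "f \<in> borel_measurable borel" "h \<in> borel_measurable borel"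
  shows "conv f (\<lambda>t. c * h t) = (\<lambda>t. c * conv f h t)"
  unfolding conv_def by (auto simp: fun_eq_iff mult.left_commute nn_integral_cmult[symmetric])

lemma conv_cmult_left:
  assumes [measurable]: "f \<in> borel_measurable borel" "h \<in> borel_measurable borel"
  shows "conv (\<lambda>t. c * f t) h = (\<lambda>t. c * conv f h t)"
  unfolding conv_def by (auto simp: fun_eq_iff mult.assoc nn_integral_cmult[symmetric])

lemma conv_pow_measurable [measurable]:
  assumes [measurable]: "f \<in> borel_measurable borel" "h \<in> borel_measurable borel"
  shows "(conv f ^^ k) h \<in> borel_measurable borel"
  by (induction k) auto

lemma conv_pow_mono: "(\<And>t. h t \<le> h' t) \<Longrightarrow> (conv f ^^ k) h t \<le> (conv f ^^ k) h' t"
  by (induction k arbitrary: t) (auto intro: conv_mono)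

lemma conv_pow_conv:
  assumes [measurable]: "f \<in> borel_measurable borel" "h \<in> borel_measurable borel" "g \<in> borel_measurable borel"
  shows "(conv f ^^ k) (conv g h) = conv g ((conv f ^^ k) h)"
proof (induction k)
  case (Suc k)
  have "(conv f ^^ Suc k) (conv g h) = conv f (conv g ((conv f ^^ k) h))" using Suc by simp
  also have "\<dots> = conv (conv f g) ((conv f ^^ k) h)" by (rule conv_assoc) measurable
  also have "conv f g = conv g f" by (rule conv_commute) measurable
  also have "conv (conv g f) ((conv f ^^ k) h) = conv g (conv f ((conv f ^^ k) h))" by (rule conv_assoc[symmetric]) measurable
  finally show ?case by simp
qed simp

lemma conv_pow_Suc_eq:
  assumes [measurable]: "f \<in> borel_measurable borel" "h \<in> borel_measurable borel"
  shows "(conv f ^^ Suc k) h = conv ((conv f ^^ k) f) h"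
proof -
  have "(conv f ^^ Suc k) h = (conv f ^^ k) (conv f h)" by (simp add: funpow_swap1)
  also have "\<dots> = (conv f ^^ k) (conv h f)" by (subst conv_commute) auto
  also have "\<dots> = conv h ((conv f ^^ k) f)" by (rule conv_pow_conv) measurable
  also have "\<dots> = conv ((conv f ^^ k) f) h" by (rule conv_commute) measurable
  finally show ?thesis .
qed

lemma conv_pow_add:
  assumes [measurable]: "f \<in> borel_measurable borel" "g \<in> borel_measurable borel" "h \<in> borel_measurable borel"
  shows "(conv f ^^ k) (\<lambda>t. g t + h t) = (\<lambda>t. (conv f ^^ k) g t + (conv f ^^ k) h t)"
  by (induction k) (auto simp: conv_add)

lemma conv_pow_cmult:
  assumes [measurable]: "f \<in> borel_measurable borel" "h \<in> borel_measurable borel"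
  shows "(conv f ^^ k) (\<lambda>t. c * h t) = (\<lambda>t. c * (conv f ^^ k) h t)"
  by (induction k) (auto simp: conv_cmult)

lemma conv_pow_cmult_left:
  assumes [measurable]: "f \<in> borel_measurable borel" "h \<in> borel_measurable borel"
  shows "(conv (\<lambda>t. c * f t) ^^ k) h = (\<lambda>t. c ^ k * (conv f ^^ k) h t)"
proof (induction k)
  case (Suc k)
  have "(conv (\<lambda>t. c * f t) ^^ Suc k) h = (\<lambda>t. c * conv f (\<lambda>t. c ^ k * (conv f ^^ k) h t) t)"
    using Suc by (simp add: conv_cmult_left)
  also have "\<dots> = (\<lambda>t. c * (c ^ k * conv f ((conv f ^^ k) h) t))"
    by (subst conv_cmult) auto
  finally show ?case by (simp add: mult.assoc)
qed simp

section \<open>Exponential weights and Chernoff bounds for the window\<close>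

definition mgf :: "(real \<Rightarrow> ennreal) \<Rightarrow> real \<Rightarrow> ennreal" where
  "mgf f \<eta> = (\<integral>\<^sup>+ s. f s * ennreal (exp (\<eta> * s)) \<partial>lborel)"

text \<open>Exponentials are eigenfunctions of convolution with the moment generating function as
  eigenvalue. Every Chernoff bound below dominates a function by such an eigenfunction and
  iterates.\<close>

lemma conv_exp:
  assumes [measurable]: "f \<in> borel_measurable borel"
  shows "conv f (\<lambda>t. ennreal (exp (- (\<eta> * t)))) t = mgf f \<eta> * ennreal (exp (- (\<eta> * t)))"
  unfolding conv_def mgf_def
  by (subst nn_integral_multc[symmetric])
     (auto simp: exp_add[symmetric] mult.assoc ennreal_mult[symmetric] algebra_simps intro!: nn_integral_cong)

lemma conv_pow_exp:
  assumes [measurable]: "f \<in> borel_measurable borel"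
  shows "(conv f ^^ k) (\<lambda>t. ennreal (exp (- (\<eta> * t)))) = (\<lambda>t. mgf f \<eta> ^ k * ennreal (exp (- (\<eta> * t))))"
proof (induction k)
  case (Suc k)
  then show ?case by (simp add: conv_cmult conv_exp mult.assoc mult.left_commute)
qed simp

abbreviation win :: "real \<Rightarrow> real \<Rightarrow> ennreal" where
  "win x \<equiv> indicator {0<..x}"

text \<open>Chernoff bound giving decay in \<open>t\<close>: the window is dominated by a decreasing
  exponential. It controls the finitely many terms split off from the renewal series.\<close>

lemma conv_pow_win_le:
  assumes [measurable]: "f \<in> borel_measurable borel" and "0 \<le> \<eta>"
  shows "(conv f ^^ k) (win x) t \<le> mgf f \<eta> ^ k * ennreal (exp (\<eta> * x - \<eta> * t))"
proof -
  have "win x s \<le> ennreal (exp (\<eta> * x)) * ennreal (exp (- (\<eta> * s)))" for s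
    using assms(2) mult_left_mono[of s x \<eta>]
    by (auto simp: indicator_def ennreal_mult[symmetric] exp_add[symmetric])
  then have "(conv f ^^ k) (win x) t \<le> (conv f ^^ k) (\<lambda>s. ennreal (exp (\<eta> * x)) * ennreal (exp (- (\<eta> * s)))) t"
    by (rule conv_pow_mono)
  also have "\<dots> = mgf f \<eta> ^ k * ennreal (exp (\<eta> * x - \<eta> * t))"
    by (subst conv_pow_cmult, simp_all add: conv_pow_exp)
       (simp add: mult.left_commute[of "ennreal (exp (\<eta> * x))"] ennreal_mult[symmetric] exp_add[symmetric])
  finally show ?thesis .
qed

text \<open>Chernoff bound giving decay in \<open>k\<close>: the window lies in
  \<open>s > 0\<close>, where \<open>exp (\<theta> * s)\<close> is at least 1. The price is growth
  in \<open>t\<close>; the gain is a power of \<open>mgf f (-\<theta>)\<close>, which is below 1 for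
  suitable \<open>\<theta>\<close>.\<close>

lemma conv_pow_win_le':
  assumes [measurable]: "f \<in> borel_measurable borel" and "0 \<le> \<theta>"
  shows "(conv f ^^ k) (win x) t \<le> mgf f (-\<theta>) ^ k * ennreal (exp (\<theta> * t))"
proof -
  have "win x s \<le> ennreal (exp (- ((-\<theta>) * s)))" for s
    using assms(2) by (auto simp: indicator_def )
  then have "(conv f ^^ k) (win x) t \<le> (conv f ^^ k) (\<lambda>s. ennreal (exp (- ((-\<theta>) * s)))) t"
    by (rule conv_pow_mono)
  then show ?thesis by (subst (asm) conv_pow_exp) auto
qed

section \<open>The renewal function\<close>

definition surv :: "(real \<Rightarrow> ennreal) \<Rightarrow> real \<Rightarrow> ennreal" where
  "surv f s = indicator {0..} s * (\<integral>\<^sup>+ u. f u * indicator {s<..} u \<partial>lborel)"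

text \<open>For a density \<open>f\<close>, the summand \<open>(conv f ^^ k) (win x) t\<close> is
  the probability that the sum of \<open>k\<close> independent copies lies in
  \<open>[t - x, t)\<close>, with \<open>k = 0\<close> for the empty sum. The half-open window
  matches the strict inequality in the Shapley value.\<close>

definition renewals :: "(real \<Rightarrow> ennreal) \<Rightarrow> real \<Rightarrow> real \<Rightarrow> ennreal" where
  "renewals f x t = (\<Sum>k. (conv f ^^ k) (win x) t)"

definition nnmean :: "(real \<Rightarrow> ennreal) \<Rightarrow> ennreal" where
  "nnmean f = (\<integral>\<^sup>+ s. f s * ennreal s \<partial>lborel)"

lemma surv_measurable [measurable]:
  assumes [measurable]: "f \<in> borel_measurable borel"
  shows "surv f \<in> borel_measurable borel"
proof -
  have "surv f = (\<lambda>s. indicator {0..} s * (\<integral>\<^sup>+ u. (if s < u then f u else 0) \<partial>lborel))"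
    unfolding surv_def by (intro ext arg_cong2[where f="(*)"] nn_integral_cong) (auto simp: indicator_def)
  moreover have "\<dots> \<in> borel_measurable borel" by measurable
  ultimately show ?thesis by simp
qed

lemma renewals_measurable [measurable]:
  assumes [measurable]: "f \<in> borel_measurable borel"
  shows "renewals f x \<in> borel_measurable borel"
  unfolding renewals_def[abs_def] by measurable

lemma conv_win_heaviside:
  assumes "0 \<le> x"
  shows "conv (win x) (indicator {0..}) t = ennreal (min (max t 0) x)"
proof -
  have "conv (win x) (indicator {0..}) t = (\<integral>\<^sup>+ s. indicator {0<..min x t} s \<partial>lborel)"
    unfolding conv_def by (intro nn_integral_cong) (auto simp: indicator_def)
  also have "\<dots> = ennreal (min (max t 0) x)"
    using assms by (cases "0 \<le> t") (auto simp: min_def max_def)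
  finally show ?thesis .
qed

locale renewal_density =
  fixes f :: "real \<Rightarrow> ennreal"
  assumes f_measurable [measurable]: "f \<in> borel_measurable borel"
    and f_neg: "\<And>t. t < 0 \<Longrightarrow> f t = 0"
    and f_total: "(\<integral>\<^sup>+ t. f t \<partial>lborel) = 1"
begin

text \<open>For \<open>t \<ge> 0\<close> the mass 1 of \<open>f\<close> is split at
  \<open>t\<close>. Read as \<open>b = H - f * H\<close> with the Heaviside function
  \<open>H\<close>, it makes \<open>b\<close> telescope against the renewal series.\<close>

lemma heaviside_decomp: "(indicator {0..} :: real \<Rightarrow> ennreal) = (\<lambda>t. surv f t + conv f (indicator {0..}) t)"
proof
  fix t :: real
  show "(indicator {0..} t :: ennreal) = surv f t + conv f (indicator {0..}) t"
  proof (cases "0 \<le> t")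
    case True
    have "(1::ennreal) = (\<integral>\<^sup>+ u. f u * indicator {t<..} u + f u * indicator {0..} (t - u) \<partial>lborel)"
      unfolding f_total[symmetric] by (intro nn_integral_cong) (auto simp: indicator_def)
    also have "\<dots> = (\<integral>\<^sup>+ u. f u * indicator {t<..} u \<partial>lborel) + (\<integral>\<^sup>+ u. f u * indicator {0..} (t - u) \<partial>lborel)"
      by (rule nn_integral_add) measurable
    finally show ?thesis using True by (simp add: surv_def conv_def)
  next
    case False
    have "conv f (indicator {0..}) t = (\<integral>\<^sup>+ (u::real). 0 \<partial>lborel)"
      unfolding conv_def
      by (rule nn_integral_cong) (use False f_neg in \<open>auto simp: indicator_def\<close>)
    then show ?thesis using False by (simp add: surv_def)
  qed
qed

text \<open>The preceding decomposition is convolved with the window and substituted into itself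
  \<open>K\<close> times. The additive form avoids the truncated subtraction of
  \<open>ennreal\<close>.\<close>

lemma surv_telescope:
  "(\<lambda>t. (\<Sum>k<K. (conv f ^^ k) (conv (surv f) (win x)) t) + (conv f ^^ K) (conv (win x) (indicator {0..})) t)
    = conv (win x) (indicator {0..})"
proof (induction K)
  case (Suc K)
  have eq: "conv (win x) (indicator {0..}) = (\<lambda>t. conv (surv f) (win x) t + conv f (conv (win x) (indicator {0..})) t)"
  proof -
    have "conv (win x) (indicator {0..}) = conv (win x) (\<lambda>t. surv f t + conv f (indicator {0..}) t)"
      using heaviside_decomp by simp
    also have "\<dots> = (\<lambda>t. conv (win x) (surv f) t + conv (win x) (conv f (indicator {0..})) t)"
      by (rule conv_add) measurable
    also have "conv (win x) (surv f) = conv (surv f) (win x)" by (rule conv_commute) measurable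
    also have "conv (win x) (conv f (indicator {0..})) = conv f (conv (win x) (indicator {0..}))"
      using conv_pow_conv[of f "indicator {0..}" "win x" 1] by simp
    finally show ?thesis .
  qed
  have "(conv f ^^ K) (conv (win x) (indicator {0..})) =
        (conv f ^^ K) (\<lambda>t. conv (surv f) (win x) t + conv f (conv (win x) (indicator {0..})) t)"
    using eq by (rule arg_cong)
  also have "\<dots> = (\<lambda>t. (conv f ^^ K) (conv (surv f) (win x)) t + (conv f ^^ K) (conv f (conv (win x) (indicator {0..}))) t)"
    by (rule conv_pow_add) measurable
  finally have *: "(conv f ^^ K) (conv (win x) (indicator {0..})) =
      (\<lambda>t. (conv f ^^ K) (conv (surv f) (win x)) t + (conv f ^^ Suc K) (conv (win x) (indicator {0..})) t)"
    by (simp only: funpow_Suc_right comp_apply)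
  from Suc[unfolded *] show ?case by (simp add: add.assoc)
qed simp

text \<open>In the telescoped identity the remainder tends to 0 like a power of
  \<open>mgf f (-\<theta>)\<close>. From \<open>t = x\<close> on the value is the constant
  \<open>x\<close>, which is how the limit of the renewal function gets identified.\<close>

lemma conv_surv_renewals:
  assumes "0 \<le> \<theta>" "mgf f (-\<theta>) < 1" "0 \<le> x"
  shows "conv (surv f) (renewals f x) t = ennreal (min (max t 0) x)"
proof -
  let ?G = "conv (win x) (indicator {0..})"
  have lim: "(\<lambda>K. (conv f ^^ K) ?G t) \<longlonglongrightarrow> 0"
  proof (rule tendsto_sandwich[of "\<lambda>_. 0"])
    have "?G s \<le> ennreal x * ennreal (exp (- ((-\<theta>) * s)))" for s
      using assms mult_left_mono[of 1 "exp (\<theta> * s)" x]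
      by (cases "0 \<le> s") (auto simp: conv_win_heaviside ennreal_mult[symmetric] min_def max_def intro!: ennreal_leI)
    then have "(conv f ^^ K) ?G t \<le> (conv f ^^ K) (\<lambda>s. ennreal x * ennreal (exp (- ((-\<theta>) * s)))) t" for K
      by (rule conv_pow_mono)
    also have "(conv f ^^ K) (\<lambda>s. ennreal x * ennreal (exp (- ((-\<theta>) * s)))) t
       = ennreal (x * exp (\<theta> * t)) * mgf f (-\<theta>) ^ K" for K
    proof -
      have "(conv f ^^ K) (\<lambda>s. ennreal x * ennreal (exp (- ((-\<theta>) * s))))
        = (\<lambda>s. ennreal x * (conv f ^^ K) (\<lambda>s. ennreal (exp (- ((-\<theta>) * s)))) s)"
        by (rule conv_pow_cmult) measurable
      then have "(conv f ^^ K) (\<lambda>s. ennreal x * ennreal (exp (- ((-\<theta>) * s)))) t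
          = ennreal x * (mgf f (-\<theta>) ^ K * ennreal (exp (\<theta> * t)))"
        by (simp only: conv_pow_exp[OF f_measurable]) simp
      then show ?thesis using assms(3) by (simp only: ennreal_mult exp_ge_zero mult_ac)
    qed
    finally show "\<forall>\<^sub>F K in sequentially. (conv f ^^ K) ?G t \<le> ennreal (x * exp (\<theta> * t)) * mgf f (-\<theta>) ^ K"
      by simp
    obtain r where r: "mgf f (-\<theta>) = ennreal r" "0 \<le> r" "r < 1"
      using assms(2) by (cases "mgf f (-\<theta>)") auto
    have "(\<lambda>K. ennreal (x * exp (\<theta> * t) * r ^ K)) \<longlonglongrightarrow> ennreal (x * exp (\<theta> * t) * 0)"
      using r by (intro tendsto_ennrealI tendsto_mult tendsto_const LIMSEQ_power_zero) auto
    then show "(\<lambda>K. ennreal (x * exp (\<theta> * t)) * mgf f (-\<theta>) ^ K) \<longlonglongrightarrow> 0"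
      using r assms by (simp add: ennreal_mult ennreal_power)
  qed auto
  have "(\<lambda>K. (\<Sum>k<K. (conv f ^^ k) (conv (surv f) (win x)) t) + (conv f ^^ K) ?G t)
      \<longlonglongrightarrow> (\<Sum>k. (conv f ^^ k) (conv (surv f) (win x)) t) + 0"
    by (intro tendsto_add lim summable_LIMSEQ) auto
  moreover have "(\<Sum>k<K. (conv f ^^ k) (conv (surv f) (win x)) t) + (conv f ^^ K) ?G t = ?G t" for K
    using fun_cong[OF surv_telescope[of x K], of t] .
  ultimately have "(\<lambda>K::nat. ?G t) \<longlonglongrightarrow> (\<Sum>k. (conv f ^^ k) (conv (surv f) (win x)) t) + 0"
    by simp
  from LIMSEQ_unique[OF tendsto_const this]
  have "(\<Sum>k. (conv f ^^ k) (conv (surv f) (win x)) t) = ?G t"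
    by (simp only: add_0_right)
  moreover have "conv (surv f) (renewals f x) t = (\<Sum>k. (conv f ^^ k) (conv (surv f) (win x)) t)"
    unfolding renewals_def[abs_def] by (simp add: conv_suminf conv_pow_conv)
  ultimately show ?thesis using assms by (simp add: conv_win_heaviside)
qed

text \<open>Splits off the terms \<open>k \<le> N\<close>. Since \<open>(conv f ^^ N) f\<close>
  contains \<open>N + 1\<close> factors \<open>f\<close>, the exponent \<open>Suc N\<close> appears
  in the estimates that follow.\<close>

lemma renewals_renewal:
  "renewals f x t = (\<Sum>k\<le>N. (conv f ^^ k) (win x) t) + conv ((conv f ^^ N) f) (renewals f x) t"
proof -
  have "conv ((conv f ^^ N) f) (renewals f x) t = (\<Sum>k. conv ((conv f ^^ N) f) ((conv f ^^ k) (win x)) t)"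
    unfolding renewals_def[abs_def] by (simp add: conv_suminf)
  also have "\<dots> = (\<Sum>k. (conv f ^^ (k + Suc N)) (win x) t)"
  proof (rule arg_cong[where f=suminf], rule ext)
    fix k
    have "conv ((conv f ^^ N) f) ((conv f ^^ k) (win x)) = (conv f ^^ Suc N) ((conv f ^^ k) (win x))"
      by (rule conv_pow_Suc_eq[symmetric]) measurable
    then show "conv ((conv f ^^ N) f) ((conv f ^^ k) (win x)) t = (conv f ^^ (k + Suc N)) (win x) t"
      by (metis add.commute comp_apply funpow_add)
  qed
  finally have *: "conv ((conv f ^^ N) f) (renewals f x) t = (\<Sum>k. (conv f ^^ (k + Suc N)) (win x) t)" .
  show ?thesis
    unfolding * unfolding renewals_def
    by (subst suminf_offset[of _ "Suc N"]) (auto simp: add.commute lessThan_Suc_atMost simp del: funpow.simps)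
qed

text \<open>A geometric series with two uses: \<open>n = 0\<close> gives finiteness of the renewal
  function, and \<open>n\<close> the number of agents gives the cost of summing over all
  \<open>k\<close> instead of \<open>k < n\<close>.\<close>

lemma suminf_conv_pow_win_le:
  assumes "0 \<le> \<theta>" "mgf f (-\<theta>) \<le> ennreal r" "0 \<le> r" "r < 1"
  shows "(\<Sum>k. (conv f ^^ (k + n)) (win x) t) \<le> ennreal (exp (\<theta> * t) * r ^ n / (1 - r))"
proof -
  have "(\<Sum>k. (conv f ^^ (k + n)) (win x) t) \<le> (\<Sum>k. ennreal (r ^ (k + n) * exp (\<theta> * t)))"
  proof (intro suminf_le)
    fix k
    have "(conv f ^^ (k + n)) (win x) t \<le> mgf f (-\<theta>) ^ (k + n) * ennreal (exp (\<theta> * t))"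
      using assms by (intro conv_pow_win_le') auto
    also have "\<dots> \<le> ennreal r ^ (k + n) * ennreal (exp (\<theta> * t))"
      using assms by (intro mult_right_mono power_mono) auto
    finally show "(conv f ^^ (k + n)) (win x) t \<le> ennreal (r ^ (k + n) * exp (\<theta> * t))"
      using assms by (simp add: ennreal_mult ennreal_power)
  qed auto
  also have "\<dots> = ennreal (exp (\<theta> * t) * r ^ n / (1 - r))"
  proof (rule suminf_ennreal_eq)
    have "(\<lambda>k. exp (\<theta> * t) * r ^ n * r ^ k) sums (exp (\<theta> * t) * r ^ n * (1 / (1 - r)))"
      using assms by (intro sums_mult geometric_sums) auto
    then show "(\<lambda>k. r ^ (k + n) * exp (\<theta> * t)) sums (exp (\<theta> * t) * r ^ n / (1 - r))"
      by (simp add: power_add mult_ac)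
  qed (use assms in auto)
  finally show ?thesis .
qed

lemma nn_integral_surv: "(\<integral>\<^sup>+ s. surv f s \<partial>lborel) = nnmean f"
proof -
  have "(\<integral>\<^sup>+ s. surv f s \<partial>lborel)
      = (\<integral>\<^sup>+ s. \<integral>\<^sup>+ u. indicator {0..} s * (f u * (if s < u then 1 else 0)) \<partial>lborel \<partial>lborel)"
    unfolding surv_def
    by (intro nn_integral_cong, subst nn_integral_cmult[symmetric])
       (auto simp: indicator_def intro!: nn_integral_cong)
  also have "\<dots> = (\<integral>\<^sup>+ u. \<integral>\<^sup>+ s. indicator {0..} s * (f u * (if s < u then 1 else 0)) \<partial>lborel \<partial>lborel)"
    by (rule lborel_pair.Fubini') measurable
  also have "\<dots> = (\<integral>\<^sup>+ u. f u * (\<integral>\<^sup>+ s. indicator {0..<u} s \<partial>lborel) \<partial>lborel)"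
    by (intro nn_integral_cong, subst nn_integral_cmult[symmetric])
       (auto simp: indicator_def intro!: nn_integral_cong)
  also have "\<dots> = nnmean f"
    unfolding nnmean_def
  proof (rule nn_integral_cong)
    fix u :: real
    show "f u * (\<integral>\<^sup>+ s. indicator {0..<u} s \<partial>lborel) = f u * ennreal u"
      using f_neg[of u] by (cases "0 \<le> u") auto
  qed
  finally show ?thesis .
qed

lemma surv_le:
  assumes "0 \<le> \<eta>"
  shows "surv f s \<le> mgf f \<eta> * ennreal (exp (- \<eta> * s))"
proof -
  have "surv f s \<le> (\<integral>\<^sup>+ u. f u * ennreal (exp (\<eta> * u)) * ennreal (exp (- \<eta> * s)) \<partial>lborel)"
    unfolding surv_def nn_integral_cmult[symmetric]
  proof (cases "0 \<le> s", simp_all, intro nn_integral_mono)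
    fix u
    have "s < u \<Longrightarrow> (1::ennreal) \<le> ennreal (exp (\<eta> * u) * exp (- \<eta> * s))"
      using assms mult_left_mono[of s u \<eta>] by (auto simp: exp_add[symmetric] simp del: ennreal_1 simp: ennreal_1[symmetric] intro!: ennreal_leI)
    then have "s < u \<Longrightarrow> f u * 1 \<le> f u * ennreal (exp (\<eta> * u) * exp (- \<eta> * s))"
      by (intro mult_left_mono) auto
    then show "f u * indicator {s<..} u \<le> f u * ennreal (exp (\<eta> * u)) * ennreal (exp (- (\<eta> * s)))"
      by (auto simp: indicator_def ennreal_mult mult.assoc)
  qed
  also have "\<dots> = mgf f \<eta> * ennreal (exp (- \<eta> * s))"
    unfolding mgf_def by (rule nn_integral_multc) measurable
  finally show ?thesis .
qed

end

section \<open>Contraction of the deviation from the renewal limit\<close>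

text \<open>The supremum \<open>M\<close> of \<open>\<bar>D u\<bar> * exp (\<eta> * u)\<close> over
  \<open>u \<le> t\<close> satisfies \<open>M \<le> R + \<kappa> * M\<close>: the kernel lives on
  \<open>s \<ge> 0\<close>, so the equation only looks back to arguments covered by the same
  supremum. The bound \<open>bdd\<close> is qualitative; it makes \<open>M\<close> finite, so that
  \<open>\<kappa> * M\<close> can be absorbed, and does not enter the result.\<close>

lemma renewal_kernel_contraction:
  fixes D P S :: "real \<Rightarrow> real"
  assumes [measurable]: "D \<in> borel_measurable borel" "P \<in> borel_measurable borel" "S \<in> borel_measurable borel"
    and P0: "\<And>s. s < 0 \<Longrightarrow> P s = 0" and S0: "\<And>s. s < 0 \<Longrightarrow> S s = 0"
    and eq: "\<And>t. D t = r t + (\<integral>s. (P s - S s) * D (t - s) \<partial>lborel)"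
    and r: "\<And>t. \<bar>r t\<bar> \<le> R * exp (- (\<eta> * t))"
    and kernel: "(\<integral>\<^sup>+ s. ennreal (\<bar>P s - S s\<bar> * exp (\<eta> * s)) \<partial>lborel) \<le> ennreal \<kappa>"
    and \<kappa>: "0 \<le> \<kappa>" "\<kappa> < 1"
    and bdd: "\<And>T. \<exists>B. \<forall>t\<le>T. \<bar>D t\<bar> * exp (\<eta> * t) \<le> B"
  shows "\<bar>D t\<bar> \<le> R / (1 - \<kappa>) * exp (- (\<eta> * t))"
proof -
  define M where "M = (SUP u\<in>{..t}. \<bar>D u\<bar> * exp (\<eta> * u))"
  have bd: "bdd_above ((\<lambda>u. \<bar>D u\<bar> * exp (\<eta> * u)) ` {..t})"
    using bdd[of t] by (auto simp: bdd_above_def)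
  have M: "\<bar>D u\<bar> * exp (\<eta> * u) \<le> M" if "u \<le> t" for u
    unfolding M_def by (rule cSUP_upper[OF _ bd]) (use that in auto)
  have M0: "0 \<le> M" using M[of t] by (smt (verit) mult_nonneg_nonneg abs_ge_zero exp_ge_zero)
  have int: "integrable lborel (\<lambda>s. \<bar>P s - S s\<bar> * exp (\<eta> * s))"
    by (rule integrableI_nonneg) (use le_less_trans[OF kernel ennreal_less_top] in \<open>auto\<close>)
  have kint: "(\<integral>s. \<bar>P s - S s\<bar> * exp (\<eta> * s) \<partial>lborel) \<le> \<kappa>"
    using kernel \<kappa> by (subst integral_eq_nn_integral) (auto intro: enn2real_leI)
  have "\<bar>D u\<bar> * exp (\<eta> * u) \<le> R + \<kappa> * M" if u: "u \<le> t" for u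
  proof -
    have "\<bar>\<integral>s. (P s - S s) * D (u - s) \<partial>lborel\<bar> \<le> (\<integral>s. M * exp (- (\<eta> * u)) * (\<bar>P s - S s\<bar> * exp (\<eta> * s)) \<partial>lborel)"
    proof (rule integral_abs_bound_integral)
      have *: "\<bar>(P s - S s) * D (u - s)\<bar> \<le> M * exp (- (\<eta> * u)) * (\<bar>P s - S s\<bar> * exp (\<eta> * s))" for s
      proof (cases "s < 0")
        case False
        then have "\<bar>D (u - s)\<bar> * exp (\<eta> * (u - s)) * exp (- (\<eta> * (u - s))) \<le> M * exp (- (\<eta> * (u - s)))"
          using u by (intro mult_right_mono M) auto
        then have "\<bar>D (u - s)\<bar> \<le> M * exp (- (\<eta> * u)) * exp (\<eta> * s)"
          by (simp add: exp_add[symmetric] mult.assoc algebra_simps)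
        then have "\<bar>P s - S s\<bar> * \<bar>D (u - s)\<bar> \<le> \<bar>P s - S s\<bar> * (M * exp (- (\<eta> * u)) * exp (\<eta> * s))"
          by (intro mult_left_mono) auto
        then show ?thesis by (simp add: abs_mult mult_ac)
      qed (simp add: P0 S0)
      show "\<bar>(P s - S s) * D (u - s)\<bar> \<le> M * exp (- (\<eta> * u)) * (\<bar>P s - S s\<bar> * exp (\<eta> * s))" for s by (rule *)
      show i2: "integrable lborel (\<lambda>s. M * exp (- (\<eta> * u)) * (\<bar>P s - S s\<bar> * exp (\<eta> * s)))"
        using int by simp
      show "integrable lborel (\<lambda>s. (P s - S s) * D (u - s))"
        using * by (intro Bochner_Integration.integrable_bound[OF i2]) (auto intro: order_trans[OF _ abs_ge_self])
    qed
    also have "\<dots> = M * exp (- (\<eta> * u)) * (\<integral>s. \<bar>P s - S s\<bar> * exp (\<eta> * s) \<partial>lborel)" by simp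
    also have "\<dots> \<le> M * exp (- (\<eta> * u)) * \<kappa>"
      using M0 kint by (intro mult_left_mono) auto
    finally have "\<bar>D u\<bar> \<le> (R + \<kappa> * M) * exp (- (\<eta> * u))"
      using eq[of u] r[of u] by (simp add: algebra_simps)
    then have "\<bar>D u\<bar> * exp (\<eta> * u) \<le> (R + \<kappa> * M) * exp (- (\<eta> * u)) * exp (\<eta> * u)"
      by (intro mult_right_mono) auto
    then show ?thesis by (simp add: mult.assoc exp_add[symmetric])
  qed
  then have "M \<le> R + \<kappa> * M"
    unfolding M_def by (intro cSUP_least) auto
  then have "M \<le> R / (1 - \<kappa>)"
    using \<kappa> by (simp add: field_simps)
  with M[of t] have "\<bar>D t\<bar> * exp (\<eta> * t) \<le> R / (1 - \<kappa>)" by simp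
  then have "\<bar>D t\<bar> * exp (\<eta> * t) * exp (- (\<eta> * t)) \<le> R / (1 - \<kappa>) * exp (- (\<eta> * t))"
    by (intro mult_right_mono) auto
  then show ?thesis by (simp add: mult.assoc exp_add[symmetric])
qed

text \<open>Each convolution adds \<open>{p..q}\<close> to the current interval. Giving up
  \<open>\<delta>\<close> at both ends leaves an overlap of length at least \<open>\<delta>\<close>
  in the convolution integral, hence a factor \<open>c0 * \<delta>\<close> per step. The interval
  reached has length \<open>4 * \<delta> + 2 * \<delta> * N\<close>, so it exceeds any prescribed
  length for large \<open>N\<close>.\<close>

lemma conv_pow_minorant:
  fixes f :: "real \<Rightarrow> ennreal" and p q c0 :: real
  assumes [measurable]: "f \<in> borel_measurable borel"
    and pq: "p < q" "0 \<le> c0" and lb: "\<And>s. s \<in> {p..q} \<Longrightarrow> ennreal c0 \<le> f s"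
  defines "\<delta> \<equiv> (q - p) / 4"
  shows "s \<in> {p + real N * (p + \<delta>) .. q + real N * (q - \<delta>)} \<Longrightarrow> ennreal (c0 * (c0 * \<delta>) ^ N) \<le> (conv f ^^ N) f s"
proof (induction N arbitrary: s)
  case 0
  then show ?case using lb by simp
next
  case (Suc N)
  define a b c where "a = p + real N * (p + \<delta>)" and "b = q + real N * (q - \<delta>)" and "c = c0 * (c0 * \<delta>) ^ N"
  have \<delta>: "0 < \<delta>" "q - p = 4 * \<delta>" using pq by (auto simp: \<delta>_def)
  have c: "0 \<le> c" using pq \<delta> by (auto simp: c_def)
  \<comment> \<open>For \<open>u\<close> between \<open>l\<close> and \<open>h\<close> both factors
    of the convolution integrand are covered by their lower bounds.\<close>
  define l h where "l = max p (s - b)" and "h = min q (s - a)"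
  have s: "a + p + \<delta> \<le> s" "s \<le> b + q - \<delta>" using Suc.prems by (auto simp: a_def b_def algebra_simps)
  have "b - a = (q - p) + real N * (2 * \<delta>)" unfolding a_def b_def using \<delta> by (simp add: algebra_simps)
  then have ba: "b - a \<ge> \<delta>" using \<delta> by (simp add: mult_nonneg_nonneg)
  have lh: "h - l \<ge> \<delta>" using s ba \<delta> unfolding l_def h_def by linarith
  have "ennreal (c0 * (c0 * \<delta>) ^ Suc N) \<le> ennreal (c0 * c) * ennreal (h - l)"
  proof -
    have "c0 * c * \<delta> \<le> c0 * c * (h - l)" using lh pq c by (intro mult_left_mono) auto
    then show ?thesis using lh pq c \<delta>
      by (subst ennreal_mult[symmetric]) (auto simp: c_def mult_ac intro!: ennreal_leI)
  qed
  also have "\<dots> = (\<integral>\<^sup>+ u. ennreal (c0 * c) * indicator {l..h} u \<partial>lborel)"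
    using lh \<delta> by (subst nn_integral_cmult_indicator) auto
  also have "\<dots> \<le> (\<integral>\<^sup>+ u. f u * (conv f ^^ N) f (s - u) \<partial>lborel)"
  proof (rule nn_integral_mono)
    fix u
    show "ennreal (c0 * c) * indicator {l..h} u \<le> f u * (conv f ^^ N) f (s - u)"
    proof (cases "u \<in> {l..h}")
      case True
      then have "ennreal c0 \<le> f u" by (intro lb) (auto simp: l_def h_def)
      moreover have "ennreal c \<le> (conv f ^^ N) f (s - u)"
        unfolding c_def by (rule Suc.IH) (use True in \<open>auto simp: l_def h_def a_def b_def\<close>)
      ultimately show ?thesis using True pq c by (simp add: ennreal_mult mult_mono)
    qed simp
  qed
  finally show ?case by (simp add: conv_def[of f _ s])
qed

context renewal_density
begin

lemma conv_pow_neg: "t < 0 \<Longrightarrow> (conv f ^^ k) f t = 0"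
proof (induction k arbitrary: t)
  case (Suc k)
  have "f s * (conv f ^^ k) f (t - s) = 0" for s
    using Suc f_neg[of s] by (cases "s < 0") auto
  then have "(\<lambda>s. f s * (conv f ^^ k) f (t - s)) = (\<lambda>_. 0)" by blast
  then have "conv f ((conv f ^^ k) f) t = 0" unfolding conv_def[of f _ t] by (simp only: nn_integral_const) simp
  then show ?case by simp
qed (simp add: f_neg)

lemma mgf_zero: "mgf f 0 = 1"
  by (simp add: mgf_def f_total)

lemma mgf_conv_pow: "mgf ((conv f ^^ N) f) \<eta> = mgf f \<eta> ^ Suc N"
proof -
  have "conv ((conv f ^^ N) f) (\<lambda>t. ennreal (exp (- (\<eta> * t)))) = (\<lambda>t. mgf f \<eta> ^ Suc N * ennreal (exp (- (\<eta> * t))))"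
    by (simp add: conv_pow_Suc_eq[symmetric] conv_pow_exp del: funpow.simps power_Suc)
  from fun_cong[OF this, of 0] show ?thesis
    by (simp add: conv_def mgf_def)
qed

lemma surv_le_1: "surv f s \<le> 1"
  using surv_le[of 0 s] by (simp add: mgf_zero)

text \<open>In \<open>\<kappa>\<close>, the power of \<open>\<phi>\<close> bounds the tilted mass of
  the convolution power, \<open>c * \<mu>\<close> is the mass of the subtracted kernel, and the
  \<open>\<tau>\<close> term pays for the part of that kernel beyond \<open>y + L\<close>, once
  without and once with the tilt. The parameters \<open>\<theta>\<close> and \<open>r\<close> ensure
  finiteness and are absent from the conclusion, so they may depend on the density without harming
  uniformity.\<close>

lemma renewal_error_bound:
  fixes x \<theta> \<mu> r \<eta> \<phi> c y L \<tau> :: real and N :: nat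
  assumes x: "0 \<le> x" and \<theta>: "0 \<le> \<theta>" "mgf f (-\<theta>) \<le> ennreal r" "0 \<le> r" "r < 1"
    and \<mu>: "nnmean f = ennreal \<mu>" "0 < \<mu>"
    and \<phi>: "0 < \<eta>" "mgf f \<eta> \<le> ennreal \<phi>" "0 \<le> \<phi>"
    and minor: "0 < c" "0 \<le> y" "0 \<le> L" "\<And>s. s \<in> {y..y+L} \<Longrightarrow> ennreal c \<le> (conv f ^^ N) f s"
    and tail: "(\<integral>\<^sup>+ s. surv f s * indicator {L<..} s * ennreal (exp (\<eta> * s)) \<partial>lborel) \<le> ennreal \<tau>" "0 \<le> \<tau>"
  defines "\<kappa> \<equiv> \<phi> ^ Suc N - c * \<mu> + c * (1 + exp (\<eta> * y)) * \<tau>"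
  assumes \<kappa>1: "\<kappa> < 1"
  shows "\<bar>enn2real (renewals f x t) - x / \<mu>\<bar>
     \<le> ((\<Sum>k\<le>N. \<phi> ^ k) + c * x * exp (\<eta> * y)) * exp (\<eta> * x) / (1 - \<kappa>) * exp (- (\<eta> * t))"
proof -
  define p where "p = (conv f ^^ N) f"
  have p_meas[measurable]: "p \<in> borel_measurable borel" unfolding p_def by measurable
  define P S Z where "P s = enn2real (p s)" and "S s = c * enn2real (surv f (s - y))" and "Z t = enn2real (renewals f x t)" for s t
  define D where "D t = Z t - x / \<mu>" for t
  define A where "A k t = enn2real ((conv f ^^ k) (win x) t)" for k t
  \<comment> \<open>The sum consists of the terms split off by \<open>renewals_renewal\<close>. The
    second part is the defect of the shifted identity \<open>b * D = 0\<close>; it vanishes for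
    \<open>t \<ge> x + y\<close>, hence is bounded by any decaying exponential at the cost of a
    constant.\<close>
  define \<rho> where "\<rho> t = (\<Sum>k\<le>N. A k t) + c * (min (max (t - y) 0) x - x)" for t
  have ms[measurable]: "P \<in> borel_measurable borel" "S \<in> borel_measurable borel" "Z \<in> borel_measurable borel"
      "D \<in> borel_measurable borel"
    unfolding P_def[abs_def] S_def[abs_def] Z_def[abs_def] D_def[abs_def] by measurable
  have Pnn: "0 \<le> P s" and Snn: "0 \<le> S s" and Znn: "0 \<le> Z s" for s
    using minor by (auto simp: P_def S_def Z_def)
  have mgf_p: "(\<integral>\<^sup>+ s. p s * ennreal (exp (\<eta> * s)) \<partial>lborel) \<le> ennreal (\<phi> ^ Suc N)"
    using mgf_conv_pow[of N \<eta>] power_mono[OF \<phi>(2), of "Suc N"] \<phi>(3) by (simp add: mgf_def p_def ennreal_power[symmetric] del: power_Suc)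
  have p1: "(\<integral>\<^sup>+ s. p s \<partial>lborel) = 1"
    using mgf_conv_pow[of N 0] by (simp add: mgf_zero) (simp add: mgf_def p_def)
  have AEp: "AE s in lborel. p s = ennreal (P s)"
  proof -
    have "AE s in lborel. p s \<noteq> \<infinity>" by (rule nn_integral_noteq_infinite) (auto simp: p1)
    then show ?thesis by eventually_elim (auto simp: P_def less_top)
  qed
  have S_eq: "ennreal (S s) = ennreal c * surv f (s - y)" for s
    using le_less_trans[OF surv_le_1[of "s - y"] ennreal_one_less_top] minor
    by (simp add: S_def ennreal_mult ennreal_enn2real)
  have renewals_le: "renewals f x t \<le> ennreal (exp (\<theta> * t) / (1 - r))" for t
    using suminf_conv_pow_win_le[OF \<theta>, of 0 x t] by (simp add: renewals_def)
  have renewals_eq: "renewals f x t = ennreal (Z t)" for t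
    using le_less_trans[OF renewals_le[of t] ennreal_less_top] by (simp add: Z_def ennreal_enn2real)
  have Z_le: "Z t \<le> exp (\<theta> * t) / (1 - r)" for t
    using renewals_le[of t] \<theta> by (simp add: renewals_eq ennreal_le_iff)
  have A_le: "(conv f ^^ k) (win x) t \<le> ennreal (\<phi> ^ k * exp (\<eta> * x - \<eta> * t))" for k t
  proof -
    have "(conv f ^^ k) (win x) t \<le> mgf f \<eta> ^ k * ennreal (exp (\<eta> * x - \<eta> * t))"
      using \<phi> by (intro conv_pow_win_le) auto
    also have "\<dots> \<le> ennreal \<phi> ^ k * ennreal (exp (\<eta> * x - \<eta> * t))"
      using \<phi> by (intro mult_right_mono power_mono) auto
    finally show ?thesis using \<phi> by (simp add: ennreal_mult ennreal_power)
  qed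
  have A_eq: "(conv f ^^ k) (win x) t = ennreal (A k t)" for k t
    using le_less_trans[OF A_le[of k t] ennreal_less_top] by (simp add: A_def ennreal_enn2real)
  have A_nn: "0 \<le> A k t" for k t by (simp add: A_def)
  have A_le': "A k t \<le> \<phi> ^ k * exp (\<eta> * x - \<eta> * t)" for k t
    using A_le[of k t] \<phi> by (simp add: A_eq ennreal_le_iff)
  have PZ: "(\<integral>\<^sup>+ s. ennreal (P s * Z (t - s)) \<partial>lborel) = ennreal (Z t - (\<Sum>k\<le>N. A k t))"
    and ZA: "(\<Sum>k\<le>N. A k t) \<le> Z t" for t
  proof -
    have "(\<integral>\<^sup>+ s. ennreal (P s * Z (t - s)) \<partial>lborel) = conv p (renewals f x) t"
      unfolding conv_def using AEp Pnn Znn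
      by (intro nn_integral_cong_AE) (auto simp: ennreal_mult renewals_eq elim!: eventually_mono)
    moreover have *: "ennreal (Z t) = ennreal (\<Sum>k\<le>N. A k t) + conv p (renewals f x) t"
      using renewals_renewal[of x t N] by (simp add: renewals_eq[symmetric] A_eq p_def A_nn sum_ennreal)
    ultimately show "(\<integral>\<^sup>+ s. ennreal (P s * Z (t - s)) \<partial>lborel) = ennreal (Z t - (\<Sum>k\<le>N. A k t))"
      by (simp add: ennreal_minus[symmetric] sum_nonneg A_nn)
    show "(\<Sum>k\<le>N. A k t) \<le> Z t"
      using * Znn by (metis ennreal_le_iff le_iff_add)
  qed
  have SZ: "(\<integral>\<^sup>+ s. ennreal (S s * Z (t - s)) \<partial>lborel) = ennreal (c * min (max (t - y) 0) x)" for t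
  proof -
    have "(\<integral>\<^sup>+ s. ennreal (S s * Z (t - s)) \<partial>lborel) = (\<integral>\<^sup>+ s. (\<lambda>s. ennreal c * (surv f s * renewals f x (t - y - s))) (s - y) \<partial>lborel)"
      using Snn Znn by (intro nn_integral_cong) (simp add: ennreal_mult S_eq renewals_eq mult.assoc)
    also have "\<dots> = (\<integral>\<^sup>+ s. ennreal c * (surv f s * renewals f x (t - y - s)) \<partial>lborel)"
      by (rule nn_integral_shift) measurable
    also have "\<dots> = ennreal c * conv (surv f) (renewals f x) (t - y)"
      unfolding conv_def by (rule nn_integral_cmult) measurable
    also have "conv (surv f) (renewals f x) (t - y) = ennreal (min (max (t - y) 0) x)"
      by (rule conv_surv_renewals[OF \<theta>(1) _ x]) (use \<theta> in \<open>auto intro: le_less_trans simp: ennreal_less_one_iff\<close>)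
    finally show ?thesis using minor x by (simp add: ennreal_mult)
  qed
  have P1: "(\<integral>\<^sup>+ s. ennreal (P s) \<partial>lborel) = 1"
    using p1 nn_integral_cong_AE[OF AEp] by simp
  have S1: "(\<integral>\<^sup>+ s. ennreal (S s) \<partial>lborel) = ennreal (c * \<mu>)"
  proof -
    have "(\<integral>\<^sup>+ s. ennreal (S s) \<partial>lborel) = ennreal c * (\<integral>\<^sup>+ s. surv f (s - y) \<partial>lborel)"
      unfolding S_eq by (rule nn_integral_cmult) measurable
    also have "(\<integral>\<^sup>+ s. surv f (s - y) \<partial>lborel) = (\<integral>\<^sup>+ s. surv f s \<partial>lborel)"
      by (rule nn_integral_shift) measurable
    finally show ?thesis using \<mu> minor by (simp add: nn_integral_surv ennreal_mult)
  qed
  have ints: "integrable lborel P" "integrable lborel S"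
     "integrable lborel (\<lambda>s. P s * Z (t - s))" "integrable lborel (\<lambda>s. S s * Z (t - s))" for t
    by (rule integrableI_nonneg; use Pnn Snn Znn P1 S1 PZ SZ in auto)+
  have "(\<integral>s. P s \<partial>lborel) = 1" "(\<integral>s. S s \<partial>lborel) = c * \<mu>"
     "(\<integral>s. P s * Z (t - s) \<partial>lborel) = Z t - (\<Sum>k\<le>N. A k t)"
     "(\<integral>s. S s * Z (t - s) \<partial>lborel) = c * min (max (t - y) 0) x" for t
    using minor \<mu> x ZA by (subst integral_eq_nn_integral; auto simp: Pnn Snn Znn P1 S1 PZ SZ)+
  note vals = this
  \<comment> \<open>The constant \<open>x / \<mu>\<close> integrates to
    \<open>(x / \<mu>) * (c * \<mu>) = c * x\<close> against \<open>S\<close>, which cancels the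
    \<open>- c * x\<close> inside \<open>\<rho>\<close>. No other constant would do.\<close>
  have D_eq: "D t = \<rho> t + (\<integral>s. (P s - S s) * D (t - s) \<partial>lborel)" for t
  proof -
    have "(\<integral>s. (P s - S s) * D (t - s) \<partial>lborel)
      = (\<integral>s. (P s * Z (t - s) - S s * Z (t - s)) - (x / \<mu>) * P s + (x / \<mu>) * S s \<partial>lborel)"
      by (intro Bochner_Integration.integral_cong) (auto simp: D_def algebra_simps)
    also have "\<dots> = (Z t - (\<Sum>k\<le>N. A k t)) - c * min (max (t - y) 0) x - (x / \<mu>) * 1 + (x / \<mu>) * (c * \<mu>)"
      using ints by (simp add: vals)
    finally show ?thesis using \<mu> by (simp add: D_def \<rho>_def algebra_simps)
  qed
  define R where "R = ((\<Sum>k\<le>N. \<phi> ^ k) + c * x * exp (\<eta> * y)) * exp (\<eta> * x)"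
  have r_le: "\<bar>\<rho> t\<bar> \<le> R * exp (- (\<eta> * t))" for t
  proof -
    have "(\<Sum>k\<le>N. A k t) \<le> (\<Sum>k\<le>N. \<phi> ^ k) * exp (\<eta> * x - \<eta> * t)"
      unfolding sum_distrib_right by (intro sum_mono A_le')
    moreover have "0 \<le> (\<Sum>k\<le>N. A k t)" by (intro sum_nonneg A_nn)
    moreover have "\<bar>min (max (t - y) 0) x - x\<bar> \<le> x * exp (\<eta> * y + \<eta> * x - \<eta> * t)"
    proof (cases "t - y \<ge> x")
      case True
      then have "min (max (t - y) 0) x = x" using x by auto
      then show ?thesis using x by simp
    next
      case False
      then have "0 \<le> \<eta> * (y + x - t)" using \<phi> by (intro mult_nonneg_nonneg) auto
      then have "1 \<le> exp (\<eta> * y + \<eta> * x - \<eta> * t)" by (simp add: algebra_simps)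
      then have "x * 1 \<le> x * exp (\<eta> * y + \<eta> * x - \<eta> * t)" using x by (intro mult_left_mono) auto
      then show ?thesis using x by (auto simp: min_def max_def)
    qed
    then have "\<bar>c * (min (max (t - y) 0) x - x)\<bar> \<le> c * (x * exp (\<eta> * y + \<eta> * x - \<eta> * t))"
      using minor by (simp add: abs_mult)
    ultimately show ?thesis
      unfolding \<rho>_def R_def by (simp add: algebra_simps exp_add exp_diff exp_minus inverse_eq_divide)
  qed
  let ?K = "(\<integral>\<^sup>+ s. ennreal (\<bar>P s - S s\<bar> * exp (\<eta> * s)) \<partial>lborel)"
  \<comment> \<open>This is the bound of the kernel by \<open>\<kappa>\<close> with
    \<open>c * \<mu>\<close> moved to the left, because subtraction in \<open>ennreal\<close> is
    truncated; \<open>kern'\<close> moves it back once \<open>\<kappa>\<close> is known to be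
    non-negative.\<close>
  have kern: "?K + ennreal (c * \<mu>)
      \<le> ennreal (\<phi> ^ Suc N + c * (1 + exp (\<eta> * y)) * \<tau>)"
  proof -
    let ?T = "\<lambda>s. surv f s * indicator {L<..} s * ennreal (exp (\<eta> * s))"
    let ?I = "\<lambda>s. indicator {y..y+L} s :: ennreal" and ?J = "\<lambda>s. indicator {y+L<..} s :: ennreal"
    \<comment> \<open>Three ranges: below \<open>y\<close> the function \<open>S\<close> vanishes.
      On \<open>{y..y+L}\<close> one has \<open>S \<le> c \<le> P\<close>, so the absolute value is
      \<open>P - S\<close> and the mass of \<open>S\<close> is gained, as
      \<open>exp (\<eta> * s) \<ge> 1\<close>. Beyond \<open>y + L\<close> the triangle inequality
      is enough, and the tilted \<open>S\<close> is charged to the tail.\<close>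
    have a1: "(\<integral>\<^sup>+ s. ennreal (\<bar>P s - S s\<bar> * exp (\<eta> * s)) + ennreal (S s) * ?I s \<partial>lborel)
       \<le> (\<integral>\<^sup>+ s. p s * ennreal (exp (\<eta> * s)) + ennreal (c * exp (\<eta> * y)) * ?T (s - y) \<partial>lborel)"
    proof (intro nn_integral_mono_AE, use AEp in eventually_elim)
      fix s assume ps: "p s = ennreal (P s)"
      have S0: "S s = 0" if "s < y" using that by (simp add: S_def surv_def)
      have T: "ennreal (c * exp (\<eta> * y)) * ?T (s - y) = ennreal (S s * exp (\<eta> * s)) * ?J s"
      proof -
        have "c * exp (\<eta> * y) * exp (\<eta> * (s - y)) = c * exp (\<eta> * s)"
          by (simp add: mult.assoc exp_add[symmetric] right_diff_distrib)
        then have e: "ennreal (c * exp (\<eta> * y)) * ennreal (exp (\<eta> * (s - y))) = ennreal c * ennreal (exp (\<eta> * s))"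
          using minor(1) by (simp add: ennreal_mult[symmetric])
        have "ennreal (c * exp (\<eta> * y)) * ?T (s - y)
            = surv f (s - y) * indicator {L<..} (s - y) * (ennreal (c * exp (\<eta> * y)) * ennreal (exp (\<eta> * (s - y))))"
          by (simp only: mult_ac)
        also have "\<dots> = ennreal c * surv f (s - y) * ennreal (exp (\<eta> * s)) * ?J s"
          unfolding e by (simp add: indicator_def mult_ac)
        finally show ?thesis using Snn[of s] by (simp add: ennreal_mult S_eq)
      qed
      consider "s < y" | "s \<in> {y..y+L}" | "s > y + L" by fastforce
      then show "ennreal (\<bar>P s - S s\<bar> * exp (\<eta> * s)) + ennreal (S s) * ?I s
         \<le> p s * ennreal (exp (\<eta> * s)) + ennreal (c * exp (\<eta> * y)) * ?T (s - y)"
      proof cases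
        case 1
        then show ?thesis unfolding T using Pnn S0 minor(2,3) by (simp add: ps ennreal_mult indicator_def)
      next
        case 2
        have "surv f (s - y) \<le> 1" by (rule surv_le_1)
        then have "S s \<le> c" using minor unfolding S_def by (auto simp: enn2real_leI intro!: mult_left_le)
        moreover have "c \<le> P s" using minor(4)[OF 2] ps Pnn minor(1) by (simp add: p_def ennreal_le_iff)
        ultimately have SP: "S s \<le> P s" by simp
        have "1 \<le> exp (\<eta> * s)" using 2 \<phi> minor by simp
        then have "S s * 1 \<le> S s * exp (\<eta> * s)" using Snn by (intro mult_left_mono) auto
        then have "\<bar>P s - S s\<bar> * exp (\<eta> * s) + S s \<le> P s * exp (\<eta> * s)" using SP by (simp add: algebra_simps)
        then have "ennreal (\<bar>P s - S s\<bar> * exp (\<eta> * s)) + ennreal (S s) \<le> ennreal (P s * exp (\<eta> * s))"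
          using Snn[of s] by (simp add: ennreal_leI del: ennreal_plus flip: ennreal_plus)
        then show ?thesis unfolding T using 2 Pnn by (simp add: ps ennreal_mult)
      next
        case 3
        have "\<bar>P s - S s\<bar> \<le> P s + S s" using Pnn[of s] Snn[of s] by simp
        then have "\<bar>P s - S s\<bar> * exp (\<eta> * s) \<le> (P s + S s) * exp (\<eta> * s)" by (intro mult_right_mono) auto
        then have "ennreal (\<bar>P s - S s\<bar> * exp (\<eta> * s)) \<le> ennreal (P s * exp (\<eta> * s)) + ennreal (S s * exp (\<eta> * s))"
          using Snn[of s] Pnn[of s] by (simp add: ennreal_leI distrib_right del: ennreal_plus flip: ennreal_plus)
        then show ?thesis unfolding T using 3 Pnn by (simp add: ps ennreal_mult)
      qed
    qed
    have a2: "(\<integral>\<^sup>+ s. p s * ennreal (exp (\<eta> * s)) + ennreal (c * exp (\<eta> * y)) * ?T (s - y) \<partial>lborel)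
       \<le> ennreal (\<phi> ^ Suc N) + ennreal (c * exp (\<eta> * y)) * ennreal \<tau>"
    proof (subst nn_integral_add)
      have "(\<integral>\<^sup>+ s. ennreal (c * exp (\<eta> * y)) * ?T (s - y) \<partial>lborel) = ennreal (c * exp (\<eta> * y)) * (\<integral>\<^sup>+ s. ?T (s - y) \<partial>lborel)"
        by (rule nn_integral_cmult) measurable
      also have "(\<integral>\<^sup>+ s. ?T (s - y) \<partial>lborel) = (\<integral>\<^sup>+ s. ?T s \<partial>lborel)"
        by (rule nn_integral_shift) measurable
      finally show "(\<integral>\<^sup>+ s. p s * ennreal (exp (\<eta> * s)) \<partial>lborel) + (\<integral>\<^sup>+ s. ennreal (c * exp (\<eta> * y)) * ?T (s - y) \<partial>lborel)
         \<le> ennreal (\<phi> ^ Suc N) + ennreal (c * exp (\<eta> * y)) * ennreal \<tau>"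
        using mgf_p tail(1) by (auto intro!: add_mono mult_left_mono)
    qed measurable
    \<comment> \<open>All but at most \<open>c * \<tau>\<close> of the mass of \<open>S\<close> lies
      in \<open>{y..y+L}\<close>, so the gain in \<open>a1\<close> is nearly all of
      \<open>c * \<mu>\<close>.\<close>
    have a3: "ennreal (c * \<mu>) \<le> (\<integral>\<^sup>+ s. ennreal (S s) * ?I s \<partial>lborel) + ennreal c * ennreal \<tau>"
    proof -
      have "ennreal (c * \<mu>) \<le> (\<integral>\<^sup>+ s. ennreal (S s) * ?I s + ennreal c * ?T (s - y) \<partial>lborel)"
        unfolding S1[symmetric]
      proof (rule nn_integral_mono)
        fix s
        consider "s < y" | "s \<in> {y..y+L}" | "s > y + L" by fastforce
        then show "ennreal (S s) \<le> ennreal (S s) * ?I s + ennreal c * ?T (s - y)"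
        proof cases
          case 1 then show ?thesis by (simp add: S_def surv_def)
        next
          case 2 then show ?thesis by simp
        next
          case 3
          have "(1::ennreal) \<le> ennreal (exp (\<eta> * (s - y)))"
            using 3 \<phi> minor by (simp add: mult_nonneg_nonneg)
          then have "ennreal c * surv f (s - y) * 1 \<le> ennreal c * surv f (s - y) * ennreal (exp (\<eta> * (s - y)))"
            by (intro mult_left_mono) auto
          then show ?thesis using 3 by (simp add: S_eq mult.assoc)
        qed
      qed
      also have "\<dots> = (\<integral>\<^sup>+ s. ennreal (S s) * ?I s \<partial>lborel) + (\<integral>\<^sup>+ s. ennreal c * ?T (s - y) \<partial>lborel)"
        by (rule nn_integral_add) measurable
      also have "(\<integral>\<^sup>+ s. ennreal c * ?T (s - y) \<partial>lborel) = ennreal c * (\<integral>\<^sup>+ s. ?T (s - y) \<partial>lborel)"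
        by (rule nn_integral_cmult) measurable
      also have "(\<integral>\<^sup>+ s. ?T (s - y) \<partial>lborel) = (\<integral>\<^sup>+ s. ?T s \<partial>lborel)"
        by (rule nn_integral_shift) measurable
      also have "(\<integral>\<^sup>+ s. ennreal (S s) * ?I s \<partial>lborel) + ennreal c * (\<integral>\<^sup>+ s. ?T s \<partial>lborel)
          \<le> (\<integral>\<^sup>+ s. ennreal (S s) * ?I s \<partial>lborel) + ennreal c * ennreal \<tau>"
        using tail(1) by (intro add_mono mult_left_mono) auto
      finally show ?thesis .
    qed
    have a0: "(\<integral>\<^sup>+ s. ennreal (\<bar>P s - S s\<bar> * exp (\<eta> * s)) + ennreal (S s) * ?I s \<partial>lborel)
      = ?K + (\<integral>\<^sup>+ s. ennreal (S s) * ?I s \<partial>lborel)"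
      by (rule nn_integral_add) measurable
    have "?K + ennreal (c * \<mu>)
      \<le> ?K + ((\<integral>\<^sup>+ s. ennreal (S s) * ?I s \<partial>lborel) + ennreal c * ennreal \<tau>)"
      by (intro add_left_mono a3)
    also have "\<dots> \<le> ennreal (\<phi> ^ Suc N) + ennreal (c * exp (\<eta> * y)) * ennreal \<tau> + ennreal c * ennreal \<tau>"
      using order_trans[OF a1 a2] unfolding a0 add.assoc[symmetric] by (rule add_right_mono)
    also have "\<dots> = ennreal (\<phi> ^ Suc N + c * (1 + exp (\<eta> * y)) * \<tau>)"
      using \<phi> minor tail(2) by (simp add: ennreal_mult[symmetric] algebra_simps del: power_Suc flip: ennreal_plus)
    finally show ?thesis .
  qed
  have le0: "ennreal (c * \<mu>) \<le> ennreal (\<phi> ^ Suc N + c * (1 + exp (\<eta> * y)) * \<tau>)"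
    using kern by (rule order_trans[rotated]) simp
  have sum0: "0 \<le> \<phi> ^ Suc N + c * (1 + exp (\<eta> * y)) * \<tau>"
    using \<phi> minor tail(2) by (intro add_nonneg_nonneg mult_nonneg_nonneg) (auto intro: add_nonneg_nonneg)
  have \<kappa>0: "0 \<le> \<kappa>"
    using le0 sum0 by (simp add: \<kappa>_def ennreal_le_iff del: power_Suc)
  have kern': "?K \<le> ennreal \<kappa>"
  proof -
    have "\<phi> ^ Suc N + c * (1 + exp (\<eta> * y)) * \<tau> = \<kappa> + c * \<mu>" by (simp add: \<kappa>_def)
    then have "?K + ennreal (c * \<mu>) \<le> ennreal \<kappa> + ennreal (c * \<mu>)"
      using kern \<kappa>0 minor \<mu> by (simp del: power_Suc flip: ennreal_plus)
    then show ?thesis by (simp add: ennreal_add_left_cancel_le add.commute)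
  qed
  have "\<bar>D t\<bar> \<le> R / (1 - \<kappa>) * exp (- (\<eta> * t))"
  proof (rule renewal_kernel_contraction[where D=D and P=P and S=S and r=\<rho> and R=R and \<kappa>=\<kappa> and \<eta>=\<eta>])
    show "P s = 0" if "s < 0" for s using that by (simp add: P_def p_def conv_pow_neg)
    show "S s = 0" if "s < 0" for s using that minor by (simp add: S_def surv_def)
    show "\<exists>B. \<forall>t\<le>T. \<bar>D t\<bar> * exp (\<eta> * t) \<le> B" for T
    proof (intro exI allI impI)
      fix t assume t: "t \<le> T"
      have "\<bar>D t\<bar> \<le> Z t + x / \<mu>" using Znn[of t] x \<mu> by (simp add: D_def abs_le_iff)
      also have "Z t \<le> exp (\<theta> * T) / (1 - r)"
        using Z_le[of t] t \<theta> by (smt (verit) divide_right_mono exp_le_cancel_iff mult_left_mono)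
      finally have "\<bar>D t\<bar> \<le> exp (\<theta> * T) / (1 - r) + x / \<mu>" by simp
      then show "\<bar>D t\<bar> * exp (\<eta> * t) \<le> (exp (\<theta> * T) / (1 - r) + x / \<mu>) * exp (\<eta> * T)"
        using t \<phi> \<theta> x \<mu> by (intro mult_mono) (auto intro!: add_nonneg_nonneg divide_nonneg_nonneg)
    qed
    show "D t = \<rho> t + (\<integral>s. (P s - S s) * D (t - s) \<partial>lborel)" for t by (rule D_eq)
    show "\<bar>\<rho> t\<bar> \<le> R * exp (- (\<eta> * t))" for t by (rule r_le)
    show "(\<integral>\<^sup>+ s. ennreal (\<bar>P s - S s\<bar> * exp (\<eta> * s)) \<partial>lborel) \<le> ennreal \<kappa>" by (rule kern')
  qed (rule ms \<kappa>0 \<kappa>1)+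
  then show ?thesis by (simp add: D_def R_def Z_def)
qed

end

section \<open>Uniform exponential renewal theorem\<close>

lemma exp_neg_le_quadratic:
  fixes u :: real
  assumes "0 \<le> u"
  shows "exp (- u) \<le> 1 - u + u\<^sup>2 / 2"
proof -
  define g where "g = (\<lambda>u::real. 1 - u + u\<^sup>2 / 2 - exp (- u))"
  have "g 0 \<le> g u"
  proof (rule DERIV_nonneg_imp_nondecreasing[OF assms])
    fix x :: real
    have "(g has_real_derivative (- 1 + x + exp (- x))) (at x)"
      unfolding g_def by (auto intro!: derivative_eq_intros)
    moreover have "0 \<le> - 1 + x + exp (- x)" using exp_ge_add_one_self[of "- x"] by simp
    ultimately show "\<exists>y. (g has_real_derivative y) (at x) \<and> 0 \<le> y" by blast
  qed
  then show ?thesis by (simp add: g_def)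
qed

lemma exp_chord_le:
  fixes \<eta> \<eta>0 s :: real
  assumes "0 \<le> \<eta>" "\<eta> \<le> \<eta>0" "0 < \<eta>0"
  shows "exp (\<eta> * s) \<le> 1 + \<eta> / \<eta>0 * exp (\<eta>0 * s)"
proof -
  have "convex_on UNIV exp" by (rule exp_convex)
  from convex_onD[OF this, of "\<eta> / \<eta>0" 0 "\<eta>0 * s"] assms
  have "exp (\<eta> * s) \<le> (1 - \<eta> / \<eta>0) * 1 + \<eta> / \<eta>0 * exp (\<eta>0 * s)"
    by simp
  moreover have "(1 - \<eta> / \<eta>0) * 1 \<le> 1" using assms by simp
  ultimately show ?thesis by linarith
qed

lemma nn_integral_exp_tail:
  fixes a L :: real
  assumes "0 < a"
  shows "(\<integral>\<^sup>+ s. ennreal (exp (- (a * s))) * indicator {L..} s \<partial>lborel) = ennreal (exp (- (a * L)) / a)"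
proof -
  have "(\<integral>\<^sup>+ s. ennreal (exp (- (a * s))) * indicator {L..} s \<partial>lborel) = ennreal (0 - (- exp (- (a * L)) / a))"
  proof (rule nn_integral_FTC_atLeast)
    have "((\<lambda>x::real. exp (- (a * x))) \<longlongrightarrow> 0) at_top"
      using assms
      by (intro filterlim_compose[OF exp_at_bot] filterlim_compose[OF filterlim_uminus_at_bot_at_top]
          filterlim_tendsto_pos_mult_at_top[OF tendsto_const _ filterlim_ident])
    then have "((\<lambda>x::real. - exp (- (a * x)) / a) \<longlongrightarrow> - 0 / a) at_top"
      using assms by (intro tendsto_intros) auto
    then show "((\<lambda>x::real. - exp (- (a * x)) / a) \<longlongrightarrow> 0) at_top" by simp
  qed (use assms in \<open>auto intro!: derivative_eq_intros\<close>)
  then show ?thesis by simp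
qed

context renewal_density
begin

lemma nnmean_le:
  assumes "0 < \<eta>" "mgf f \<eta> \<le> ennreal A" "0 \<le> A"
  shows "nnmean f \<le> ennreal (A / \<eta>)"
proof -
  have "nnmean f \<le> (\<integral>\<^sup>+ s. ennreal (1 / \<eta>) * (f s * ennreal (exp (\<eta> * s))) \<partial>lborel)"
    unfolding nnmean_def
  proof (rule nn_integral_mono)
    fix s
    have "\<eta> * s \<le> exp (\<eta> * s)" using exp_ge_add_one_self[of "\<eta> * s"] by linarith
    then have "s \<le> 1 / \<eta> * exp (\<eta> * s)" using assms by (simp add: field_simps)
    then have "f s * ennreal s \<le> f s * ennreal (1 / \<eta> * exp (\<eta> * s))"
      by (intro mult_left_mono ennreal_leI) auto
    also have "\<dots> = f s * (ennreal (1 / \<eta>) * ennreal (exp (\<eta> * s)))"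
      using assms by (subst ennreal_mult) auto
    finally show "f s * ennreal s \<le> ennreal (1 / \<eta>) * (f s * ennreal (exp (\<eta> * s)))"
      by (simp only: mult_ac)
  qed
  also have "\<dots> = ennreal (1 / \<eta>) * mgf f \<eta>"
    unfolding mgf_def by (rule nn_integral_cmult) measurable
  also have "\<dots> \<le> ennreal (1 / \<eta>) * ennreal A"
    by (intro mult_left_mono assms) auto
  also have "\<dots> = ennreal (A / \<eta>)" using assms by (subst ennreal_mult[symmetric]) auto
  finally show ?thesis .
qed

text \<open>Convexity of the exponential: as \<open>\<eta>\<close> tends to 0 the tilted mass tends
  to 1 at a rate that depends on the density only through the bound \<open>A\<close>.\<close>

lemma mgf_small_le:
  assumes "0 \<le> \<eta>" "\<eta> \<le> \<eta>0" "0 < \<eta>0" "mgf f \<eta>0 \<le> ennreal A" "0 \<le> A"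
  shows "mgf f \<eta> \<le> ennreal (1 + \<eta> * A / \<eta>0)"
proof -
  have "mgf f \<eta> \<le> (\<integral>\<^sup>+ s. f s + ennreal (\<eta> / \<eta>0) * (f s * ennreal (exp (\<eta>0 * s))) \<partial>lborel)"
    unfolding mgf_def
  proof (rule nn_integral_mono)
    fix s
    have "f s * ennreal (exp (\<eta> * s)) \<le> f s * ennreal (1 + \<eta> / \<eta>0 * exp (\<eta>0 * s))"
      by (intro mult_left_mono ennreal_leI exp_chord_le assms) auto
    also have "ennreal (1 + \<eta> / \<eta>0 * exp (\<eta>0 * s)) = 1 + ennreal (\<eta> / \<eta>0) * ennreal (exp (\<eta>0 * s))"
      using assms by (subst ennreal_mult[symmetric]) (simp_all flip: ennreal_1 ennreal_plus)
    finally show "f s * ennreal (exp (\<eta> * s)) \<le> f s + ennreal (\<eta> / \<eta>0) * (f s * ennreal (exp (\<eta>0 * s)))"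
      by (simp only: distrib_left mult_1_right mult_1_left mult_ac)
  qed
  also have "\<dots> = (\<integral>\<^sup>+ s. f s \<partial>lborel) + (\<integral>\<^sup>+ s. ennreal (\<eta> / \<eta>0) * (f s * ennreal (exp (\<eta>0 * s))) \<partial>lborel)"
    by (rule nn_integral_add) measurable
  also have "(\<integral>\<^sup>+ s. ennreal (\<eta> / \<eta>0) * (f s * ennreal (exp (\<eta>0 * s))) \<partial>lborel) = ennreal (\<eta> / \<eta>0) * mgf f \<eta>0"
    unfolding mgf_def by (rule nn_integral_cmult) measurable
  also have "(\<integral>\<^sup>+ s. f s \<partial>lborel) + ennreal (\<eta> / \<eta>0) * mgf f \<eta>0 \<le> 1 + ennreal (\<eta> / \<eta>0) * ennreal A"
    unfolding f_total by (intro add_left_mono mult_left_mono assms) auto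
  also have "\<dots> = ennreal (1 + \<eta> * A / \<eta>0)"
    using assms by (subst ennreal_plus) (auto simp: ennreal_mult[symmetric])
  finally show ?thesis .
qed

text \<open>Second-order expansion of the Laplace transform, with the quadratic term paid by the
  exponential moment. It makes the renewal series converge and later yields the Chernoff rates for
  cutting it at \<open>n\<close>. A lower bound \<open>m\<close> for the mean is enough, which is
  convenient when the density varies.\<close>

lemma mgf_neg_le:
  assumes \<theta>: "0 \<le> \<theta>" and \<eta>: "0 < \<eta>" "mgf f \<eta> \<le> ennreal A" "0 \<le> A" and m: "0 \<le> m" "ennreal m \<le> nnmean f"
  shows "mgf f (-\<theta>) \<le> ennreal (1 - \<theta> * m + \<theta>\<^sup>2 * (A / \<eta>\<^sup>2))"
proof -
  have sq: "s\<^sup>2 / 2 \<le> exp (\<eta> * s) / \<eta>\<^sup>2" if "0 \<le> s" for s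
  proof -
    have "(\<eta> * s)\<^sup>2 / 2 \<le> exp (\<eta> * s)"
      using exp_lower_Taylor_quadratic[of "\<eta> * s"] that \<eta>(1) mult_nonneg_nonneg[of \<eta> s] by linarith
    then show ?thesis using \<eta>(1) by (simp add: field_simps)
  qed
  have "mgf f (-\<theta>) + ennreal \<theta> * nnmean f = (\<integral>\<^sup>+ s. f s * ennreal (exp (-\<theta> * s)) + ennreal \<theta> * (f s * ennreal s) \<partial>lborel)"
    unfolding mgf_def nnmean_def
    by (subst nn_integral_cmult[symmetric], measurable) (rule nn_integral_add[symmetric], measurable)
  also have "\<dots> \<le> (\<integral>\<^sup>+ s. f s + ennreal (\<theta>\<^sup>2 / \<eta>\<^sup>2) * (f s * ennreal (exp (\<eta> * s))) \<partial>lborel)"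
  proof (rule nn_integral_mono)
    fix s
    show "f s * ennreal (exp (-\<theta> * s)) + ennreal \<theta> * (f s * ennreal s) \<le> f s + ennreal (\<theta>\<^sup>2 / \<eta>\<^sup>2) * (f s * ennreal (exp (\<eta> * s)))"
    proof (cases "s < 0")
      case False
      then have s: "0 \<le> s" by simp
      have "\<theta>\<^sup>2 * (s\<^sup>2 / 2) \<le> \<theta>\<^sup>2 * (exp (\<eta> * s) / \<eta>\<^sup>2)"
        by (intro mult_left_mono sq s) auto
      then have "exp (-\<theta> * s) + \<theta> * s \<le> 1 + \<theta>\<^sup>2 / \<eta>\<^sup>2 * exp (\<eta> * s)"
      proof -
        have "exp (- (\<theta> * s)) \<le> 1 - \<theta> * s + \<theta>\<^sup>2 * (s\<^sup>2 / 2)"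
          using exp_neg_le_quadratic[of "\<theta> * s"] \<theta> s by (simp add: power_mult_distrib)
        moreover have "\<theta>\<^sup>2 * (exp (\<eta> * s) / \<eta>\<^sup>2) = \<theta>\<^sup>2 / \<eta>\<^sup>2 * exp (\<eta> * s)" by simp
        ultimately show ?thesis
          using \<open>\<theta>\<^sup>2 * (s\<^sup>2 / 2) \<le> \<theta>\<^sup>2 * (exp (\<eta> * s) / \<eta>\<^sup>2)\<close> by (simp only: mult_minus_left)
      qed
      then have "f s * ennreal (exp (-\<theta> * s) + \<theta> * s) \<le> f s * ennreal (1 + \<theta>\<^sup>2 / \<eta>\<^sup>2 * exp (\<eta> * s))"
        by (intro mult_left_mono ennreal_leI) auto
      moreover have "ennreal (exp (-\<theta> * s) + \<theta> * s) = ennreal (exp (-\<theta> * s)) + ennreal \<theta> * ennreal s"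
        using \<theta> s by (simp add: ennreal_mult)
      moreover have "ennreal (1 + \<theta>\<^sup>2 / \<eta>\<^sup>2 * exp (\<eta> * s)) = 1 + ennreal (\<theta>\<^sup>2 / \<eta>\<^sup>2) * ennreal (exp (\<eta> * s))"
        by (subst ennreal_mult[symmetric]) (simp_all flip: ennreal_1 ennreal_plus)
      ultimately show ?thesis by (simp only: distrib_left mult_1_right mult_1_left mult_ac)
    qed (simp add: f_neg)
  qed
  also have "\<dots> = (\<integral>\<^sup>+ s. f s \<partial>lborel) + (\<integral>\<^sup>+ s. ennreal (\<theta>\<^sup>2 / \<eta>\<^sup>2) * (f s * ennreal (exp (\<eta> * s))) \<partial>lborel)"
    by (rule nn_integral_add) measurable
  also have "(\<integral>\<^sup>+ s. ennreal (\<theta>\<^sup>2 / \<eta>\<^sup>2) * (f s * ennreal (exp (\<eta> * s))) \<partial>lborel) = ennreal (\<theta>\<^sup>2 / \<eta>\<^sup>2) * mgf f \<eta>"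
    unfolding mgf_def by (rule nn_integral_cmult) measurable
  also have "(\<integral>\<^sup>+ s. f s \<partial>lborel) + ennreal (\<theta>\<^sup>2 / \<eta>\<^sup>2) * mgf f \<eta> \<le> 1 + ennreal (\<theta>\<^sup>2 / \<eta>\<^sup>2) * ennreal A"
    unfolding f_total by (intro add_left_mono mult_left_mono \<eta>) auto
  also have "\<dots> = ennreal (1 + \<theta>\<^sup>2 * (A / \<eta>\<^sup>2))"
    using \<eta> by (subst ennreal_plus) (auto simp: ennreal_mult[symmetric])
  finally have "mgf f (-\<theta>) + ennreal \<theta> * nnmean f \<le> ennreal (1 + \<theta>\<^sup>2 * (A / \<eta>\<^sup>2))" .
  then have "mgf f (-\<theta>) + ennreal \<theta> * ennreal m \<le> ennreal (1 + \<theta>\<^sup>2 * (A / \<eta>\<^sup>2))"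
    using m by (intro order_trans[OF add_left_mono[OF mult_left_mono[OF m(2)]]]) auto
  then have *: "mgf f (-\<theta>) + ennreal (\<theta> * m) \<le> ennreal (1 + \<theta>\<^sup>2 * (A / \<eta>\<^sup>2))"
    using \<theta> m by (simp add: ennreal_mult)
  have "mgf f (-\<theta>) < top" using le_less_trans[OF order_trans[OF _ *] ennreal_less_top] by simp
  then obtain v where v: "mgf f (-\<theta>) = ennreal v" "0 \<le> v" by (cases "mgf f (-\<theta>)") auto
  have "ennreal (v + \<theta> * m) \<le> ennreal (1 + \<theta>\<^sup>2 * (A / \<eta>\<^sup>2))"
    using * v \<theta> m by simp
  then have "v + \<theta> * m \<le> 1 + \<theta>\<^sup>2 * (A / \<eta>\<^sup>2)"
    using \<eta> by (subst (asm) ennreal_le_iff) auto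
  then show ?thesis unfolding v by (intro ennreal_leI) simp
qed

text \<open>The limit \<open>\<eta> \<le> \<eta>0 / 2\<close> leaves half of the decay of
  \<open>surv f\<close>, and the bound no longer contains \<open>\<eta>\<close>. This allows
  \<open>L\<close> to be fixed before \<open>\<eta>\<close>.\<close>

lemma surv_tail_le:
  assumes "0 \<le> \<eta>" "\<eta> \<le> \<eta>0 / 2" "0 < \<eta>0" "mgf f \<eta>0 \<le> ennreal A" "0 \<le> A" "0 \<le> L"
  shows "(\<integral>\<^sup>+ s. surv f s * indicator {L<..} s * ennreal (exp (\<eta> * s)) \<partial>lborel)
     \<le> ennreal (2 * A / \<eta>0 * exp (- (\<eta>0 / 2 * L)))"
proof -
  have "(\<integral>\<^sup>+ s. surv f s * indicator {L<..} s * ennreal (exp (\<eta> * s)) \<partial>lborel)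
     \<le> (\<integral>\<^sup>+ s. ennreal A * (ennreal (exp (- (\<eta>0 / 2 * s))) * indicator {L..} s) \<partial>lborel)"
  proof (rule nn_integral_mono)
    fix s
    show "surv f s * indicator {L<..} s * ennreal (exp (\<eta> * s)) \<le> ennreal A * (ennreal (exp (- (\<eta>0 / 2 * s))) * indicator {L..} s)"
    proof (cases "L < s")
      case True
      have "\<eta> * s \<le> \<eta>0 / 2 * s" using True assms by (intro mult_right_mono) auto
      then have e: "exp (- \<eta>0 * s) * exp (\<eta> * s) \<le> exp (- (\<eta>0 / 2 * s))"
        by (simp add: exp_add[symmetric])
      have "surv f s * ennreal (exp (\<eta> * s)) \<le> ennreal A * ennreal (exp (- \<eta>0 * s)) * ennreal (exp (\<eta> * s))"
        using assms by (intro mult_right_mono order_trans[OF surv_le[of \<eta>0 s]]) auto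
      also have "\<dots> = ennreal A * ennreal (exp (- \<eta>0 * s) * exp (\<eta> * s))"
        by (simp add: ennreal_mult mult.assoc)
      also have "\<dots> \<le> ennreal A * ennreal (exp (- (\<eta>0 / 2 * s)))"
        using e by (intro mult_left_mono ennreal_leI) auto
      finally show ?thesis using True by simp
    qed simp
  qed
  also have "\<dots> = ennreal A * ennreal (exp (- (\<eta>0 / 2 * L)) / (\<eta>0 / 2))"
    using assms nn_integral_exp_tail[of "\<eta>0 / 2" L] by (subst nn_integral_cmult) auto
  also have "\<dots> = ennreal (2 * A / \<eta>0 * exp (- (\<eta>0 / 2 * L)))"
    using assms by (subst ennreal_mult[symmetric]) (auto simp: field_simps)
  finally show ?thesis .
qed

lemma nnmean_ge:
  assumes "0 \<le> p" "p < q" "0 \<le> c0" "\<And>s. s \<in> {p..q} \<Longrightarrow> ennreal c0 \<le> f s"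
  shows "ennreal (c0 * ((p + q) / 2) * ((q - p) / 2)) \<le> nnmean f"
proof -
  let ?m = "(p + q) / 2"
  have "ennreal (c0 * ?m * ((q - p) / 2)) = (\<integral>\<^sup>+ s. ennreal (c0 * ?m) * indicator {?m..q} s \<partial>lborel)"
  proof -
    have "q - ?m = (q - p) / 2" by (simp add: field_simps)
    then show ?thesis using assms by (subst nn_integral_cmult_indicator) (auto simp: ennreal_mult[symmetric])
  qed
  also have "\<dots> \<le> nnmean f"
    unfolding nnmean_def
  proof (rule nn_integral_mono)
    fix s
    show "ennreal (c0 * ?m) * indicator {?m..q} s \<le> f s * ennreal s"
    proof (cases "s \<in> {?m..q}")
      case True
      then have "ennreal c0 \<le> f s" using assms by (intro assms) auto
      moreover have "ennreal ?m \<le> ennreal s" using True by (intro ennreal_leI) auto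
      moreover have "ennreal (c0 * ?m) = ennreal c0 * ennreal ?m" using assms by (intro ennreal_mult) auto
      ultimately show ?thesis using True by (simp add: mult_mono)
    qed simp
  qed
  finally show ?thesis .
qed

end

text \<open>Makes \<open>1 - \<theta> * m + \<theta>\<^sup>2 * V\<close> usable as a rate: the first
  requirement keeps it non-negative, the second with \<open>d < m\<close> keeps it below 1.\<close>

lemma ex_small_rate:
  fixes m V d :: real
  assumes "0 < m" "0 \<le> V" "0 < d"
  shows "\<exists>\<theta>>0. \<theta> * m \<le> 1 \<and> \<theta> * V \<le> d"
proof -
  define \<theta> where "\<theta> = min (1 / m) (d / (V + 1))"
  have "0 < \<theta>" using assms by (simp add: \<theta>_def)
  moreover have "\<theta> * m \<le> 1" using assms pos_le_divide_eq[of m \<theta> 1] by (simp add: \<theta>_def)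
  moreover have "\<theta> * (V + 1) \<le> d" using assms pos_le_divide_eq[of "V + 1" \<theta> d] by (simp add: \<theta>_def)
  ultimately show ?thesis by (intro exI[of _ \<theta>]) (auto simp: algebra_simps)
qed

text \<open>The point of this version is that \<open>\<eta>\<close> and \<open>K\<close> depend only on the minorant and on the moment bound,
  not on the density.\<close>

proposition renewal_exponential_uniform:
  fixes c0 p q \<eta>0 A :: real
  assumes c0: "0 < c0" and pq: "0 \<le> p" "p < q" and \<eta>0: "0 < \<eta>0" and A: "0 \<le> A"
  obtains \<eta> K where "0 < \<eta>" "0 \<le> K"
    "\<And>f x t. renewal_density f \<Longrightarrow> (\<And>s. s \<in> {p..q} \<Longrightarrow> ennreal c0 \<le> f s) \<Longrightarrow> mgf f \<eta>0 \<le> ennreal A \<Longrightarrow> 0 \<le> x \<Longrightarrow>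
       renewals f x t < \<infinity> \<and> \<bar>enn2real (renewals f x t) - x / enn2real (nnmean f)\<bar> \<le> K * exp (\<eta>0 * x) * exp (- (\<eta> * t))"
proof -
  define \<mu>0 where "\<mu>0 = c0 * ((p + q) / 2) * ((q - p) / 2)"
  have \<mu>0: "0 < \<mu>0" using c0 pq by (simp add: \<mu>0_def)
  define \<delta> where "\<delta> = (q - p) / 4"
  have \<delta>: "0 < \<delta>" using pq by (simp add: \<delta>_def)
  define \<tau> where "\<tau> L = 2 * A / \<eta>0 * exp (- (\<eta>0 / 2 * L))" for L
  \<comment> \<open>The constants are fixed in the order \<open>L\<close>, \<open>N\<close>, then
    \<open>y\<close> and \<open>c\<close>, and \<open>\<eta>\<close> last; this is not circular
    because \<open>\<tau>\<close> does not involve \<open>\<eta>\<close>. The factor 1/12 makes the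
    \<open>\<tau>\<close> term of the contraction constant at most
    \<open>c * \<mu>0 / 4\<close>.\<close>
  obtain L where L: "0 \<le> L" "\<tau> L \<le> \<mu>0 / 12"
  proof -
    have "((\<lambda>L. exp (- (\<eta>0 / 2 * L))) \<longlongrightarrow> 0) at_top"
      using \<eta>0
      by (intro filterlim_compose[OF exp_at_bot] filterlim_compose[OF filterlim_uminus_at_bot_at_top]
          filterlim_tendsto_pos_mult_at_top[OF tendsto_const _ filterlim_ident]) auto
    then have "(\<tau> \<longlongrightarrow> 2 * A / \<eta>0 * 0) at_top"
      unfolding \<tau>_def by (intro tendsto_mult tendsto_const)
    then have "\<forall>\<^sub>F L in at_top. \<tau> L < \<mu>0 / 12"
      using \<mu>0 by (intro order_tendstoD(2)) auto
    then have "\<forall>\<^sub>F L in at_top. \<tau> L < \<mu>0 / 12 \<and> 0 \<le> L"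
      using eventually_ge_at_top[of 0] by eventually_elim auto
    then obtain L where "\<tau> L < \<mu>0 / 12" "0 \<le> L" by (auto simp: eventually_at_top_linorder)
    then show thesis by (intro that[of L]) auto
  qed
  \<comment> \<open>With this \<open>N\<close> the minorant interval of the convolution power is at
    least as long as \<open>L\<close>.\<close>
  obtain N :: nat where N: "L / (2 * \<delta>) \<le> real N" using real_arch_simple by blast
  define y c where "y = p + real N * (p + \<delta>)" and "c = c0 * (c0 * \<delta>) ^ N"
  have y: "0 \<le> y" and c: "0 < c" using pq \<delta> c0 by (auto simp: y_def c_def)
  have yL: "y + L \<le> q + real N * (q - \<delta>)"
  proof -
    have "L \<le> real N * (2 * \<delta>)" using N \<delta> by (simp add: field_simps)
    moreover have "q + real N * (q - \<delta>) - y = 4 * \<delta> + real N * (2 * \<delta>)"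
      by (simp add: y_def \<delta>_def field_simps)
    ultimately show ?thesis using \<delta> by linarith
  qed
  obtain \<eta> where \<eta>: "0 < \<eta>" "\<eta> < \<eta>0 / 2" "exp (\<eta> * y) < 2" "(1 + \<eta> * A / \<eta>0) ^ Suc N < 1 + c * \<mu>0 / 2"
  proof -
    have "((\<lambda>\<eta>. exp (\<eta> * y)) \<longlongrightarrow> exp (0 * y)) (at_right 0)"
      by (intro tendsto_intros)
    then have e1: "\<forall>\<^sub>F \<eta> in at_right 0. exp (\<eta> * y) < 2"
      by (intro order_tendstoD(2)) auto
    have "((\<lambda>\<eta>. (1 + \<eta> * A / \<eta>0) ^ Suc N) \<longlongrightarrow> (1 + 0 * A / \<eta>0) ^ Suc N) (at_right 0)"
      using \<eta>0 by (intro tendsto_intros) auto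
    then have e2: "\<forall>\<^sub>F \<eta> in at_right 0. (1 + \<eta> * A / \<eta>0) ^ Suc N < 1 + c * \<mu>0 / 2"
      using c \<mu>0 by (intro order_tendstoD(2)) auto
    have e3: "\<forall>\<^sub>F \<eta> in at_right 0. \<eta> < \<eta>0 / 2 \<and> 0 < \<eta>"
      using \<eta>0 eventually_at_right_less[of "0::real"] eventually_at_right_real[of 0 "\<eta>0/2"] by (auto elim: eventually_mono)
    from e1 e2 e3 have "\<forall>\<^sub>F \<eta> in at_right 0. exp (\<eta> * y) < 2 \<and> (1 + \<eta> * A / \<eta>0) ^ Suc N < 1 + c * \<mu>0 / 2 \<and> \<eta> < \<eta>0 / 2 \<and> 0 < \<eta>"
      by eventually_elim auto
    then have "\<exists>\<eta>. exp (\<eta> * y) < 2 \<and> (1 + \<eta> * A / \<eta>0) ^ Suc N < 1 + c * \<mu>0 / 2 \<and> \<eta> < \<eta>0 / 2 \<and> 0 < \<eta>"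
      by (rule eventually_happens'[rotated]) simp
    then show thesis using that by blast
  qed
  define \<phi> where "\<phi> = 1 + \<eta> * A / \<eta>0"
  have \<phi>: "1 \<le> \<phi>" using \<eta> A \<eta>0 by (simp add: \<phi>_def)
  define K where "K = (real (Suc N) * (1 + c * \<mu>0 / 2) + 2 * c * (2 / \<eta>0)) * (4 / (c * \<mu>0))"
  show thesis
  proof (rule that[of \<eta> K])
    show "0 < \<eta>" by fact
    show "0 \<le> K" using c \<mu>0 \<eta>0 by (auto simp: K_def intro!: mult_nonneg_nonneg add_nonneg_nonneg)
    fix f :: "real \<Rightarrow> ennreal" and x t :: real
    assume f: "renewal_density f" and lb: "\<And>s. s \<in> {p..q} \<Longrightarrow> ennreal c0 \<le> f s"
      and mgf: "mgf f \<eta>0 \<le> ennreal A" and x: "0 \<le> x"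
    interpret renewal_density f by (rule f)
    have mean_fin: "nnmean f \<le> ennreal (A / \<eta>0)" using nnmean_le[OF \<eta>0 mgf A] .
    then obtain \<mu> where \<mu>: "nnmean f = ennreal \<mu>" "0 \<le> \<mu>"
      by (cases "nnmean f") (auto simp: top_unique)
    have \<mu>\<mu>0: "\<mu>0 \<le> \<mu>"
      using nnmean_ge[OF pq _ lb] c0 \<mu> \<mu>0 unfolding \<mu>0_def[symmetric] by (simp add: ennreal_le_iff)
    then have \<mu>pos: "0 < \<mu>" using \<mu>0 by simp
    \<comment> \<open>This \<open>\<theta>\<close> depends on the density through
      \<open>\<mu>\<close>, which is harmless: it does not occur in \<open>\<eta>\<close> or
      \<open>K\<close>.\<close>
    obtain \<theta> where \<theta>: "0 < \<theta>" "1 - \<theta> * \<mu> + \<theta>\<^sup>2 * (A / \<eta>0\<^sup>2) < 1" "0 \<le> 1 - \<theta> * \<mu> + \<theta>\<^sup>2 * (A / \<eta>0\<^sup>2)"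
    proof -
      define V where "V = A / \<eta>0\<^sup>2"
      have V: "0 \<le> V" using A by (simp add: V_def)
      have "0 < \<mu> / 2" using \<mu>pos by simp
      from ex_small_rate[OF \<mu>pos V this]
      obtain \<theta> where \<theta>: "0 < \<theta>" "\<theta> * \<mu> \<le> 1" "\<theta> * V \<le> \<mu> / 2" by blast
      have "\<theta> * V < \<mu>" using \<theta> \<mu>pos by linarith
      then have "\<theta> * (\<theta> * V) < \<theta> * \<mu>" using \<theta> by simp
      then have "1 - \<theta> * \<mu> + \<theta>\<^sup>2 * V < 1" by (simp add: power2_eq_square mult.assoc)
      moreover have "0 \<le> 1 - \<theta> * \<mu> + \<theta>\<^sup>2 * V" using \<theta> V by (intro add_nonneg_nonneg) auto
      ultimately show thesis using that[OF \<theta>(1)] by (simp add: V_def)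
    qed
    define r where "r = 1 - \<theta> * \<mu> + \<theta>\<^sup>2 * (A / \<eta>0\<^sup>2)"
    have r: "mgf f (-\<theta>) \<le> ennreal r" "0 \<le> r" "r < 1"
      using mgf_neg_le[OF _ \<eta>0 mgf A \<mu>(2), of \<theta>] \<theta> \<mu> by (auto simp: r_def)
    have fin: "renewals f x t < \<infinity>"
      using suminf_conv_pow_win_le[OF _ r, of 0 x t] \<theta> unfolding renewals_def
      by (auto intro: le_less_trans)
    define \<kappa> where "\<kappa> = \<phi> ^ Suc N - c * \<mu> + c * (1 + exp (\<eta> * y)) * \<tau> L"
    \<comment> \<open>The three contributions are at most \<open>1 + c * \<mu>0 / 2\<close>,
      \<open>- c * \<mu>0\<close> and \<open>c * \<mu>0 / 4\<close>.\<close>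
    have \<kappa>: "\<kappa> \<le> 1 - c * \<mu>0 / 4"
    proof -
      have "\<phi> ^ Suc N \<le> 1 + c * \<mu>0 / 2" using \<eta> by (simp add: \<phi>_def)
      moreover have "c * \<mu>0 \<le> c * \<mu>" using c \<mu>\<mu>0 by simp
      moreover have "c * (1 + exp (\<eta> * y)) * \<tau> L \<le> c * 3 * (\<mu>0 / 12)"
        using c \<eta> L A \<eta>0 by (intro mult_mono) (auto simp: \<tau>_def)
      ultimately show ?thesis unfolding \<kappa>_def by linarith
    qed
    have "0 < c * \<mu>0" using c \<mu>0 by simp
    then have \<kappa>1: "\<kappa> < 1" using \<kappa> by linarith
    have "\<bar>enn2real (renewals f x t) - x / \<mu>\<bar>
        \<le> ((\<Sum>k\<le>N. \<phi> ^ k) + c * x * exp (\<eta> * y)) * exp (\<eta> * x) / (1 - \<kappa>) * exp (- (\<eta> * t))"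
      unfolding \<kappa>_def
    proof (rule renewal_error_bound[OF x _ r \<mu>(1) \<mu>pos \<eta>(1) _ _ c y L(1)])
      show "ennreal c \<le> (conv f ^^ N) f s" if "s \<in> {y..y + L}" for s
        unfolding c_def \<delta>_def
        by (rule conv_pow_minorant[OF f_measurable pq(2) _ lb]) (use that yL c0 in \<open>auto simp: y_def \<delta>_def\<close>)
      show "(\<integral>\<^sup>+ s. surv f s * indicator {L<..} s * ennreal (exp (\<eta> * s)) \<partial>lborel) \<le> ennreal (\<tau> L)"
        unfolding \<tau>_def using \<eta> \<eta>0 mgf A L by (intro surv_tail_le) auto
      show "mgf f \<eta> \<le> ennreal \<phi>"
        unfolding \<phi>_def using \<eta> \<eta>0 mgf A by (intro mgf_small_le) auto
      show "0 \<le> \<tau> L" using A \<eta>0 by (simp add: \<tau>_def)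
      show "\<phi> ^ Suc N - c * \<mu> + c * (1 + exp (\<eta> * y)) * \<tau> L < 1" using \<kappa>1 by (simp add: \<kappa>_def)
    qed (use \<theta> \<phi> in auto)
    \<comment> \<open>The factor linear in \<open>x\<close> and the factor
      \<open>exp (\<eta> * x)\<close> each cost \<open>exp (\<eta>0 / 2 * x)\<close>. Their product
      is integrable in \<open>x\<close> by the moment assumption on the weights.\<close>
    also have "\<dots> \<le> K * exp (\<eta>0 * x) * exp (- (\<eta> * t))"
    proof (rule mult_right_mono)
      have "(\<Sum>k\<le>N. \<phi> ^ k) \<le> (\<Sum>k\<le>N. 1 + c * \<mu>0 / 2)"
      proof (rule sum_mono)
        fix k assume "k \<in> {..N}"
        then have "\<phi> ^ k \<le> \<phi> ^ Suc N" using \<phi> by (intro power_increasing) auto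
        also have "\<dots> \<le> 1 + c * \<mu>0 / 2" using \<eta> by (simp add: \<phi>_def)
        finally show "\<phi> ^ k \<le> 1 + c * \<mu>0 / 2" .
      qed
      then have s1: "(\<Sum>k\<le>N. \<phi> ^ k) \<le> real (Suc N) * (1 + c * \<mu>0 / 2)" by simp
      have e1: "1 \<le> exp (\<eta>0 / 2 * x)" using \<eta>0 x by simp
      have "\<eta>0 / 2 * x \<le> exp (\<eta>0 / 2 * x)" using exp_ge_add_one_self[of "\<eta>0 / 2 * x"] by linarith
      then have xe: "x \<le> 2 / \<eta>0 * exp (\<eta>0 / 2 * x)" using \<eta>0 by (simp add: field_simps)
      have "(\<Sum>k\<le>N. \<phi> ^ k) + c * x * exp (\<eta> * y)
          \<le> real (Suc N) * (1 + c * \<mu>0 / 2) * exp (\<eta>0 / 2 * x) + c * (2 / \<eta>0 * exp (\<eta>0 / 2 * x)) * 2"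
      proof (rule add_mono)
        show "(\<Sum>k\<le>N. \<phi> ^ k) \<le> real (Suc N) * (1 + c * \<mu>0 / 2) * exp (\<eta>0 / 2 * x)"
        proof -
          have "0 \<le> real (Suc N) * (1 + c * \<mu>0 / 2)" using c \<mu>0 by (intro mult_nonneg_nonneg) auto
          from mult_left_mono[OF e1 this] s1 show ?thesis by linarith
        qed
        show "c * x * exp (\<eta> * y) \<le> c * (2 / \<eta>0 * exp (\<eta>0 / 2 * x)) * 2"
          using c x xe \<eta> \<eta>0 by (intro mult_mono) auto
      qed
      then have le1: "(\<Sum>k\<le>N. \<phi> ^ k) + c * x * exp (\<eta> * y) \<le> (real (Suc N) * (1 + c * \<mu>0 / 2) + 2 * c * (2 / \<eta>0)) * exp (\<eta>0 / 2 * x)"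
        by (simp add: algebra_simps)
      have le2: "exp (\<eta> * x) \<le> exp (\<eta>0 / 2 * x)" using mult_right_mono[of \<eta> "\<eta>0 / 2" x] \<eta> x by simp
      have le3: "1 / (1 - \<kappa>) \<le> 4 / (c * \<mu>0)"
      proof -
        have "1 / (1 - \<kappa>) \<le> 1 / (c * \<mu>0 / 4)"
          using \<kappa> \<open>0 < c * \<mu>0\<close> by (intro divide_left_mono mult_pos_pos) auto
        then show ?thesis by simp
      qed
      define W where "W = real (Suc N) * (1 + c * \<mu>0 / 2) + 2 * c * (2 / \<eta>0)"
      have W0: "0 \<le> W" unfolding W_def using c \<mu>0 \<eta>0 by (intro add_nonneg_nonneg mult_nonneg_nonneg) auto
      have "((\<Sum>k\<le>N. \<phi> ^ k) + c * x * exp (\<eta> * y)) * exp (\<eta> * x) * (1 / (1 - \<kappa>))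
         \<le> (W * exp (\<eta>0 / 2 * x)) * exp (\<eta>0 / 2 * x) * (4 / (c * \<mu>0))"
        using le1 le2 le3 \<kappa>1 W0 unfolding W_def[symmetric] by (intro mult_mono mult_nonneg_nonneg) auto
      also have "\<dots> = K * (exp (\<eta>0 / 2 * x) * exp (\<eta>0 / 2 * x))"
        unfolding K_def W_def by (simp only: mult_ac)
      also have "exp (\<eta>0 / 2 * x) * exp (\<eta>0 / 2 * x) = exp (\<eta>0 * x)"
        by (simp add: exp_add[symmetric])
      finally show "((\<Sum>k\<le>N. \<phi> ^ k) + c * x * exp (\<eta> * y)) * exp (\<eta> * x) / (1 - \<kappa>) \<le> K * exp (\<eta>0 * x)"
        by simp
    qed simp
    finally show "renewals f x t < \<infinity> \<and> \<bar>enn2real (renewals f x t) - x / enn2real (nnmean f)\<bar> \<le> K * exp (\<eta>0 * x) * exp (- (\<eta> * t))"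
      using fin \<mu> by simp
  qed
qed

section \<open>Conditioning on the extremal agent\<close>

text \<open>The choice operator is kept in the form used by \<open>phi_max\<close> and
  \<open>phi_min\<close>, so both become instances without any uniqueness argument.\<close>

definition extremal :: "(real \<Rightarrow> real set) \<Rightarrow> nat \<Rightarrow> (nat \<Rightarrow> real) \<Rightarrow> nat" where
  "extremal S n w = (SOME i. i < n \<and> (\<forall>j<n. w j \<in> S (w i)))"

text \<open>Left unnormalised, so that no division by the mass of \<open>A\<close> occurs, which may
  be zero.\<close>

definition restr :: "(real \<Rightarrow> real) \<Rightarrow> real set \<Rightarrow> real \<Rightarrow> ennreal" where
  "restr f A s = ennreal (f s) * indicator A s"

lemma restr_measurable [measurable]:
  assumes [measurable]: "f \<in> borel_measurable borel" "A \<in> sets borel"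
  shows "restr f A \<in> borel_measurable borel"
  unfolding restr_def[abs_def] by measurable

lemma sets_Xdist [measurable_cong, simp]: "sets (Xdist f) = sets borel"
  by (simp add: Xdist_def)

lemma space_Xdist [simp]: "space (Xdist f) = UNIV"
  by (simp add: Xdist_def)

lemma component_PiM_Xdist:
  assumes "j \<in> I"
  shows "(\<lambda>w. w j) \<in> borel_measurable (PiM I (\<lambda>_. Xdist f))"
proof -
  have "(\<lambda>w. w j) \<in> measurable (PiM I (\<lambda>_. Xdist f)) (Xdist f)"
    by (rule measurable_component_singleton[OF assms])
  then show ?thesis using measurable_cong_sets[OF refl sets_Xdist] by blast
qed

lemma prod_sum_measurable:
  fixes h :: "real \<Rightarrow> ennreal"
  assumes "J \<subseteq> I" and A: "A \<in> sets borel" and h: "h \<in> borel_measurable borel"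
  shows "(\<lambda>w. (\<Prod>j\<in>I. indicator A (w j)) * h (t - (\<Sum>j\<in>J. w j))) \<in> borel_measurable (PiM I (\<lambda>_. Xdist f))"
proof (rule borel_measurable_times_ennreal)
  have "indicator A \<in> borel_measurable borel" using A by (rule borel_measurable_indicator)
  then show "(\<lambda>w. \<Prod>j\<in>I. indicator A (w j) :: ennreal) \<in> borel_measurable (PiM I (\<lambda>_. Xdist f))"
    by (intro borel_measurable_prod_ennreal) (rule measurable_compose[OF component_PiM_Xdist])
  have "(\<lambda>w. \<Sum>j\<in>J. w j) \<in> borel_measurable (PiM I (\<lambda>_. Xdist f))"
    using assms(1) by (intro borel_measurable_sum component_PiM_Xdist) auto
  then have "(\<lambda>w. t - (\<Sum>j\<in>J. w j)) \<in> borel_measurable (PiM I (\<lambda>_. Xdist f))" by simp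
  from measurable_compose[OF this h]
  show "(\<lambda>w. h (t - (\<Sum>j\<in>J. w j))) \<in> borel_measurable (PiM I (\<lambda>_. Xdist f))" .
qed

lemma nn_integral_Xdist:
  assumes [measurable]: "f \<in> borel_measurable borel" "h \<in> borel_measurable borel"
  shows "(\<integral>\<^sup>+ s. h s \<partial>Xdist f) = (\<integral>\<^sup>+ s. ennreal (f s) * h s \<partial>lborel)"
  unfolding Xdist_def by (rule nn_integral_density) measurable

lemma nn_integral_Xdist_conv:
  assumes [measurable]: "f \<in> borel_measurable borel" "A \<in> sets borel" "G \<in> borel_measurable borel"
  shows "(\<integral>\<^sup>+ y. indicator A y * (K * G (t - y)) \<partial>Xdist f) = K * conv (restr f A) G t"
proof -
  have "(\<integral>\<^sup>+ y. indicator A y * (K * G (t - y)) \<partial>Xdist f)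
      = (\<integral>\<^sup>+ y. ennreal (f y) * (indicator A y * (K * G (t - y))) \<partial>lborel)"
    by (rule nn_integral_Xdist) measurable
  also have "\<dots> = (\<integral>\<^sup>+ y. K * (restr f A y * G (t - y)) \<partial>lborel)"
    unfolding restr_def by (rule nn_integral_cong) (simp only: mult_ac)
  also have "\<dots> = K * conv (restr f A) G t"
    unfolding conv_def[of "restr f A" G t] by (rule nn_integral_cmult) measurable
  finally show ?thesis .
qed

text \<open>Positions are counted from 0, so the position of an agent is the number of its
  predecessors. For i.i.d. weights only this number matters.\<close>

lemma card_predecessors:
  assumes "\<sigma> permutes {..<n}" "i < n"
  shows "card {j. j < n \<and> \<sigma> j < \<sigma> i} = \<sigma> i"
proof -
  have inj: "inj_on \<sigma> A" for A using assms(1) permutes_inj_on by blast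
  have "\<sigma> i < n" using assms permutes_in_image[of \<sigma> "{..<n}" i] by simp
  have "\<sigma> ` {j. j < n \<and> \<sigma> j < \<sigma> i} = {..<\<sigma> i}"
  proof safe
    fix k assume k: "k < \<sigma> i"
    then have "k \<in> \<sigma> ` {..<n}" using \<open>\<sigma> i < n\<close> permutes_image[OF assms(1)] by auto
    then show "k \<in> \<sigma> ` {j. j < n \<and> \<sigma> j < \<sigma> i}" using k by auto
  qed
  then show ?thesis using card_image[OF inj, of "{j. j < n \<and> \<sigma> j < \<sigma> i}"] by simp
qed

text \<open>Pivotality says that \<open>Q\<close> minus the weight of the predecessors falls into
  the window \<open>{0<..w i}\<close>; in this form the expectation can be taken permutation by
  permutation.\<close>

lemma ennreal_shapley:
  "ennreal (shapley n w Q i) =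
     (\<Sum>\<sigma> | \<sigma> permutes {..<n}. ennreal (1 / fact n) * win (w i) (Q - (\<Sum>j\<in>{j. j < n \<and> \<sigma> j < \<sigma> i}. w j)))"
proof -
  let ?s = "\<lambda>\<sigma>. \<Sum>j\<in>{j. j < n \<and> \<sigma> j < \<sigma> i}. w j"
  have fin: "finite {\<sigma>. \<sigma> permutes {..<n}}" by (simp add: finite_permutations)
  have "(\<Sum>\<sigma> | \<sigma> permutes {..<n}. ennreal (1 / fact n) * win (w i) (Q - ?s \<sigma>))
      = ennreal (1 / fact n) * (\<Sum>\<sigma> | \<sigma> permutes {..<n}. if Q - w i \<le> ?s \<sigma> \<and> ?s \<sigma> < Q then 1 else 0)"
    unfolding sum_distrib_left by (intro sum.cong refl) (auto simp: indicator_def)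
  also have "(\<Sum>\<sigma> | \<sigma> permutes {..<n}. if Q - w i \<le> ?s \<sigma> \<and> ?s \<sigma> < Q then 1 else 0 :: ennreal)
      = (\<Sum>\<sigma>\<in>{\<sigma>. \<sigma> permutes {..<n} \<and> Q - w i \<le> ?s \<sigma> \<and> ?s \<sigma> < Q}. 1)"
    using fin by (intro sum.mono_neutral_cong_right) auto
  also have "\<dots> = ennreal (real (card {\<sigma>. \<sigma> permutes {..<n} \<and> Q - w i \<le> ?s \<sigma> \<and> ?s \<sigma> < Q}))"
    by (simp add: ennreal_of_nat_eq_real_of_nat)
  finally show ?thesis
    unfolding shapley_def by (simp add: ennreal_mult[symmetric])
qed

lemma shapley_nonneg: "0 \<le> shapley n w Q i"
  by (simp add: shapley_def)

section \<open>Independent weights drawn from a density\<close>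

locale positive_density =
  fixes f :: "real \<Rightarrow> real"
  assumes f_meas [measurable]: "f \<in> borel_measurable borel"
    and f_nonneg: "\<And>t. 0 \<le> f t"
    and f_neg_zero: "\<And>t. t < 0 \<Longrightarrow> f t = 0"
    and f_int: "integrable lborel f"
    and f_one: "(\<integral>t. f t \<partial>lborel) = 1"
begin

lemma nn_f_one: "(\<integral>\<^sup>+ t. ennreal (f t) \<partial>lborel) = 1"
  using nn_integral_eq_integral[OF f_int] f_nonneg f_one by simp

sublocale X: prob_space "Xdist f"
  by (rule prob_spaceI) (simp add: Xdist_def emeasure_density nn_f_one)

sublocale P: product_prob_space "\<lambda>_. Xdist f" I for I
  by unfold_locales

lemma AE_nonneg: "AE x in Xdist f. 0 \<le> x"
proof -
  have "ennreal (f x) \<noteq> 0 \<longrightarrow> 0 \<le> x" for x using f_neg_zero[of x] by (cases "x < 0") auto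
  then show ?thesis unfolding Xdist_def by (subst AE_density) (auto simp: less_le)
qed

lemma emeasure_Xdist: "A \<in> sets borel \<Longrightarrow> emeasure (Xdist f) A = (\<integral>\<^sup>+ s. restr f A s \<partial>lborel)"
  by (simp add: Xdist_def emeasure_density restr_def)

text \<open>Induction over the coordinates: one in \<open>J\<close> contributes a convolution with
  \<open>restr f A\<close>, one outside \<open>J\<close> contributes the mass of \<open>A\<close>.
  Hence only the cardinalities appear.\<close>

lemma nn_integral_PiM_restr:
  assumes "finite I" "J \<subseteq> I" and [measurable]: "A \<in> sets borel" "h \<in> borel_measurable borel"
  shows "(\<integral>\<^sup>+ w. (\<Prod>j\<in>I. indicator A (w j)) * h (t - (\<Sum>j\<in>J. w j)) \<partial>PiM I (\<lambda>_. Xdist f))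
     = emeasure (Xdist f) A ^ (card I - card J) * (conv (restr f A) ^^ card J) h t"
  using assms(1,2)
proof (induction I arbitrary: J t rule: finite_induct)
  case empty
  interpret e: product_sigma_finite "\<lambda>_::nat. Xdist f" by unfold_locales
  from empty show ?case by (simp add: nn_integral_count_space_finite PiM_empty)
next
  case (insert i I)
  note [simp] = insert.hyps
  have J_fin: "finite J" using finite_subset[OF insert.prems] by simp
  let ?g = "\<lambda>w. (\<Prod>j\<in>insert i I. indicator A (w j)) * h (t - (\<Sum>j\<in>J. w j)) :: ennreal"
  have meas: "?g \<in> borel_measurable (PiM (insert i I) (\<lambda>_. Xdist f))"
    by (rule prod_sum_measurable[OF insert.prems assms(3,4)])
  have "(\<integral>\<^sup>+ w. ?g w \<partial>PiM (insert i I) (\<lambda>_. Xdist f))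
     = (\<integral>\<^sup>+ y. \<integral>\<^sup>+ x. ?g (x(i := y)) \<partial>PiM I (\<lambda>_. Xdist f) \<partial>Xdist f)"
    by (rule P.product_nn_integral_insert_rev) (use meas in auto)
  also have "\<dots> = (\<integral>\<^sup>+ y. \<integral>\<^sup>+ x. indicator A y * ((\<Prod>j\<in>I. indicator A (x j)) *
       h ((if i \<in> J then t - y else t) - (\<Sum>j\<in>J - {i}. x j))) \<partial>PiM I (\<lambda>_. Xdist f) \<partial>Xdist f)"
  proof (intro nn_integral_cong)
    fix y x
    have "(\<Prod>j\<in>I. indicator A ((x(i := y)) j)) = (\<Prod>j\<in>I. indicator A (x j) :: ennreal)"
      using insert.hyps by (intro prod.cong) auto
    moreover have "(\<Sum>j\<in>J. (x(i := y)) j) = (if i \<in> J then y else 0) + (\<Sum>j\<in>J - {i}. x j)"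
      using J_fin by (cases "i \<in> J") (auto simp: sum.remove intro!: sum.cong)
    ultimately show "?g (x(i := y)) = indicator A y * ((\<Prod>j\<in>I. indicator A (x j)) *
       h ((if i \<in> J then t - y else t) - (\<Sum>j\<in>J - {i}. x j)))"
      by (simp add: mult.assoc diff_diff_eq)
  qed
  also have "\<dots> = (\<integral>\<^sup>+ y. indicator A y * (emeasure (Xdist f) A ^ (card I - card (J - {i})) *
      (conv (restr f A) ^^ card (J - {i})) h (if i \<in> J then t - y else t)) \<partial>Xdist f)"
  proof (rule nn_integral_cong)
    fix y
    have "J - {i} \<subseteq> I" using insert.prems by auto
    then show "(\<integral>\<^sup>+ x. indicator A y * ((\<Prod>j\<in>I. indicator A (x j)) *
       h ((if i \<in> J then t - y else t) - (\<Sum>j\<in>J - {i}. x j))) \<partial>PiM I (\<lambda>_. Xdist f))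
      = indicator A y * (emeasure (Xdist f) A ^ (card I - card (J - {i})) *
      (conv (restr f A) ^^ card (J - {i})) h (if i \<in> J then t - y else t))"
      by (subst nn_integral_cmult[OF prod_sum_measurable[OF _ assms(3,4)]], assumption, subst insert.IH) auto
  qed
  also have "\<dots> = emeasure (Xdist f) A ^ (card (insert i I) - card J) * (conv (restr f A) ^^ card J) h t"
  proof (cases "i \<in> J")
    case True
    define c where "c = card (J - {i})"
    have c: "card (J - {i}) = c" "card J = Suc c"
      using card.remove[OF J_fin True] by (simp_all only: c_def)
    have G: "(conv (restr f A) ^^ c) h \<in> borel_measurable borel" by measurable
    show ?thesis unfolding c
      using nn_integral_Xdist_conv[OF f_meas assms(3) G, of "emeasure (Xdist f) A ^ (card I - c)" t]
      by (simp only: True if_True card_insert_disjoint[OF insert.hyps] diff_Suc_Suc funpow.simps comp_apply)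
  next
    case False
    then have JI: "J \<subseteq> I" using insert.prems by auto
    then have "card J \<le> card I" by (intro card_mono) auto
    have "(\<integral>\<^sup>+ y. indicator A y * (emeasure (Xdist f) A ^ (card I - card J) * (conv (restr f A) ^^ card J) h t) \<partial>Xdist f)
      = (\<integral>\<^sup>+ y. indicator A y \<partial>Xdist f) * (emeasure (Xdist f) A ^ (card I - card J) * (conv (restr f A) ^^ card J) h t)"
      by (rule nn_integral_multc) measurable
    then show ?thesis using False \<open>card J \<le> card I\<close> by (simp add: Suc_diff_le mult.assoc)
  qed
  finally show ?case .
qed

text \<open>With all other coordinates fixed, a tie confines one coordinate to a single point, and
  the law has no atoms. It makes the extremal agent almost surely unique.\<close>

lemma AE_no_ties: "AE w in samples f n. \<forall>i<n. \<forall>j<n. i \<noteq> j \<longrightarrow> w i \<noteq> w j"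
proof -
  have "AE w in samples f n. w i \<noteq> w j" if ij: "i < n" "j < n" "i \<noteq> j" for i j
  proof -
    let ?P = "PiM {..<n} (\<lambda>_. Xdist f)"
    have I: "{..<n} = insert i ({..<n} - {i})" using ij by auto
    have [measurable]: "(\<lambda>w. w i) \<in> borel_measurable ?P" "(\<lambda>w. w j) \<in> borel_measurable ?P"
      using ij by (auto intro: component_PiM_Xdist)
    have set: "{w \<in> space ?P. w i = w j} \<in> sets ?P" by measurable
    have gm: "(\<lambda>w. if w i = w j then 1 else 0 :: ennreal) \<in> borel_measurable ?P" by measurable
    have "emeasure ?P {w \<in> space ?P. w i = w j} = (\<integral>\<^sup>+ w. indicator {w \<in> space ?P. w i = w j} w \<partial>?P)"
      using set by simp
    also have "\<dots> = (\<integral>\<^sup>+ w. (if w i = w j then 1 else 0) \<partial>?P)"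
      by (intro nn_integral_cong) (auto simp: indicator_def)
    also have "\<dots> = (\<integral>\<^sup>+ w. (if w i = w j then 1 else 0) \<partial>PiM (insert i ({..<n} - {i})) (\<lambda>_. Xdist f))"
      using I by simp
    also have "\<dots> = (\<integral>\<^sup>+ x. \<integral>\<^sup>+ y. (if (x(i := y)) i = (x(i := y)) j then 1 else 0) \<partial>Xdist f \<partial>PiM ({..<n} - {i}) (\<lambda>_. Xdist f))"
      by (rule P.product_nn_integral_insert) (use gm I in auto)
    also have "\<dots> = (\<integral>\<^sup>+ x. 0 \<partial>PiM ({..<n} - {i}) (\<lambda>_. Xdist f))"
    proof (rule nn_integral_cong)
      fix x
      have "(\<integral>\<^sup>+ y. (if (x(i := y)) i = (x(i := y)) j then 1 else 0) \<partial>Xdist f) = (\<integral>\<^sup>+ y. indicator {x j} y \<partial>Xdist f)"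
        using ij by (intro nn_integral_cong) (auto simp: indicator_def)
      also have "\<dots> = emeasure (Xdist f) {x j}" by simp
      also have "\<dots> = 0" unfolding Xdist_def
        by (subst emeasure_density) (auto intro!: nn_integral_null_set)
      finally show "(\<integral>\<^sup>+ y. (if (x(i := y)) i = (x(i := y)) j then 1 else 0) \<partial>Xdist f) = 0" .
    qed
    finally have "emeasure ?P {w \<in> space ?P. w i = w j} = 0" by simp
    then have "{w \<in> space ?P. \<not> w i \<noteq> w j} \<in> null_sets ?P" using set by auto
    then show ?thesis unfolding samples_def by (rule AE_I'[where P="\<lambda>w. w i \<noteq> w j"]) auto
  qed
  then have "AE w in samples f n. \<forall>i\<in>{..<n}. \<forall>j\<in>{..<n}. i \<noteq> j \<longrightarrow> w i \<noteq> w j"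
    by (intro AE_finite_allI) auto
  then show ?thesis by eventually_elim auto
qed

end

text \<open>The two cases of the theorem are \<open>S x = {..x}\<close> and \<open>S x = {x..}\<close>: an agent is extremal iff all
  weights lie in \<open>S\<close> of its own weight.\<close>

locale extremal_sampling = positive_density f for f :: "real \<Rightarrow> real" +
  fixes S :: "real \<Rightarrow> real set"
  assumes S_meas: "{z. snd z \<in> S (fst z)} \<in> sets (borel \<Otimes>\<^sub>M borel)"
    and S_refl: "x \<in> S x"
    and S_antisym: "y \<in> S x \<Longrightarrow> x \<in> S y \<Longrightarrow> x = y"
    and S_trans: "y \<in> S x \<Longrightarrow> z \<in> S y \<Longrightarrow> z \<in> S x"
    and S_total: "x \<in> S y \<or> y \<in> S x"
begin

lemma S_pred [measurable (raw)]:
  assumes [measurable]: "g \<in> borel_measurable M" "h \<in> borel_measurable M"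
  shows "Measurable.pred M (\<lambda>w. h w \<in> S (g w))"
proof -
  have "(\<lambda>w. (g w, h w)) -` {z. snd z \<in> S (fst z)} \<inter> space M \<in> sets M"
    by (rule measurable_sets[OF _ S_meas]) measurable
  then show ?thesis unfolding pred_def by (simp add: vimage_def Int_def conj_commute)
qed

lemma S_borel [measurable]: "S x \<in> sets borel"
proof -
  have "Measurable.pred borel (\<lambda>y. y \<in> S x)" by (rule S_pred) measurable
  then show ?thesis by (simp add: pred_def)
qed

lemma ex_extremal: "0 < (n::nat) \<Longrightarrow> \<exists>i<n. \<forall>j<n. w j \<in> S (w i)"
proof (induction n)
  case (Suc n)
  show ?case
  proof (cases "n = 0")
    case False
    then obtain i where i: "i < n" "\<forall>j<n. w j \<in> S (w i)" using Suc by auto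
    consider "w n \<in> S (w i)" | "w i \<in> S (w n)" using S_total by blast
    then show ?thesis
    proof cases
      case 1 then show ?thesis using i by (intro exI[of _ i]) (auto simp: less_Suc_eq)
    next
      case 2 then show ?thesis using i S_trans S_refl by (intro exI[of _ n]) (auto simp: less_Suc_eq)
    qed
  qed (auto simp: S_refl)
qed simp

lemma extremal_props:
  assumes "0 < n"
  shows "extremal S n w < n" "j < n \<Longrightarrow> w j \<in> S (w (extremal S n w))"
  using someI_ex[OF ex_extremal[OF assms, of w]] unfolding extremal_def by auto

lemma component_measurable: "i < n \<Longrightarrow> (\<lambda>w. w i) \<in> borel_measurable (samples f n)"
  unfolding samples_def by (rule component_PiM_Xdist) simp

text \<open>The choice of an agent depends on \<open>w\<close> only through the set
  \<open>B w\<close> of all extremal agents. That set takes finitely many values, each on a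
  measurable event, so an arbitrary choice does no harm.\<close>

lemma extremal_measurable:
  assumes "\<And>i. i < n \<Longrightarrow> \<Psi> i \<in> borel_measurable (samples f n)" "0 < n"
  shows "(\<lambda>w. \<Psi> (extremal S n w) w :: real) \<in> borel_measurable (samples f n)"
proof -
  define B where "B w = {i. i < n \<and> (\<forall>j<n. w j \<in> S (w i))}" for w :: "nat \<Rightarrow> real"
  have B: "B \<in> measurable (samples f n) (count_space (Pow {..<n}))"
  proof (subst measurable_count_space_eq2, simp, intro conjI ballI)
    show "B \<in> space (samples f n) \<rightarrow> Pow {..<n}" by (auto simp: B_def)
    fix T assume T: "T \<in> Pow {..<n}"
    have "B -` {T} \<inter> space (samples f n) = {w \<in> space (samples f n). \<forall>i\<in>{..<n}. (i \<in> T) = (\<forall>j\<in>{..<n}. w j \<in> S (w i))}"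
    proof -
      have "{i. i < n \<and> P i} = T \<longleftrightarrow> (\<forall>i\<in>{..<n}. (i \<in> T) = P i)" for P
        using T by auto
      then have "B w = T \<longleftrightarrow> (\<forall>i\<in>{..<n}. (i \<in> T) = (\<forall>j\<in>{..<n}. w j \<in> S (w i)))" for w
        unfolding B_def by (simp only: Ball_def lessThan_iff)
      then show ?thesis by blast
    qed
    also have "\<dots> \<in> sets (samples f n)"
    proof -
      have "Measurable.pred (samples f n) (\<lambda>w. \<forall>j\<in>{..<n}. w j \<in> S (w i))" if "i < n" for i
      proof (rule pred_intros_finite(3))
        fix j assume "j \<in> {..<n}"
        then have "(\<lambda>w. w j) \<in> borel_measurable (samples f n)" by (intro component_measurable) simp
        with component_measurable[OF that]
        show "Measurable.pred (samples f n) (\<lambda>w. w j \<in> S (w i))" by (rule S_pred)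
      qed simp
      then have "Measurable.pred (samples f n) (\<lambda>w. (i \<in> T) = (\<forall>j\<in>{..<n}. w j \<in> S (w i)))" if "i < n" for i
        using that by (intro pred_intros_logic(6)) auto
      then have "Measurable.pred (samples f n) (\<lambda>w. \<forall>i\<in>{..<n}. (i \<in> T) = (\<forall>j\<in>{..<n}. w j \<in> S (w i)))"
        by (intro pred_intros_finite(3)) auto
      then show ?thesis by (simp only: pred_def)
    qed
    finally show "B -` {T} \<inter> space (samples f n) \<in> sets (samples f n)" .
  qed
  define \<Phi> where "\<Phi> T = (if (SOME i. i \<in> T) < n then \<Psi> (SOME i. i \<in> T) else (\<lambda>_. 0))" for T
  have "(\<lambda>w. \<Phi> (B w) w) \<in> borel_measurable (samples f n)"
    by (rule measurable_compose_countable'[OF _ B]) (auto simp: \<Phi>_def assms intro: countable_finite)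
  moreover have "\<Phi> (B w) w = \<Psi> (extremal S n w) w" for w
    using extremal_props(1)[OF assms(2), of w] by (simp add: \<Phi>_def B_def extremal_def)
  ultimately show ?thesis by simp
qed

text \<open>Without ties, antisymmetry of \<open>S\<close> makes the events that all other weights
  lie in \<open>S (w i)\<close> disjoint in \<open>i\<close>, and one of them always occurs.\<close>

lemma nn_integral_extremal:
  assumes n: "0 < n" and m: "\<And>i. i < n \<Longrightarrow> \<Psi> i \<in> borel_measurable (samples f n)"
  shows "(\<integral>\<^sup>+ w. \<Psi> (extremal S n w) w \<partial>samples f n)
    = (\<Sum>i<n. \<integral>\<^sup>+ w. (\<Prod>j\<in>{..<n} - {i}. indicator (S (w i)) (w j)) * \<Psi> i w \<partial>samples f n)"
proof -
  let ?ind = "\<lambda>i w. (\<Prod>j\<in>{..<n} - {i}. indicator (S (w i)) (w j)) :: ennreal"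
  have "(\<integral>\<^sup>+ w. \<Psi> (extremal S n w) w \<partial>samples f n) = (\<integral>\<^sup>+ w. (\<Sum>i<n. ?ind i w * \<Psi> i w) \<partial>samples f n)"
  proof (rule nn_integral_cong_AE, use AE_no_ties[of n] in eventually_elim)
    fix w :: "nat \<Rightarrow> real" assume nt: "\<forall>i<n. \<forall>j<n. i \<noteq> j \<longrightarrow> w i \<noteq> w j"
    let ?e = "extremal S n w"
    have z: "?ind i w = (if i = ?e then 1 else 0)" if i: "i < n" for i
    proof (cases "i = ?e")
      case True
      then show ?thesis using extremal_props(2)[OF n, of _ w] by (simp add: indicator_def)
    next
      case False
      have "w i \<in> S (w ?e)" using extremal_props(2)[OF n, of i w] i by auto
      moreover have "w i \<noteq> w ?e" using nt i False extremal_props(1)[OF n, of w] by auto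
      ultimately have "w ?e \<notin> S (w i)" using S_antisym by blast
      then have "\<exists>j\<in>{..<n} - {i}. indicator (S (w i)) (w j) = (0::ennreal)"
        using False extremal_props(1)[OF n, of w] by (intro bexI[of _ ?e]) auto
      then show ?thesis using False by (simp only: prod_zero_iff finite_Diff finite_lessThan if_False) simp
    qed
    have "(\<Sum>i<n. ?ind i w * \<Psi> i w) = (\<Sum>i<n. if i = ?e then \<Psi> i w else 0)"
      using z by (intro sum.cong) auto
    also have "\<dots> = \<Psi> ?e w" using extremal_props(1)[OF n, of w] by simp
    finally show "\<Psi> ?e w = (\<Sum>i<n. ?ind i w * \<Psi> i w)" by simp
  qed
  also have "\<dots> = (\<Sum>i<n. \<integral>\<^sup>+ w. ?ind i w * \<Psi> i w \<partial>samples f n)"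
  proof (rule nn_integral_sum)
    fix i assume i: "i \<in> {..<n}"
    have "?ind i \<in> borel_measurable (samples f n)"
      unfolding indicator_def
    proof (rule borel_measurable_prod_ennreal)
      fix j assume j: "j \<in> {..<n} - {i}"
      have "Measurable.pred (samples f n) (\<lambda>w. w j \<in> S (w i))"
        by (rule S_pred; rule component_measurable) (use i j in auto)
      then show "(\<lambda>w. of_bool (w j \<in> S (w i)) :: ennreal) \<in> borel_measurable (samples f n)"
        by measurable
    qed
    then show "(\<lambda>w. ?ind i w * \<Psi> i w) \<in> borel_measurable (samples f n)"
      using m[of i] i by simp
  qed
  finally show ?thesis .
qed

definition prob_S :: "real \<Rightarrow> ennreal" where
  "prob_S y = emeasure (Xdist f) (S y)"

lemma inner_measurable:
  fixes h :: "real \<Rightarrow> real \<Rightarrow> ennreal"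
  assumes h: "(\<lambda>z. h (fst z) (snd z)) \<in> borel_measurable (borel \<Otimes>\<^sub>M borel)"
    and J: "finite I" "J \<subseteq> I" and g: "g \<in> borel_measurable N"
    and c: "\<And>j. j \<in> I \<Longrightarrow> (\<lambda>w. k j w) \<in> borel_measurable N"
  shows "(\<lambda>w. (\<Prod>j\<in>I. indicator (S (g w)) (k j w)) * h (g w) (t - (\<Sum>j\<in>J. k j w))) \<in> borel_measurable N"
proof (rule borel_measurable_times_ennreal)
  show "(\<lambda>w. \<Prod>j\<in>I. indicator (S (g w)) (k j w) :: ennreal) \<in> borel_measurable N"
  proof (rule borel_measurable_prod_ennreal)
    fix j assume "j \<in> I"
    then have "Measurable.pred N (\<lambda>w. k j w \<in> S (g w))" by (intro S_pred g c)
    then show "(\<lambda>w. indicator (S (g w)) (k j w) :: ennreal) \<in> borel_measurable N"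
      unfolding indicator_def by measurable
  qed
  have "(\<lambda>w. \<Sum>j\<in>J. k j w) \<in> borel_measurable N"
    using J by (intro borel_measurable_sum c) auto
  then have "(\<lambda>w. (g w, t - (\<Sum>j\<in>J. k j w))) \<in> measurable N (borel \<Otimes>\<^sub>M borel)"
    using g by simp
  from measurable_compose[OF this h]
  show "(\<lambda>w. h (g w) (t - (\<Sum>j\<in>J. k j w))) \<in> borel_measurable N" by simp
qed

text \<open>The expression is recognised as an integral over \<open>m\<close> independent
  coordinates in which \<open>y\<close> is a parameter; such integrals depend measurably on the
  parameter.\<close>

lemma conditional_measurable:
  fixes h :: "real \<Rightarrow> real \<Rightarrow> ennreal"
  assumes h: "(\<lambda>z. h (fst z) (snd z)) \<in> borel_measurable (borel \<Otimes>\<^sub>M borel)"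
    and J: "k \<le> m"
  shows "(\<lambda>y. prob_S y ^ (m - k) * (conv (restr f (S y)) ^^ k) (h y) t) \<in> borel_measurable borel"
proof -
  let ?P = "PiM {..<m} (\<lambda>_. Xdist f)"
  have hy: "h y \<in> borel_measurable borel" for y
    using measurable_compose[OF measurable_Pair1'[of y borel borel] h] by simp
  have s: "sigma_finite_measure ?P"
    using prob_space_imp_sigma_finite[OF P.prob_space_axioms[of "{..<m}"]] by simp
  have "(\<lambda>y. \<integral>\<^sup>+ x. (\<Prod>j\<in>{..<m}. indicator (S y) (x j)) * h y (t - (\<Sum>j\<in>{..<k}. x j)) \<partial>?P) \<in> borel_measurable borel"
  proof (rule sigma_finite_measure.borel_measurable_nn_integral[OF s])
    show "(\<lambda>(y, x). (\<Prod>j\<in>{..<m}. indicator (S y) (x j)) * h y (t - (\<Sum>j\<in>{..<k}. x j))) \<in> borel_measurable (borel \<Otimes>\<^sub>M ?P)"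
      unfolding case_prod_beta
      by (rule inner_measurable[OF h, where g=fst and k="\<lambda>j z. snd z j"])
         (use J in \<open>auto intro!: measurable_compose[OF measurable_snd component_PiM_Xdist]\<close>)
  qed
  moreover have "(\<integral>\<^sup>+ x. (\<Prod>j\<in>{..<m}. indicator (S y) (x j)) * h y (t - (\<Sum>j\<in>{..<k}. x j)) \<partial>?P)
     = prob_S y ^ (m - k) * (conv (restr f (S y)) ^^ k) (h y) t" for y
    using nn_integral_PiM_restr[of "{..<m}" "{..<k}" "S y" "h y" t] J hy S_borel by (simp add: prob_S_def)
  ultimately show ?thesis by simp
qed

text \<open>Coordinate \<open>i\<close> is integrated last. At \<open>w i = y\<close> the indicators
  restrict each of the other \<open>n - 1\<close> coordinates to \<open>S y\<close>, which is the
  situation of \<open>nn_integral_PiM_restr\<close>.\<close>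

lemma nn_integral_conditional:
  fixes h :: "real \<Rightarrow> real \<Rightarrow> ennreal"
  assumes h: "(\<lambda>z. h (fst z) (snd z)) \<in> borel_measurable (borel \<Otimes>\<^sub>M borel)"
    and i: "i < n" and J: "J \<subseteq> {..<n} - {i}"
  shows "(\<integral>\<^sup>+ w. (\<Prod>j\<in>{..<n} - {i}. indicator (S (w i)) (w j)) * h (w i) (t - (\<Sum>j\<in>J. w j)) \<partial>samples f n)
    = (\<integral>\<^sup>+ y. prob_S y ^ (n - 1 - card J) * (conv (restr f (S y)) ^^ card J) (h y) t \<partial>Xdist f)"
proof -
  let ?I = "{..<n} - {i}"
  have I: "{..<n} = insert i ?I" using i by auto
  have hy: "h y \<in> borel_measurable borel" for y
    using measurable_compose[OF measurable_Pair1'[of y borel borel] h] by simp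
  have m: "(\<lambda>w. (\<Prod>j\<in>?I. indicator (S (w i)) (w j)) * h (w i) (t - (\<Sum>j\<in>J. w j))) \<in> borel_measurable (PiM (insert i ?I) (\<lambda>_. Xdist f))"
    by (rule inner_measurable[OF h]) (use J in \<open>auto intro!: component_PiM_Xdist\<close>)
  have "(\<integral>\<^sup>+ w. (\<Prod>j\<in>?I. indicator (S (w i)) (w j)) * h (w i) (t - (\<Sum>j\<in>J. w j)) \<partial>samples f n)
    = (\<integral>\<^sup>+ w. (\<Prod>j\<in>?I. indicator (S (w i)) (w j)) * h (w i) (t - (\<Sum>j\<in>J. w j)) \<partial>PiM (insert i ?I) (\<lambda>_. Xdist f))"
    unfolding samples_def using I by simp
  also have "\<dots> = (\<integral>\<^sup>+ y. \<integral>\<^sup>+ x. (\<Prod>j\<in>?I. indicator (S ((x(i := y)) i)) ((x(i := y)) j)) *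
       h ((x(i := y)) i) (t - (\<Sum>j\<in>J. (x(i := y)) j)) \<partial>PiM ?I (\<lambda>_. Xdist f) \<partial>Xdist f)"
    by (rule P.product_nn_integral_insert_rev) (use m in auto)
  also have "\<dots> = (\<integral>\<^sup>+ y. \<integral>\<^sup>+ x. (\<Prod>j\<in>?I. indicator (S y) (x j)) * h y (t - (\<Sum>j\<in>J. x j)) \<partial>PiM ?I (\<lambda>_. Xdist f) \<partial>Xdist f)"
  proof (intro nn_integral_cong)
    fix y x
    have "(\<Prod>j\<in>?I. indicator (S ((x(i := y)) i)) ((x(i := y)) j)) = (\<Prod>j\<in>?I. indicator (S y) (x j) :: ennreal)"
      by (intro prod.cong) auto
    moreover have "(\<Sum>j\<in>J. (x(i := y)) j) = (\<Sum>j\<in>J. x j)" using J by (intro sum.cong) auto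
    ultimately show "(\<Prod>j\<in>?I. indicator (S ((x(i := y)) i)) ((x(i := y)) j)) * h ((x(i := y)) i) (t - (\<Sum>j\<in>J. (x(i := y)) j))
      = (\<Prod>j\<in>?I. indicator (S y) (x j)) * h y (t - (\<Sum>j\<in>J. x j))" by simp
  qed
  also have "\<dots> = (\<integral>\<^sup>+ y. prob_S y ^ (n - 1 - card J) * (conv (restr f (S y)) ^^ card J) (h y) t \<partial>Xdist f)"
  proof (rule nn_integral_cong)
    fix y
    have "card ?I = n - 1" using i by simp
    then show "(\<integral>\<^sup>+ x. (\<Prod>j\<in>?I. indicator (S y) (x j)) * h y (t - (\<Sum>j\<in>J. x j)) \<partial>PiM ?I (\<lambda>_. Xdist f))
      = prob_S y ^ (n - 1 - card J) * (conv (restr f (S y)) ^^ card J) (h y) t"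
      using nn_integral_PiM_restr[of ?I J "S y" "h y" t] J hy S_borel by (simp add: prob_S_def)
  qed
  finally show ?thesis .
qed

lemma win_measurable: "(\<lambda>z. win (fst z) (snd z)) \<in> borel_measurable (borel \<Otimes>\<^sub>M borel)"
  unfolding indicator_def greaterThanAtMost_iff by measurable

lemma shapley_measurable:
  assumes "i < n"
  shows "(\<lambda>w. shapley n w Q i) \<in> borel_measurable (samples f n)"
proof -
  have "(\<lambda>w. ennreal (shapley n w Q i)) \<in> borel_measurable (samples f n)"
    unfolding ennreal_shapley
  proof (intro borel_measurable_sum borel_measurable_times_ennreal)
    fix \<sigma> :: "nat \<Rightarrow> nat"
    have "(\<lambda>w. Q - (\<Sum>j\<in>{j. j < n \<and> \<sigma> j < \<sigma> i}. w j)) \<in> borel_measurable (samples f n)"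
      by (intro borel_measurable_diff borel_measurable_sum component_measurable) auto
    then have "(\<lambda>w. (w i, Q - (\<Sum>j\<in>{j. j < n \<and> \<sigma> j < \<sigma> i}. w j))) \<in> measurable (samples f n) (borel \<Otimes>\<^sub>M borel)"
      using component_measurable[OF assms] by simp
    from measurable_compose[OF this win_measurable]
    show "(\<lambda>w. win (w i) (Q - (\<Sum>j\<in>{j. j < n \<and> \<sigma> j < \<sigma> i}. w j))) \<in> borel_measurable (samples f n)" by simp
  qed simp
  then have "(\<lambda>w. enn2real (ennreal (shapley n w Q i))) \<in> borel_measurable (samples f n)" by (rule measurable_compose) simp
  then show ?thesis by (simp add: shapley_nonneg)
qed

text \<open>No factor \<open>1 / n\<close> occurs: the uniform position of the agent contributes
  \<open>1 / n\<close>, and the \<open>n\<close> candidates for being extremal contribute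
  \<open>n\<close>.\<close>

definition shap_density :: "nat \<Rightarrow> real \<Rightarrow> real \<Rightarrow> ennreal" where
  "shap_density n Q y = (\<Sum>k<n. prob_S y ^ (n - 1 - k) * (conv (restr f (S y)) ^^ k) (win y) Q)"

lemma shap_density_measurable: "shap_density n Q \<in> borel_measurable borel"
  unfolding shap_density_def[abs_def]
  by (intro borel_measurable_sum conditional_measurable win_measurable) auto

text \<open>The contribution of agent \<open>i\<close> under \<open>\<sigma>\<close> depends only on
  the position \<open>\<sigma> i\<close>. Summing over the agents first reindexes to a sum over
  positions, the same for every \<open>\<sigma>\<close>, so that the number of permutations cancels
  \<open>1 / fact n\<close>.\<close>

lemma expectation_shapley:
  assumes n: "0 < n"
  shows "(\<integral>w. shapley n w Q (extremal S n w) \<partial>samples f n) = enn2real (\<integral>\<^sup>+ y. shap_density n Q y \<partial>Xdist f)"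
proof -
  let ?X = "\<lambda>k. (\<integral>\<^sup>+ y. prob_S y ^ (n - 1 - k) * (conv (restr f (S y)) ^^ k) (win y) Q \<partial>Xdist f)"
  have "(\<integral>w. shapley n w Q (extremal S n w) \<partial>samples f n)
     = enn2real (\<integral>\<^sup>+ w. ennreal (shapley n w Q (extremal S n w)) \<partial>samples f n)"
    using extremal_measurable[of n "\<lambda>i w. shapley n w Q i"] n shapley_measurable
    by (intro integral_eq_nn_integral) (auto simp: shapley_nonneg)
  also have "(\<integral>\<^sup>+ w. ennreal (shapley n w Q (extremal S n w)) \<partial>samples f n)
     = (\<Sum>i<n. \<integral>\<^sup>+ w. (\<Prod>j\<in>{..<n} - {i}. indicator (S (w i)) (w j)) * ennreal (shapley n w Q i) \<partial>samples f n)"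
    by (rule nn_integral_extremal[where \<Psi>="\<lambda>i w. ennreal (shapley n w Q i)", OF n])
       (rule measurable_compose[OF shapley_measurable measurable_ennreal])
  also have "\<dots> = (\<Sum>i<n. \<Sum>\<sigma> | \<sigma> permutes {..<n}. ennreal (1 / fact n) * ?X (\<sigma> i))"
  proof (rule sum.cong[OF refl])
    fix i assume "i \<in> {..<n}"
    then have i: "i < n" by simp
    let ?J = "\<lambda>\<sigma>. {j. j < n \<and> \<sigma> j < \<sigma> i}"
    let ?F = "\<lambda>\<sigma> w. (\<Prod>j\<in>{..<n} - {i}. indicator (S (w i)) (w j)) * win (w i) (Q - (\<Sum>j\<in>?J \<sigma>. w j))"
    have m: "?F \<sigma> \<in> borel_measurable (samples f n)" for \<sigma> :: "nat \<Rightarrow> nat"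
      by (rule inner_measurable[OF win_measurable]) (use i in \<open>auto intro!: component_measurable\<close>)
    have "(\<integral>\<^sup>+ w. (\<Prod>j\<in>{..<n} - {i}. indicator (S (w i)) (w j)) * ennreal (shapley n w Q i) \<partial>samples f n)
      = (\<integral>\<^sup>+ w. (\<Sum>\<sigma> | \<sigma> permutes {..<n}. ennreal (1 / fact n) * ?F \<sigma> w) \<partial>samples f n)"
      unfolding ennreal_shapley sum_distrib_left
      by (intro nn_integral_cong sum.cong refl) (simp only: mult_ac)
    also have "\<dots> = (\<Sum>\<sigma> | \<sigma> permutes {..<n}. \<integral>\<^sup>+ w. ennreal (1 / fact n) * ?F \<sigma> w \<partial>samples f n)"
      by (rule nn_integral_sum) (rule borel_measurable_times_ennreal[OF _ m], simp)
    also have "\<dots> = (\<Sum>\<sigma> | \<sigma> permutes {..<n}. ennreal (1 / fact n) * (\<integral>\<^sup>+ w. ?F \<sigma> w \<partial>samples f n))"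
      by (rule sum.cong[OF refl], rule nn_integral_cmult[OF m])
    also have "\<dots> = (\<Sum>\<sigma> | \<sigma> permutes {..<n}. ennreal (1 / fact n) * ?X (\<sigma> i))"
    proof (rule sum.cong[OF refl])
      fix \<sigma> assume "\<sigma> \<in> {\<sigma>. \<sigma> permutes {..<n}}"
      then have c: "card (?J \<sigma>) = \<sigma> i" using card_predecessors i by auto
      have "?J \<sigma> \<subseteq> {..<n} - {i}" by auto
      from nn_integral_conditional[OF win_measurable i this]
      show "ennreal (1 / fact n) * (\<integral>\<^sup>+ w. ?F \<sigma> w \<partial>samples f n) = ennreal (1 / fact n) * ?X (\<sigma> i)"
        unfolding c by simp
    qed
    finally show "(\<integral>\<^sup>+ w. (\<Prod>j\<in>{..<n} - {i}. indicator (S (w i)) (w j)) * ennreal (shapley n w Q i) \<partial>samples f n)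
      = (\<Sum>\<sigma> | \<sigma> permutes {..<n}. ennreal (1 / fact n) * ?X (\<sigma> i))" .
  qed
  also have "\<dots> = (\<Sum>\<sigma> | \<sigma> permutes {..<n}. \<Sum>i<n. ennreal (1 / fact n) * ?X (\<sigma> i))"
    by (rule sum.swap)
  also have "\<dots> = (\<Sum>\<sigma> | \<sigma> permutes {..<n}. \<Sum>k<n. ennreal (1 / fact n) * ?X k)"
  proof (rule sum.cong[OF refl])
    fix \<sigma> assume "\<sigma> \<in> {\<sigma>. \<sigma> permutes {..<n}}"
    then have "bij_betw \<sigma> {..<n} {..<n}" using permutes_imp_bij by auto
    then show "(\<Sum>i<n. ennreal (1 / fact n) * ?X (\<sigma> i))
      = (\<Sum>k<n. ennreal (1 / fact n) * ?X k)"
      by (rule sum.reindex_bij_betw)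
  qed
  also have "\<dots> = of_nat (fact n) * (ennreal (1 / fact n) * (\<Sum>k<n. ?X k))"
    by (simp add: sum_distrib_left card_permutations[of "{..<n}" n])
  also have "\<dots> = (\<Sum>k<n. ?X k)"
  proof -
    have "of_nat (fact n) * ennreal (1 / fact n) = ennreal (fact n * (1 / fact n))"
      by (subst ennreal_mult) (auto simp: ennreal_of_nat_eq_real_of_nat)
    also have "\<dots> = 1" by simp
    finally show ?thesis by (simp add: mult.assoc[symmetric])
  qed
  also have "\<dots> = (\<integral>\<^sup>+ y. shap_density n Q y \<partial>Xdist f)"
    unfolding shap_density_def
  proof (rule nn_integral_sum[symmetric])
    fix k assume "k \<in> {..<n}"
    then have "(\<lambda>y. prob_S y ^ (n - 1 - k) * (conv (restr f (S y)) ^^ k) (win y) Q) \<in> borel_measurable borel"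
      by (intro conditional_measurable[OF win_measurable]) auto
    then show "(\<lambda>y. prob_S y ^ (n - 1 - k) * (conv (restr f (S y)) ^^ k) (win y) Q) \<in> borel_measurable (Xdist f)"
      using measurable_cong_sets[OF sets_Xdist refl] by blast
  qed
  finally show ?thesis .
qed

lemma expectation_extremal_weight:
  assumes n: "0 < n" and h: "h \<in> borel_measurable borel" and h0: "\<And>x. 0 \<le> h x"
  shows "(\<integral>w. h (w (extremal S n w)) \<partial>samples f n) = enn2real (of_nat n * (\<integral>\<^sup>+ y. prob_S y ^ (n - 1) * ennreal (h y) \<partial>Xdist f))"
proof -
  have m: "(\<lambda>w. h (w i)) \<in> borel_measurable (samples f n)" if "i < n" for i
    using measurable_compose[OF component_measurable[OF that] h] .
  have "(\<integral>w. h (w (extremal S n w)) \<partial>samples f n)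
     = enn2real (\<integral>\<^sup>+ w. ennreal (h (w (extremal S n w))) \<partial>samples f n)"
    using extremal_measurable[of n "\<lambda>i w. h (w i)"] n m
    by (intro integral_eq_nn_integral) (auto simp: h0)
  also have "(\<integral>\<^sup>+ w. ennreal (h (w (extremal S n w))) \<partial>samples f n)
     = (\<Sum>i<n. \<integral>\<^sup>+ w. (\<Prod>j\<in>{..<n} - {i}. indicator (S (w i)) (w j)) * ennreal (h (w i)) \<partial>samples f n)"
    by (rule nn_integral_extremal[where \<Psi>="\<lambda>i w. ennreal (h (w i))", OF n])
       (rule measurable_compose[OF m measurable_ennreal])
  also have "\<dots> = (\<Sum>i<n. \<integral>\<^sup>+ y. prob_S y ^ (n - 1) * ennreal (h y) \<partial>Xdist f)"
  proof (rule sum.cong[OF refl])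
    fix i assume "i \<in> {..<n}"
    then have i: "i < n" by simp
    have hm: "(\<lambda>z. (\<lambda>y _. ennreal (h y)) (fst z) (snd z :: real)) \<in> borel_measurable (borel \<Otimes>\<^sub>M borel)"
      using measurable_compose[OF measurable_compose[OF measurable_fst[of borel "borel :: real measure"] h] measurable_ennreal] by simp
    from nn_integral_conditional[OF hm i empty_subsetI]
    show "(\<integral>\<^sup>+ w. (\<Prod>j\<in>{..<n} - {i}. indicator (S (w i)) (w j)) * ennreal (h (w i)) \<partial>samples f n)
       = (\<integral>\<^sup>+ y. prob_S y ^ (n - 1) * ennreal (h y) \<partial>Xdist f)" by simp
  qed
  also have "\<dots> = of_nat n * (\<integral>\<^sup>+ y. prob_S y ^ (n - 1) * ennreal (h y) \<partial>Xdist f)" by simp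
  finally show ?thesis .
qed

end

section \<open>From the renewal theorem to Shapley values\<close>

context extremal_sampling
begin

definition cmean :: "real \<Rightarrow> real" where
  "cmean x = (\<integral>t. t * indicator (S x) t \<partial>Xdist f) / X.prob (S x)"

text \<open>The common shape of the two errors in the theorem, so that one estimate serves both
  choices of \<open>S\<close>.\<close>

definition discrepancy :: "nat \<Rightarrow> real \<Rightarrow> real" where
  "discrepancy n Q = \<bar>(\<integral>w. shapley n w Q (extremal S n w) \<partial>samples f n)
       - (1 / real n) * (\<integral>w. w (extremal S n w) / cmean (w (extremal S n w)) \<partial>samples f n)\<bar>"

lemma borel_measurable_Xdist: "g \<in> borel_measurable borel \<Longrightarrow> g \<in> borel_measurable (Xdist f)"
  using measurable_cong_sets[OF sets_Xdist refl] by blast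

lemma prob_S_eq: "prob_S y = ennreal (X.prob (S y))"
  unfolding prob_S_def by (rule X.emeasure_eq_measure)

lemma prob_S_measurable: "prob_S \<in> borel_measurable borel"
  using conditional_measurable[of "\<lambda>_ _. 1" 0 1 0] by simp

lemma measure_S_measurable [measurable]: "(\<lambda>y. X.prob (S y)) \<in> borel_measurable borel"
proof -
  have "(\<lambda>y. enn2real (prob_S y)) \<in> borel_measurable borel" using prob_S_measurable by measurable
  then show ?thesis by (simp add: prob_S_eq)
qed

lemma cmean_measurable [measurable]: "cmean \<in> borel_measurable borel"
proof -
  have "(\<lambda>x. \<integral>t. t * indicator (S x) t \<partial>Xdist f) \<in> borel_measurable borel"
  proof (rule X.borel_measurable_lebesgue_integral)
    have "Measurable.pred (borel \<Otimes>\<^sub>M Xdist f) (\<lambda>z. snd z \<in> S (fst z))"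
      by (rule S_pred) auto
    then show "(\<lambda>(x, t). t * indicator (S x) t) \<in> borel_measurable (borel \<Otimes>\<^sub>M Xdist f)"
      unfolding case_prod_beta indicator_def by measurable
  qed
  then show ?thesis unfolding cmean_def[abs_def] by measurable
qed

lemma nn_integral_restr: "(\<integral>\<^sup>+ s. restr f (S y) s \<partial>lborel) = prob_S y"
  by (simp add: prob_S_def emeasure_Xdist)

lemma conditional_shapley_le:
  assumes "k < n"
  shows "prob_S y ^ (n - 1 - k) * (conv (restr f (S y)) ^^ k) (win y) Q \<le> ennreal (X.prob (S y) ^ (n - 1))"
proof -
  have [measurable]: "restr f (S y) \<in> borel_measurable borel" by (rule restr_measurable) auto
  have "mgf (restr f (S y)) 0 = prob_S y" by (simp add: mgf_def nn_integral_restr)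
  then have "(conv (restr f (S y)) ^^ k) (win y) Q \<le> prob_S y ^ k"
    using conv_pow_win_le[of "restr f (S y)" 0 k y Q] by simp
  then have "prob_S y ^ (n - 1 - k) * (conv (restr f (S y)) ^^ k) (win y) Q \<le> prob_S y ^ (n - 1 - k) * prob_S y ^ k"
    by (rule mult_left_mono) simp
  also have "\<dots> = ennreal (X.prob (S y) ^ (n - 1 - k + k))"
    by (simp add: prob_S_eq power_add ennreal_mult ennreal_power)
  finally show ?thesis using assms by simp
qed

text \<open>Both expectations become integrals over the extremal weight \<open>y\<close>, so a
  pointwise comparison suffices. The second integrand is not integrable a priori; this follows from
  the first being bounded by \<open>n\<close> and the difference being dominated by
  \<open>b\<close>.\<close>

lemma expectation_difference_le:
  assumes n: "0 < n"
    and bnd: "AE y in Xdist f. \<bar>enn2real (shap_density n Q y) - X.prob (S y) ^ (n - 1) * (y / cmean y)\<bar> \<le> b y"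
    and b: "integrable (Xdist f) b"
    and h: "AE y in Xdist f. 0 \<le> y \<longrightarrow> 0 \<le> y / cmean y"
  shows "discrepancy n Q \<le> (\<integral>y. b y \<partial>Xdist f)"
proof -
  let ?P = "\<lambda>y. X.prob (S y)"
  \<comment> \<open>The truncation at 0 gives a function that is non-negative everywhere, as
    \<open>expectation_extremal_weight\<close> demands, and changes nothing almost
    everywhere.\<close>
  define h where "h y = max 0 (y / cmean y)" for y
  have hm[measurable]: "h \<in> borel_measurable borel" unfolding h_def[abs_def] by measurable
  have AEh: "AE y in Xdist f. y / cmean y = h y"
    using AE_nonneg assms(4) by eventually_elim (auto simp: h_def)
  have sd[measurable]: "shap_density n Q \<in> borel_measurable borel" by (rule shap_density_measurable)
  have sd_le: "shap_density n Q y \<le> ennreal (real n)" for y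
  proof -
    have "ennreal (?P y ^ (n - 1)) \<le> 1" by (simp add: power_le_one X.prob_le_1)
    then have "prob_S y ^ (n - 1 - k) * (conv (restr f (S y)) ^^ k) (win y) Q \<le> 1" if "k < n" for k
      using conditional_shapley_le[OF that] order_trans by blast
    then have "shap_density n Q y \<le> (\<Sum>k<n. 1)" unfolding shap_density_def by (intro sum_mono) auto
    then show ?thesis by (simp add: ennreal_of_nat_eq_real_of_nat)
  qed
  define \<sigma> where "\<sigma> y = enn2real (shap_density n Q y)" for y
  have \<sigma>: "shap_density n Q y = ennreal (\<sigma> y)" for y
    using le_less_trans[OF sd_le ennreal_less_top] by (simp add: \<sigma>_def ennreal_enn2real)
  have "\<sigma> \<in> borel_measurable borel" unfolding \<sigma>_def[abs_def] by measurable
  then have \<sigma>m: "\<sigma> \<in> borel_measurable (Xdist f)" by (rule borel_measurable_Xdist)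
  have \<sigma>b: "0 \<le> \<sigma> y" "\<sigma> y \<le> real n" for y
    using sd_le[of y] by (auto simp: \<sigma>_def enn2real_leI)
  have i1: "integrable (Xdist f) \<sigma>"
    by (rule X.integrable_const_bound[where B="real n"]) (auto simp: \<sigma>b \<sigma>m)
  have e1: "(\<integral>w. shapley n w Q (extremal S n w) \<partial>samples f n) = (\<integral>y. \<sigma> y \<partial>Xdist f)"
    unfolding expectation_shapley[OF n] \<sigma> by (rule integral_eq_nn_integral[symmetric]) (auto simp: \<sigma>b \<sigma>m)
  have AEb: "AE y in Xdist f. \<bar>\<sigma> y - ?P y ^ (n - 1) * h y\<bar> \<le> b y"
    using bnd AEh by eventually_elim (simp add: \<sigma>_def)
  have i12: "integrable (Xdist f) (\<lambda>y. \<sigma> y - ?P y ^ (n - 1) * h y)"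
  proof (rule Bochner_Integration.integrable_bound[OF b])
    have "(\<lambda>y. ?P y ^ (n - 1) * h y) \<in> borel_measurable borel" by measurable
    with \<sigma>m show "(\<lambda>y. \<sigma> y - ?P y ^ (n - 1) * h y) \<in> borel_measurable (Xdist f)"
      by (intro borel_measurable_diff[OF _ borel_measurable_Xdist])
    show "AE y in Xdist f. norm (\<sigma> y - ?P y ^ (n - 1) * h y) \<le> norm (b y)"
      using AEb by eventually_elim auto
  qed
  have i2: "integrable (Xdist f) (\<lambda>y. ?P y ^ (n - 1) * h y)"
    using Bochner_Integration.integrable_diff[OF i1 i12] by simp
  have ext_nonneg: "AE w in samples f n. \<forall>i<n. 0 \<le> w i \<and> w i / cmean (w i) = h (w i)"
  proof -
    have "AE w in samples f n. 0 \<le> w i \<and> w i / cmean (w i) = h (w i)" if "i < n" for i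
      unfolding samples_def
      by (rule AE_PiM_component[where M="\<lambda>_. Xdist f" and i=i and I="{..<n}" and P="\<lambda>x. 0 \<le> x \<and> x / cmean x = h x"])
         (use that AE_nonneg AEh X.prob_space_axioms in auto)
    then have "AE w in samples f n. \<forall>i\<in>{..<n}. 0 \<le> w i \<and> w i / cmean (w i) = h (w i)"
      by (intro AE_finite_allI) auto
    then show ?thesis by eventually_elim auto
  qed
  have "(\<integral>w. w (extremal S n w) / cmean (w (extremal S n w)) \<partial>samples f n) = (\<integral>w. h (w (extremal S n w)) \<partial>samples f n)"
  proof (rule integral_cong_AE)
    show "(\<lambda>w. w (extremal S n w) / cmean (w (extremal S n w))) \<in> borel_measurable (samples f n)"
    proof (rule extremal_measurable[of n "\<lambda>i w. w i / cmean (w i)"])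
      have "(\<lambda>x. x / cmean x) \<in> borel_measurable borel" by measurable
      from measurable_compose[OF component_measurable this]
      show "(\<lambda>w. w i / cmean (w i)) \<in> borel_measurable (samples f n)" if "i < n" for i using that .
    qed (rule n)
    show "(\<lambda>w. h (w (extremal S n w))) \<in> borel_measurable (samples f n)"
      by (rule extremal_measurable[of n "\<lambda>i w. h (w i)", OF measurable_compose[OF component_measurable hm] n])
    show "AE w in samples f n. w (extremal S n w) / cmean (w (extremal S n w)) = h (w (extremal S n w))"
      using ext_nonneg by eventually_elim (use extremal_props(1)[OF n] in auto)
  qed
  also have "\<dots> = enn2real (of_nat n * (\<integral>\<^sup>+ y. prob_S y ^ (n - 1) * ennreal (h y) \<partial>Xdist f))"
    by (rule expectation_extremal_weight[OF n hm]) (simp add: h_def)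
  also have "(\<integral>\<^sup>+ y. prob_S y ^ (n - 1) * ennreal (h y) \<partial>Xdist f) = (\<integral>\<^sup>+ y. ennreal (?P y ^ (n - 1) * h y) \<partial>Xdist f)"
    by (intro nn_integral_cong) (simp add: prob_S_eq ennreal_mult ennreal_power h_def)
  also have "\<dots> = ennreal (\<integral>y. ?P y ^ (n - 1) * h y \<partial>Xdist f)"
    by (rule nn_integral_eq_integral[OF i2]) (auto simp: h_def)
  also have "enn2real (of_nat n * \<dots>) = real n * (\<integral>y. ?P y ^ (n - 1) * h y \<partial>Xdist f)"
    by (simp add: enn2real_mult integral_nonneg h_def)
  finally have e2: "(1 / real n) * (\<integral>w. w (extremal S n w) / cmean (w (extremal S n w)) \<partial>samples f n) = (\<integral>y. ?P y ^ (n - 1) * h y \<partial>Xdist f)"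
    using n by simp
  have "\<bar>(\<integral>y. \<sigma> y \<partial>Xdist f) - (\<integral>y. ?P y ^ (n - 1) * h y \<partial>Xdist f)\<bar> = \<bar>\<integral>y. \<sigma> y - ?P y ^ (n - 1) * h y \<partial>Xdist f\<bar>"
    using i1 i2 by simp
  also have "\<dots> \<le> (\<integral>y. \<bar>\<sigma> y - ?P y ^ (n - 1) * h y\<bar> \<partial>Xdist f)"
    by (rule integral_abs_bound)
  also have "\<dots> \<le> (\<integral>y. b y \<partial>Xdist f)"
    by (rule integral_mono_AE) (use i12 b AEb in auto)
  finally show ?thesis unfolding discrepancy_def e1 e2 .
qed

text \<open>Normalising multiplies by \<open>1 / X.prob (S y) \<ge> 1\<close>: lower bounds of
  \<open>f\<close> survive on \<open>S y\<close>, and exponential moments grow by at most this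
  factor.\<close>

lemma conditional_density:
  assumes y: "0 < X.prob (S y)"
  defines "\<phi> \<equiv> (\<lambda>s. ennreal (1 / X.prob (S y)) * restr f (S y) s)"
  shows "renewal_density \<phi>"
    and "mgf \<phi> \<eta> \<le> ennreal (1 / X.prob (S y)) * mgf (\<lambda>s. ennreal (f s)) \<eta>"
    and "(conv (restr f (S y)) ^^ k) (win y) Q = prob_S y ^ k * (conv \<phi> ^^ k) (win y) Q"
    and "s \<in> S y \<Longrightarrow> ennreal (f s) \<le> \<phi> s"
    and "integrable (Xdist f) (\<lambda>t. t) \<Longrightarrow> nnmean \<phi> = ennreal (cmean y)"
proof -
  let ?P = "X.prob (S y)"
  have r[measurable]: "restr f (S y) \<in> borel_measurable borel" by (rule restr_measurable) auto
  have Pinv: "ennreal (1 / ?P) * prob_S y = 1"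
    using y by (simp add: prob_S_eq ennreal_mult[symmetric])
  show "renewal_density \<phi>"
  proof
    show "\<phi> \<in> borel_measurable borel" unfolding \<phi>_def by measurable
    show "\<phi> t = 0" if "t < 0" for t using that by (simp add: \<phi>_def restr_def f_neg_zero)
    have "(\<integral>\<^sup>+ t. \<phi> t \<partial>lborel) = ennreal (1 / ?P) * (\<integral>\<^sup>+ s. restr f (S y) s \<partial>lborel)"
      unfolding \<phi>_def by (rule nn_integral_cmult) measurable
    then show "(\<integral>\<^sup>+ t. \<phi> t \<partial>lborel) = 1" by (simp add: nn_integral_restr Pinv)
  qed
  have "mgf \<phi> \<eta> \<le> (\<integral>\<^sup>+ s. ennreal (1 / ?P) * (ennreal (f s) * ennreal (exp (\<eta> * s))) \<partial>lborel)"
    unfolding mgf_def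
  proof (rule nn_integral_mono)
    fix s
    have "\<phi> s \<le> ennreal (1 / ?P) * ennreal (f s)"
      unfolding \<phi>_def restr_def by (intro mult_left_mono) (auto simp: indicator_def)
    then show "\<phi> s * ennreal (exp (\<eta> * s)) \<le> ennreal (1 / ?P) * (ennreal (f s) * ennreal (exp (\<eta> * s)))"
      unfolding mult.assoc[symmetric] by (rule mult_right_mono) simp
  qed
  also have "\<dots> = ennreal (1 / ?P) * mgf (\<lambda>s. ennreal (f s)) \<eta>"
    unfolding mgf_def by (rule nn_integral_cmult) measurable
  finally show "mgf \<phi> \<eta> \<le> ennreal (1 / ?P) * mgf (\<lambda>s. ennreal (f s)) \<eta>" .
  have "(conv \<phi> ^^ k) (win y) = (\<lambda>t. ennreal (1 / ?P) ^ k * (conv (restr f (S y)) ^^ k) (win y) t)"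
    unfolding \<phi>_def by (rule conv_pow_cmult_left) measurable
  then have "prob_S y ^ k * (conv \<phi> ^^ k) (win y) Q = (ennreal (1 / ?P) * prob_S y) ^ k * (conv (restr f (S y)) ^^ k) (win y) Q"
    unfolding power_mult_distrib by (simp only: mult_ac)
  then show "(conv (restr f (S y)) ^^ k) (win y) Q = prob_S y ^ k * (conv \<phi> ^^ k) (win y) Q"
    by (simp only: Pinv power_one mult_1)
  show "ennreal (f s) \<le> \<phi> s" if "s \<in> S y"
  proof -
    have "1 \<le> 1 / ?P" using y X.prob_le_1[of "S y"] by simp
    then have "1 * ennreal (f s) \<le> ennreal (1 / ?P) * ennreal (f s)"
      by (intro mult_right_mono) (auto simp flip: ennreal_1 intro!: ennreal_leI)
    then show ?thesis using that by (simp add: \<phi>_def restr_def)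
  qed
  assume int: "integrable (Xdist f) (\<lambda>t. t)"
  have int': "integrable (Xdist f) (\<lambda>t. t * indicator (S y) t)"
    by (rule Bochner_Integration.integrable_bound[OF int]) (auto simp: indicator_def)
  have nn: "AE t in Xdist f. 0 \<le> t * indicator (S y) t"
    using AE_nonneg by eventually_elim (auto simp: indicator_def)
  have "nnmean \<phi> = (\<integral>\<^sup>+ s. ennreal (1 / ?P) * (restr f (S y) s * ennreal s) \<partial>lborel)"
    unfolding nnmean_def \<phi>_def by (simp only: mult.assoc)
  also have "\<dots> = ennreal (1 / ?P) * (\<integral>\<^sup>+ s. restr f (S y) s * ennreal s \<partial>lborel)"
    by (rule nn_integral_cmult) measurable
  also have "(\<integral>\<^sup>+ s. restr f (S y) s * ennreal s \<partial>lborel) = (\<integral>\<^sup>+ s. ennreal (s * indicator (S y) s) \<partial>Xdist f)"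
  proof -
    have "(\<integral>\<^sup>+ s. ennreal (s * indicator (S y) s) \<partial>Xdist f) = (\<integral>\<^sup>+ s. ennreal (f s) * ennreal (s * indicator (S y) s) \<partial>lborel)"
      by (rule nn_integral_Xdist) measurable
    also have "\<dots> = (\<integral>\<^sup>+ s. restr f (S y) s * ennreal s \<partial>lborel)"
      by (intro nn_integral_cong) (auto simp: restr_def indicator_def)
    finally show ?thesis by simp
  qed
  also have "\<dots> = ennreal (\<integral>s. s * indicator (S y) s \<partial>Xdist f)"
    by (rule nn_integral_eq_integral[OF int' nn])
  finally show "nnmean \<phi> = ennreal (cmean y)"
    using y integral_nonneg_AE[OF nn] by (simp add: cmean_def ennreal_mult[symmetric])
qed

lemma mgf_integrable:
  assumes "0 < \<eta>0" "mgf (\<lambda>s. ennreal (f s)) \<eta>0 \<le> ennreal A0" "0 \<le> A0"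
  shows "integrable (Xdist f) (\<lambda>y. exp (\<eta>0 * y))" "(\<integral>y. exp (\<eta>0 * y) \<partial>Xdist f) \<le> A0"
    "integrable (Xdist f) (\<lambda>t. t)"
proof -
  have m: "(\<lambda>y. exp (\<eta>0 * y)) \<in> borel_measurable (Xdist f)" by (rule borel_measurable_Xdist) measurable
  have "(\<integral>\<^sup>+ y. ennreal (exp (\<eta>0 * y)) \<partial>Xdist f) = mgf (\<lambda>s. ennreal (f s)) \<eta>0"
    unfolding mgf_def by (rule nn_integral_Xdist) measurable
  then have le: "(\<integral>\<^sup>+ y. ennreal (exp (\<eta>0 * y)) \<partial>Xdist f) \<le> ennreal A0" using assms by simp
  show i: "integrable (Xdist f) (\<lambda>y. exp (\<eta>0 * y))"
    by (rule integrableI_nonneg[OF m]) (use le_less_trans[OF le ennreal_less_top] in auto)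
  show "(\<integral>y. exp (\<eta>0 * y) \<partial>Xdist f) \<le> A0"
    using le assms(3) by (subst integral_eq_nn_integral[OF m]) (auto intro: enn2real_leI)
  have i': "integrable (Xdist f) (\<lambda>y. exp (\<eta>0 * y) / \<eta>0)" using i by simp
  show "integrable (Xdist f) (\<lambda>t. t)"
  proof (rule Bochner_Integration.integrable_bound[OF i'])
    show "(\<lambda>t. t) \<in> borel_measurable (Xdist f)" by (rule borel_measurable_Xdist) simp
    show "AE t in Xdist f. norm t \<le> norm (exp (\<eta>0 * t) / \<eta>0)"
      using AE_nonneg
    proof eventually_elim
      fix t :: real assume "0 \<le> t"
      moreover have "\<eta>0 * t \<le> exp (\<eta>0 * t)" using exp_ge_add_one_self[of "\<eta>0 * t"] by linarith
      ultimately show "norm t \<le> norm (exp (\<eta>0 * t) / \<eta>0)"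
        using assms(1) by (simp add: pos_le_divide_eq mult.commute)
    qed
  qed
qed

text \<open>For weights in \<open>Gd\<close> the conditional densities share a minorant and the
  moment bound \<open>A0 / \<alpha>\<close>, so a single renewal rate serves them all. For the
  others the factor \<open>\<rho> ^ (n - 1)\<close> beats the trivial bounds. The parameter
  \<open>\<theta>\<close> stays free because its good choice may depend on \<open>n\<close>.\<close>

lemma shapley_estimate:
  fixes c0 p q \<eta>0 A0 \<alpha> m \<rho> B :: real and Gd :: "real set"
  assumes c0: "0 < c0" and pq: "0 \<le> p" "p < q" and lb: "\<And>s. s \<in> {p..q} \<Longrightarrow> c0 \<le> f s"
    and \<eta>0: "0 < \<eta>0" and A0: "mgf (\<lambda>s. ennreal (f s)) \<eta>0 \<le> ennreal A0" "0 \<le> A0"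
    and \<alpha>: "0 < \<alpha>" and m: "0 \<le> m"
    and good: "\<And>y. y \<in> Gd \<Longrightarrow> \<alpha> \<le> X.prob (S y) \<and> {p..q} \<subseteq> S y \<and> m \<le> cmean y"
    and bad: "\<And>y. y \<notin> Gd \<Longrightarrow> X.prob (S y) \<le> \<rho>" and \<rho>: "0 \<le> \<rho>"
    and B: "0 \<le> B" "AE y in Xdist f. 0 \<le> y \<longrightarrow> 0 \<le> y / cmean y \<and> y / cmean y \<le> B * exp (\<eta>0 * y)"
  defines "r \<equiv> \<lambda>\<theta>. 1 - \<theta> * m + \<theta>\<^sup>2 * (A0 / \<alpha> / \<eta>0\<^sup>2)"
  shows "\<exists>\<eta> K. 0 < \<eta> \<and> 0 \<le> K \<and> (\<forall>n Q \<theta>. 0 < n \<longrightarrow> 0 \<le> \<theta> \<longrightarrow> 0 \<le> r \<theta> \<longrightarrow> r \<theta> < 1 \<longrightarrow>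
    discrepancy n Q
     \<le> (K * exp (- (\<eta> * Q)) + B * \<rho> ^ (n - 1)) * A0 + exp (\<theta> * Q) * r \<theta> ^ n / (1 - r \<theta>) + real n * \<rho> ^ (n - 1))"
proof -
  have A: "0 \<le> A0 / \<alpha>" using A0 \<alpha> by simp
  obtain \<eta> K where \<eta>: "0 < \<eta>" and K: "0 \<le> K"
    and renewals: "\<And>f x t. renewal_density f \<Longrightarrow> (\<And>s. s \<in> {p..q} \<Longrightarrow> ennreal c0 \<le> f s) \<Longrightarrow> mgf f \<eta>0 \<le> ennreal (A0 / \<alpha>) \<Longrightarrow> 0 \<le> x \<Longrightarrow>
       renewals f x t < \<infinity> \<and> \<bar>enn2real (renewals f x t) - x / enn2real (nnmean f)\<bar> \<le> K * exp (\<eta>0 * x) * exp (- (\<eta> * t))"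
    using renewal_exponential_uniform[OF c0 pq \<eta>0 A] by blast
  note ints = mgf_integrable[OF \<eta>0 A0]
  show ?thesis
  proof (rule exI[of _ \<eta>], rule exI[of _ K], intro conjI \<eta> K allI impI)
    fix n :: nat and Q \<theta> :: real
    assume n: "0 < n" and \<theta>: "0 \<le> \<theta>" and r: "0 \<le> r \<theta>" "r \<theta> < 1"
    define T where "T = exp (\<theta> * Q) * r \<theta> ^ n / (1 - r \<theta>)"
    have T: "0 \<le> T" using r by (simp add: T_def)
    \<comment> \<open>The summands are the renewal error, the cost of cutting the series at
      \<open>n\<close>, and the contribution of weights outside \<open>Gd\<close>; the exponential
      in \<open>y\<close> integrates to at most \<open>A0\<close>.\<close>
    define b where "b y = K * exp (- (\<eta> * Q)) * exp (\<eta>0 * y) + T + (real n * \<rho> ^ (n - 1) + B * \<rho> ^ (n - 1) * exp (\<eta>0 * y))" for y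
    have bi: "integrable (Xdist f) b" unfolding b_def[abs_def] using ints by simp
    have "AE y in Xdist f. \<bar>enn2real (shap_density n Q y) - X.prob (S y) ^ (n - 1) * (y / cmean y)\<bar> \<le> b y"
      using B(2) AE_nonneg
    proof eventually_elim
      fix y assume hB: "0 \<le> y \<longrightarrow> 0 \<le> y / cmean y \<and> y / cmean y \<le> B * exp (\<eta>0 * y)" and y: "0 \<le> y"
      let ?P = "X.prob (S y)"
      have P1: "0 \<le> ?P" "?P \<le> 1" by (auto simp: X.prob_le_1)
      show "\<bar>enn2real (shap_density n Q y) - ?P ^ (n - 1) * (y / cmean y)\<bar> \<le> b y"
      proof (cases "y \<in> Gd")
        case True
        have P: "0 < ?P" using good[OF True] \<alpha> by auto
        define \<phi> where "\<phi> = (\<lambda>s. ennreal (1 / ?P) * restr f (S y) s)"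
        note cd = conditional_density[OF P, folded \<phi>_def]
        interpret \<phi>: renewal_density \<phi> by (rule cd(1))
        have cm: "nnmean \<phi> = ennreal (cmean y)" by (rule cd(5)) (rule ints(3))
        have cm0: "0 \<le> cmean y" using good[OF True] m by auto
        have mgf: "mgf \<phi> \<eta>0 \<le> ennreal (A0 / \<alpha>)"
        proof -
          have "mgf \<phi> \<eta>0 \<le> ennreal (1 / ?P) * ennreal A0"
            using cd(2)[of \<eta>0] mult_left_mono[OF A0(1)] by (rule order_trans) simp
          also have "\<dots> \<le> ennreal (1 / \<alpha>) * ennreal A0"
            using good[OF True] \<alpha> by (intro mult_right_mono ennreal_leI divide_left_mono) auto
          also have "\<dots> = ennreal (A0 / \<alpha>)" using \<alpha> A0 by (simp add: ennreal_mult[symmetric])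
          finally show ?thesis .
        qed
        have minor: "ennreal c0 \<le> \<phi> s" if "s \<in> {p..q}" for s
          using lb[OF that] cd(4)[of s] good[OF True] that unfolding \<phi>_def by (meson ennreal_leI order_trans subsetD)
        have R: "renewals \<phi> y Q < \<infinity>" "\<bar>enn2real (renewals \<phi> y Q) - y / cmean y\<bar> \<le> K * exp (\<eta>0 * y) * exp (- (\<eta> * Q))"
          using renewals[OF cd(1) minor mgf y, of Q] cm cm0 by auto
        let ?a = "\<lambda>k. (conv \<phi> ^^ k) (win y) Q"
        \<comment> \<open>Normalising \<open>k\<close> summands releases
          \<open>prob_S y ^ k\<close>, which completes the exponent to \<open>n - 1\<close> for
          every \<open>k\<close>; the common factor is the one in the main term.\<close>
        have sd: "shap_density n Q y = ennreal (?P ^ (n - 1)) * (\<Sum>k<n. ?a k)"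
        proof -
          have "prob_S y ^ (n - 1 - k) * (conv (restr f (S y)) ^^ k) (win y) Q = prob_S y ^ (n - 1) * ?a k" if "k < n" for k
          proof -
            have "prob_S y ^ (n - 1 - k) * (prob_S y ^ k * ?a k) = prob_S y ^ (n - 1 - k + k) * ?a k"
              by (simp only: power_add mult.assoc)
            then show ?thesis unfolding cd(3) using that by simp
          qed
          then have "shap_density n Q y = (\<Sum>k<n. prob_S y ^ (n - 1) * ?a k)"
            unfolding shap_density_def by (intro sum.cong) auto
          then show ?thesis unfolding sum_distrib_left[symmetric] by (simp add: prob_S_eq ennreal_power)
        qed
        have tail: "(\<Sum>k. ?a (k + n)) \<le> ennreal T"
          unfolding T_def
        proof (rule \<phi>.suminf_conv_pow_win_le[OF \<theta> _ r])
          show "mgf \<phi> (- \<theta>) \<le> ennreal (r \<theta>)"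
            unfolding r_def using good[OF True] cm0 m by (intro \<phi>.mgf_neg_le \<theta> \<eta>0 mgf A) (auto simp: cm intro: ennreal_leI)
        qed
        have split: "renewals \<phi> y Q = (\<Sum>k. ?a (k + n)) + (\<Sum>k<n. ?a k)"
          unfolding renewals_def by (rule suminf_offset) auto
        define s where "s = enn2real (\<Sum>k<n. ?a k)"
        define u where "u = enn2real (\<Sum>k. ?a (k + n))"
        have fin: "(\<Sum>k<n. ?a k) < top" "(\<Sum>k. ?a (k + n)) < top"
          using R(1) unfolding split by (auto simp: less_top)
        have "enn2real (renewals \<phi> y Q) = u + s"
          unfolding split s_def u_def using fin by (rule enn2real_plus[rotated])
        moreover have "0 \<le> u" "u \<le> T" using tail T by (auto simp: u_def enn2real_leI)
        ultimately have s: "\<bar>s - y / cmean y\<bar> \<le> K * exp (\<eta>0 * y) * exp (- (\<eta> * Q)) + T"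
          using R(2) by linarith
        have "enn2real (shap_density n Q y) = ?P ^ (n - 1) * s"
          unfolding sd s_def by (simp add: enn2real_mult)
        then have "\<bar>enn2real (shap_density n Q y) - ?P ^ (n - 1) * (y / cmean y)\<bar> = ?P ^ (n - 1) * \<bar>s - y / cmean y\<bar>"
          by (simp add: right_diff_distrib[symmetric] abs_mult del: times_divide_eq_right)
        also have "\<dots> \<le> 1 * \<bar>s - y / cmean y\<bar>"
          using P1 by (intro mult_right_mono power_le_one) auto
        also have "\<dots> \<le> K * exp (\<eta>0 * y) * exp (- (\<eta> * Q)) + T" using s by simp
        also have "\<dots> \<le> b y"
          using \<rho> B(1) unfolding b_def by (simp add: mult_ac)
        finally show ?thesis .
      next
        case False
        have P\<rho>: "?P ^ (n - 1) \<le> \<rho> ^ (n - 1)" using bad[OF False] P1 by (intro power_mono) auto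
        have "prob_S y ^ (n - 1 - k) * (conv (restr f (S y)) ^^ k) (win y) Q \<le> ennreal (\<rho> ^ (n - 1))" if "k < n" for k
          by (rule order_trans[OF conditional_shapley_le[OF that] ennreal_leI[OF P\<rho>]])
        then have "shap_density n Q y \<le> (\<Sum>k<n. ennreal (\<rho> ^ (n - 1)))"
          unfolding shap_density_def by (intro sum_mono) auto
        also have "\<dots> = ennreal (real n * \<rho> ^ (n - 1))"
          using \<rho> by (simp add: ennreal_mult ennreal_of_nat_eq_real_of_nat)
        finally have "enn2real (shap_density n Q y) \<le> real n * \<rho> ^ (n - 1)"
          using \<rho> by (intro enn2real_leI) auto
        moreover have "0 \<le> enn2real (shap_density n Q y)" by simp
        moreover have "0 \<le> ?P ^ (n - 1) * (y / cmean y)"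
          using hB y P1 by (intro mult_nonneg_nonneg) auto
        moreover have "?P ^ (n - 1) * (y / cmean y) \<le> \<rho> ^ (n - 1) * (B * exp (\<eta>0 * y))"
          using hB y P1 P\<rho> \<rho> by (intro mult_mono) auto
        moreover have "0 \<le> K * exp (- (\<eta> * Q)) * exp (\<eta>0 * y)" using K by simp
        moreover have "0 \<le> B * \<rho> ^ (n - 1) * exp (\<eta>0 * y)" "0 \<le> real n * \<rho> ^ (n - 1)" using B \<rho> by auto
        ultimately show ?thesis
          using T unfolding b_def by (simp only: mult_ac) linarith
      qed
    qed
    moreover have "AE y in Xdist f. 0 \<le> y \<longrightarrow> 0 \<le> y / cmean y" using B(2) by eventually_elim auto
    ultimately have "discrepancy n Q \<le> (\<integral>y. b y \<partial>Xdist f)"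
      using bi by (intro expectation_difference_le[OF n]) auto
    also have "(\<integral>y. b y \<partial>Xdist f) = K * exp (- (\<eta> * Q)) * (\<integral>y. exp (\<eta>0 * y) \<partial>Xdist f) + T
        + (real n * \<rho> ^ (n - 1) + B * \<rho> ^ (n - 1) * (\<integral>y. exp (\<eta>0 * y) \<partial>Xdist f))"
      unfolding b_def using ints X.prob_space by simp
    also have "\<dots> \<le> K * exp (- (\<eta> * Q)) * A0 + T + (real n * \<rho> ^ (n - 1) + B * \<rho> ^ (n - 1) * A0)"
      using ints(2) K B \<rho> by (intro add_mono mult_left_mono order_refl) auto
    finally show "discrepancy n Q
     \<le> (K * exp (- (\<eta> * Q)) + B * \<rho> ^ (n - 1)) * A0 + exp (\<theta> * Q) * r \<theta> ^ n / (1 - r \<theta>) + real n * \<rho> ^ (n - 1)"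
      by (simp add: T_def algebra_simps)
  qed
qed

end

lemma real_powr_quarter_le:
  assumes "1 \<le> (n::nat)"
  shows "real n powr (1/4) \<le> real n" "real n powr (1/4) \<le> real n powr (1/3)" "0 < real n powr (1/4)"
  using powr_mono[of "1/4" 1 "real n"] powr_mono[of "1/4" "1/3" "real n"] assms by auto

lemma geometric_le_exp:
  fixes \<rho> :: real
  assumes "0 \<le> \<rho>" "\<rho> < 1"
  shows "\<exists>C \<kappa>. 0 \<le> C \<and> 0 < \<kappa> \<and> (\<forall>n::nat. 1 \<le> n \<longrightarrow> real n * \<rho> ^ (n - 1) \<le> C * exp (- (\<kappa> * real n)))"
proof -
  \<comment> \<open>The maximum with 1/2 keeps the logarithm meaningful for
    \<open>\<rho> = 0\<close>. Half of the resulting rate absorbs the factor \<open>n\<close>, and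
    \<open>1 / s\<close> the shift from \<open>n\<close> to \<open>n - 1\<close>.\<close>
  define s where "s = max \<rho> (1/2)"
  have s: "0 < s" "s < 1" "\<rho> \<le> s" using assms by (auto simp: s_def)
  define a where "a = - ln s"
  have a: "0 < a" using s by (simp add: a_def)
  have "real n * \<rho> ^ (n - 1) \<le> (2 / (a * s)) * exp (- (a / 2 * real n))" if n: "1 \<le> n" for n :: nat
  proof -
    have "\<rho> ^ (n - 1) \<le> s ^ (n - 1)" using assms s by (intro power_mono) auto
    also have "\<dots> = s ^ n / s" using n s by (simp add: power_diff)
    also have "s ^ n = exp (- (a * real n))"
      using s exp_of_nat_mult[of n "ln s"] by (simp add: a_def mult.commute)
    finally have 1: "\<rho> ^ (n - 1) \<le> exp (- (a * real n)) / s" .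
    have 2: "real n \<le> 2 / a * exp (a / 2 * real n)"
      using exp_ge_add_one_self[of "a / 2 * real n"] a by (simp add: field_simps)
    have "real n * \<rho> ^ (n - 1) \<le> (2 / a * exp (a / 2 * real n)) * (exp (- (a * real n)) / s)"
      using 1 2 assms a by (intro mult_mono) auto
    also have "\<dots> = (2 / (a * s)) * (exp (a / 2 * real n) * exp (- (a * real n)))" by simp
    also have "exp (a / 2 * real n) * exp (- (a * real n)) = exp (- (a / 2 * real n))"
      by (simp add: exp_add[symmetric] field_simps)
    finally show ?thesis .
  qed
  then show ?thesis using a s by (intro exI[of _ "2 / (a * s)"] exI[of _ "a / 2"]) auto
qed

section \<open>Consequences of the hypotheses on the density\<close>

context positive_density
begin

lemma renewal_density_f: "renewal_density (\<lambda>s. ennreal (f s))"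
  by standard (auto simp: f_neg_zero nn_f_one)

lemma prob_interval_ge:
  assumes "0 \<le> c0" "p \<le> q" "\<And>s. s \<in> {p..q} \<Longrightarrow> c0 \<le> f s" "A \<in> sets borel" "{p<..<q} \<subseteq> A"
  shows "c0 * (q - p) \<le> X.prob A"
proof -
  have "ennreal (c0 * (q - p)) = (\<integral>\<^sup>+ s. ennreal c0 * indicator {p<..<q} s \<partial>lborel)"
    using assms by (subst nn_integral_cmult_indicator) (auto simp: ennreal_mult)
  also have "\<dots> \<le> (\<integral>\<^sup>+ s. ennreal (f s) * indicator A s \<partial>lborel)"
    using assms(3,5) by (intro nn_integral_mono) (auto simp: indicator_def intro!: ennreal_leI)
  also have "\<dots> = emeasure (Xdist f) A"
    unfolding Xdist_def using assms(4) by (subst emeasure_density) auto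
  also have "\<dots> = ennreal (X.prob A)" by (rule X.emeasure_eq_measure)
  finally show ?thesis by (simp add: ennreal_le_iff)
qed

lemma prob_singleton: "X.prob {x} = 0"
proof -
  have "emeasure (Xdist f) {x} = 0"
    unfolding Xdist_def by (subst emeasure_density) (auto intro!: nn_integral_null_set)
  then show ?thesis by (simp add: measure_def)
qed

sublocale X: real_distribution "Xdist f"
  by standard auto

lemma cdf_Xdist_continuous: "continuous_on A (cdf (Xdist f))"
proof -
  have "isCont (cdf (Xdist f)) x" for x
    by (subst X.isCont_cdf) (rule prob_singleton)
  then show ?thesis by (simp add: continuous_at_imp_continuous_on)
qed

text \<open>If every piece were a point or empty, \<open>f\<close> would vanish off a finite set and
  could not integrate to 1. On a compact interval inside a nondegenerate piece \<open>f\<close> is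
  continuous and positive, so its minimum is positive.\<close>

lemma ex_interval_minorant:
  assumes "finite \<I>" "\<And>I. I \<in> \<I> \<Longrightarrow> is_interval I" "\<Union>\<I> = {t. f t \<noteq> 0}"
    "\<And>I. I \<in> \<I> \<Longrightarrow> f differentiable_on I"
  shows "\<exists>a b c0. 0 \<le> a \<and> a < b \<and> 0 < c0 \<and> (\<forall>s\<in>{a..b}. c0 \<le> f s)"
proof -
  have "\<exists>I\<in>\<I>. \<exists>a\<in>I. \<exists>b\<in>I. a < b"
  proof (rule ccontr)
    assume neg: "\<not> ?thesis"
    have "finite I" if "I \<in> \<I>" for I
    proof (cases "I = {}")
      case False
      then obtain x where "x \<in> I" by auto
      then have "I \<subseteq> {x}" using neg that by (metis insertI1 linorder_neqE_linordered_idom subsetI singletonI)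
      then show ?thesis by (rule finite_subset) simp
    qed simp
    then have "finite {t. f t \<noteq> 0}" using assms(1,3) by (metis finite_Union)
    then have "{t. f t \<noteq> 0} \<in> null_sets lborel" by (rule finite_imp_null_set_lborel)
    then have "AE t in lborel. f t = 0" by (rule AE_I'[where P="\<lambda>t. f t = 0"]) auto
    then have "(\<integral>t. f t \<partial>lborel) = 0" by (rule integral_eq_zero_AE)
    then show False using f_one by simp
  qed
  then obtain I a b where I: "I \<in> \<I>" "a \<in> I" "b \<in> I" "a < b" by auto
  have sub: "{a..b} \<subseteq> I"
    using assms(2)[OF I(1), unfolded is_interval_1] I(2,3) by (meson atLeastAtMost_iff subsetI)
  have "continuous_on {a..b} f"
    using differentiable_imp_continuous_on[OF assms(4)[OF I(1)]] sub by (rule continuous_on_subset)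
  then obtain z where z: "z \<in> {a..b}" "\<And>s. s \<in> {a..b} \<Longrightarrow> f z \<le> f s"
    using continuous_attains_inf[of "{a..b}" f] I(4) by auto
  have nz: "f t \<noteq> 0" if "t \<in> {a..b}" for t using sub I(1) assms(3) that by blast
  then have "0 < f z" using f_nonneg[of z] z(1) by (simp add: less_le)
  moreover have "0 \<le> a" using f_neg_zero[of a] nz[of a] I(4) by fastforce
  ultimately show ?thesis using I(4) z(2) by (intro exI[of _ a] exI[of _ b] exI[of _ "f z"]) auto
qed

lemma mgf_of_tail:
  assumes lam: "0 < lam" and C: "0 < C" and tail: "\<And>t. 0 \<le> t \<Longrightarrow> f t \<le> C * exp (- lam * t)"
  shows "mgf (\<lambda>s. ennreal (f s)) (lam / 2) \<le> ennreal (C * 2 / lam)"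
proof -
  have "mgf (\<lambda>s. ennreal (f s)) (lam / 2) \<le> (\<integral>\<^sup>+ s. ennreal C * (ennreal (exp (- (lam / 2 * s))) * indicator {0..} s) \<partial>lborel)"
    unfolding mgf_def
  proof (rule nn_integral_mono)
    fix s
    show "ennreal (f s) * ennreal (exp (lam / 2 * s)) \<le> ennreal C * (ennreal (exp (- (lam / 2 * s))) * indicator {0..} s)"
    proof (cases "0 \<le> s")
      case True
      have "f s * exp (lam / 2 * s) \<le> C * exp (- lam * s) * exp (lam / 2 * s)"
        by (intro mult_right_mono tail True) auto
      also have "\<dots> = C * exp (- (lam / 2 * s))" by (simp add: mult.assoc exp_add[symmetric])
      finally have "ennreal (f s * exp (lam / 2 * s)) \<le> ennreal (C * exp (- (lam / 2 * s)))" by (rule ennreal_leI)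
      then show ?thesis using True C f_nonneg[of s] by (simp add: ennreal_mult)
    qed (simp add: f_neg_zero)
  qed
  also have "\<dots> = ennreal C * ennreal (exp (- (lam / 2 * 0)) / (lam / 2))"
    using nn_integral_exp_tail[of "lam / 2" 0] lam by (subst nn_integral_cmult) auto
  also have "\<dots> = ennreal (C * 2 / lam)" using C lam by (subst ennreal_mult[symmetric]) auto
  finally show ?thesis .
qed

lemma nnmean_eq_mean:
  assumes "integrable (Xdist f) (\<lambda>t. t)"
  shows "nnmean (\<lambda>s. ennreal (f s)) = ennreal (mean_X f)"
proof -
  have "nnmean (\<lambda>s. ennreal (f s)) = (\<integral>\<^sup>+ s. ennreal s \<partial>Xdist f)"
    unfolding nnmean_def by (rule nn_integral_Xdist[symmetric]) measurable
  also have "\<dots> = ennreal (mean_X f)"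
    unfolding mean_X_def
    by (rule nn_integral_eq_integral[OF assms AE_nonneg])
  finally show ?thesis .
qed

lemma mean_pos:
  assumes "integrable (Xdist f) (\<lambda>t. t)" "0 \<le> p" "p < q" "0 < c0" "\<And>s. s \<in> {p..q} \<Longrightarrow> c0 \<le> f s"
  shows "0 < mean_X f"
proof -
  have "ennreal (c0 * ((p + q) / 2) * ((q - p) / 2)) \<le> ennreal (mean_X f)"
    unfolding nnmean_eq_mean[OF assms(1), symmetric]
    by (rule renewal_density.nnmean_ge[OF renewal_density_f]) (use assms in \<open>auto intro: ennreal_leI\<close>)
  moreover have "0 < c0 * ((p + q) / 2) * ((q - p) / 2)" using assms by simp
  ultimately show ?thesis using less_le_trans[of 0 "ennreal (c0 * ((p + q) / 2) * ((q - p) / 2))" "ennreal (mean_X f)"]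
    by (simp add: ennreal_less_zero_iff)
qed

end

context extremal_sampling
begin

text \<open>The exponent \<open>n powr (1/4)\<close> only enters through \<open>n powr (1/4) \<le> Q\<close>: all other errors are smaller.\<close>

lemma shapley_estimate_powr:
  fixes c0 p q \<eta>0 A0 \<alpha> m \<rho> B C2 \<kappa>2 :: real and Gd :: "real set" and U :: "nat \<Rightarrow> real"
  assumes c0: "0 < c0" and pq: "0 \<le> p" "p < q" and lb: "\<And>s. s \<in> {p..q} \<Longrightarrow> c0 \<le> f s"
    and \<eta>0: "0 < \<eta>0" and A0: "mgf (\<lambda>s. ennreal (f s)) \<eta>0 \<le> ennreal A0" "0 \<le> A0"
    and \<alpha>: "0 < \<alpha>" and m: "0 \<le> m"
    and good: "\<And>y. y \<in> Gd \<Longrightarrow> \<alpha> \<le> X.prob (S y) \<and> {p..q} \<subseteq> S y \<and> m \<le> cmean y"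
    and bad: "\<And>y. y \<notin> Gd \<Longrightarrow> X.prob (S y) \<le> \<rho>" and \<rho>: "0 \<le> \<rho>" "\<rho> < 1"
    and B: "0 \<le> B" "AE y in Xdist f. 0 \<le> y \<longrightarrow> 0 \<le> y / cmean y \<and> y / cmean y \<le> B * exp (\<eta>0 * y)"
    and C2: "0 \<le> C2" "0 < \<kappa>2"
  defines "r \<equiv> \<lambda>\<theta>. 1 - \<theta> * m + \<theta>\<^sup>2 * (A0 / \<alpha> / \<eta>0\<^sup>2)"
  assumes U: "\<And>n Q. 1 \<le> n \<Longrightarrow> Q \<le> U n \<Longrightarrow>
     (\<exists>\<theta>\<ge>0. 0 \<le> r \<theta> \<and> r \<theta> < 1 \<and> exp (\<theta> * Q) * r \<theta> ^ n / (1 - r \<theta>) \<le> C2 * exp (- (\<kappa>2 * real n powr (1/4))))"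
  shows "\<exists>\<kappa> K. 0 < \<kappa> \<and> 0 \<le> K \<and> (\<forall>n Q. 1 \<le> n \<longrightarrow> real n powr (1/4) \<le> Q \<longrightarrow> Q \<le> U n \<longrightarrow>
    discrepancy n Q
     \<le> K * exp (- (\<kappa> * real n powr (1/4))))"
proof -
  have "\<exists>\<eta> K. 0 < \<eta> \<and> 0 \<le> K \<and> (\<forall>n Q \<theta>. 0 < n \<longrightarrow> 0 \<le> \<theta> \<longrightarrow> 0 \<le> r \<theta> \<longrightarrow> r \<theta> < 1 \<longrightarrow>
    discrepancy n Q
     \<le> (K * exp (- (\<eta> * Q)) + B * \<rho> ^ (n - 1)) * A0 + exp (\<theta> * Q) * r \<theta> ^ n / (1 - r \<theta>) + real n * \<rho> ^ (n - 1))"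
    unfolding r_def
    by (rule shapley_estimate[OF c0 pq _ \<eta>0 A0 \<alpha> m _ _ \<rho>(1) B, where Gd=Gd]; fact lb good bad)
  then obtain \<eta> K where H: "0 < \<eta>" "0 \<le> K" "\<forall>n Q \<theta>. 0 < n \<longrightarrow> 0 \<le> \<theta> \<longrightarrow> 0 \<le> r \<theta> \<longrightarrow> r \<theta> < 1 \<longrightarrow>
    discrepancy n Q
     \<le> (K * exp (- (\<eta> * Q)) + B * \<rho> ^ (n - 1)) * A0 + exp (\<theta> * Q) * r \<theta> ^ n / (1 - r \<theta>) + real n * \<rho> ^ (n - 1)"
    by (elim exE conjE) (rule that)
  note \<eta> = H(1) and K = H(2) and est = H(3)[rule_format]
  obtain C1 \<kappa>1 where C1: "0 \<le> C1" "0 < \<kappa>1" "\<And>n::nat. 1 \<le> n \<Longrightarrow> real n * \<rho> ^ (n - 1) \<le> C1 * exp (- (\<kappa>1 * real n))"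
    using geometric_le_exp[OF \<rho>] by auto
  define \<kappa> where "\<kappa> = min \<eta> (min \<kappa>1 \<kappa>2)"
  have \<kappa>: "0 < \<kappa>" "\<kappa> \<le> \<eta>" "\<kappa> \<le> \<kappa>1" "\<kappa> \<le> \<kappa>2" using \<eta> C1 C2 by (auto simp: \<kappa>_def)
  define K' where "K' = (K + B * C1) * A0 + C2 + C1"
  have "discrepancy n Q
     \<le> K' * exp (- (\<kappa> * real n powr (1/4)))" if n: "1 \<le> n" and Q: "real n powr (1/4) \<le> Q" and QU: "Q \<le> U n" for n Q
  proof -
    define N where "N = real n powr (1/4)"
    have Q: "N \<le> Q" using Q by (simp add: N_def)
    from U[OF n QU] obtain \<theta> where \<theta>: "0 \<le> \<theta>" "0 \<le> r \<theta>" "r \<theta> < 1"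
      and T: "exp (\<theta> * Q) * r \<theta> ^ n / (1 - r \<theta>) \<le> C2 * exp (- (\<kappa>2 * N))" by (auto simp: N_def)
    have N: "0 < N" "N \<le> real n" using real_powr_quarter_le[OF n] by (auto simp: N_def)
    have mono: "exp (- (k * x)) \<le> exp (- (\<kappa> * N))" if "\<kappa> \<le> k" "N \<le> x" for k x :: real
      using mult_mono[OF that] \<kappa>(1) N(1) that by simp
    have e1: "exp (- (\<eta> * Q)) \<le> exp (- (\<kappa> * N))" by (rule mono) (use \<kappa> Q in auto)
    have e2: "real n * \<rho> ^ (n - 1) \<le> C1 * exp (- (\<kappa> * N))"
      using C1(3)[OF n] mult_left_mono[OF mono[OF \<kappa>(3) N(2)] C1(1)] by linarith
    have "1 * \<rho> ^ (n - 1) \<le> real n * \<rho> ^ (n - 1)" using n \<rho> by (intro mult_right_mono) auto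
    then have e3: "\<rho> ^ (n - 1) \<le> C1 * exp (- (\<kappa> * N))" using e2 by simp
    have e4: "exp (\<theta> * Q) * r \<theta> ^ n / (1 - r \<theta>) \<le> C2 * exp (- (\<kappa> * N))"
      using T mult_left_mono[OF mono[OF \<kappa>(4) order_refl] C2(1)] by linarith
    have "(K * exp (- (\<eta> * Q)) + B * \<rho> ^ (n - 1)) * A0 \<le> (K * exp (- (\<kappa> * N)) + B * (C1 * exp (- (\<kappa> * N)))) * A0"
      using K B A0 e1 e3 by (intro mult_right_mono add_mono mult_left_mono) auto
    with est[OF _ \<theta>, of n Q] n e2 e4
    show ?thesis unfolding N_def[symmetric] K'_def by (simp add: algebra_simps)
  qed
  moreover have "0 \<le> K'" using K B C1 A0 C2 by (simp add: K'_def)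
  ultimately show ?thesis using \<kappa>(1) by blast
qed

end

section \<open>The largest and the smallest agent\<close>

lemma linear_mult_exp_le:
  fixes a t :: real
  assumes "0 < a"
  shows "t * exp (- (a * t)) \<le> 2 / a * exp (- (a / 2 * t))"
proof -
  have "t \<le> 2 / a * exp (a / 2 * t)"
    using exp_ge_add_one_self[of "a / 2 * t"] assms by (simp add: field_simps)
  then have "t * exp (- (a * t)) \<le> 2 / a * exp (a / 2 * t) * exp (- (a * t))"
    by (rule mult_right_mono) simp
  also have "\<dots> = 2 / a * (exp (a / 2 * t) * exp (- (a * t)))" by (simp only: mult.assoc)
  also have "exp (a / 2 * t) * exp (- (a * t)) = exp (- (a / 2 * t))"
    by (simp add: exp_add[symmetric] field_simps)
  finally show ?thesis .
qed

lemma power_le_exp_linear: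
  fixes x :: real
  assumes "0 \<le> 1 + x"
  shows "(1 + x) ^ n \<le> exp (real n * x)"
proof -
  have "(1 + x) ^ n \<le> exp x ^ n" using assms exp_ge_add_one_self by (intro power_mono) auto
  then show ?thesis by (simp add: exp_of_nat_mult)
qed

context positive_density
begin

lemma extremal_sampling_atMost: "extremal_sampling f (\<lambda>x. {..x})"
proof unfold_locales
  have "{z :: real \<times> real. snd z \<in> {..fst z}} = {z \<in> space (borel \<Otimes>\<^sub>M borel). snd z \<le> fst z}"
    by (auto simp: space_pair_measure)
  also have "\<dots> \<in> sets (borel \<Otimes>\<^sub>M borel)" by measurable
  finally show "{z :: real \<times> real. snd z \<in> {..fst z}} \<in> sets (borel \<Otimes>\<^sub>M borel)" .
qed auto

lemma extremal_sampling_atLeast: "extremal_sampling f (\<lambda>x. {x..})"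
proof unfold_locales
  have "{z :: real \<times> real. snd z \<in> {fst z..}} = {z \<in> space (borel \<Otimes>\<^sub>M borel). fst z \<le> snd z}"
    by (auto simp: space_pair_measure)
  also have "\<dots> \<in> sets (borel \<Otimes>\<^sub>M borel)" by measurable
  finally show "{z :: real \<times> real. snd z \<in> {fst z..}} \<in> sets (borel \<Otimes>\<^sub>M borel)" .
qed auto

lemma integrable_partial_mean:
  assumes "integrable (Xdist f) (\<lambda>t. t)" "A \<in> sets borel"
  shows "integrable (Xdist f) (\<lambda>t. t * indicator A t)"
  by (rule Bochner_Integration.integrable_bound[OF assms(1)]) (use assms(2) in \<open>auto simp: indicator_def\<close>)

lemma partial_mean_mono:
  assumes int: "integrable (Xdist f) (\<lambda>t. t)" and "A \<in> sets borel" "B \<in> sets borel" "A \<subseteq> B"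
  shows "(\<integral>t. t * indicator A t \<partial>Xdist f) \<le> (\<integral>t. t * indicator B t \<partial>Xdist f)"
  by (rule integral_mono_AE[OF integrable_partial_mean integrable_partial_mean])
     (use AE_nonneg assms in \<open>auto simp: indicator_def elim!: eventually_mono\<close>)

lemma partial_mean_nonneg: "0 \<le> (\<integral>t. t * indicator A t \<partial>Xdist f)"
  by (rule integral_nonneg_AE) (use AE_nonneg in \<open>auto simp: indicator_def elim!: eventually_mono\<close>)

text \<open>Two demands compete: \<open>{..x0}\<close> must have probability below 1, so that a
  maximum below \<open>x0\<close> is exponentially rare, yet carry almost the whole mean. The mean
  beyond \<open>x0\<close> is at most \<open>R * d + c * A0\<close>; \<open>R\<close> is taken large
  first, then \<open>d\<close> small. Continuity of the distribution function gives
  \<open>{..x0}\<close> probability exactly \<open>1 - d\<close>, also for bounded support.\<close>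

lemma ex_truncation:
  fixes \<delta>' \<eta>0 A0 u :: real
  assumes \<eta>0: "0 < \<eta>0" and A0: "mgf (\<lambda>s. ennreal (f s)) \<eta>0 \<le> ennreal A0" "0 \<le> A0"
    and \<delta>': "0 < \<delta>'" and u: "X.prob {..u} < 1"
  shows "\<exists>x0\<ge>u. X.prob {..x0} < 1 \<and> mean_X f - \<delta>' \<le> (\<integral>t. t * indicator {..x0} t \<partial>Xdist f)"
proof -
  interpret ex: extremal_sampling f "\<lambda>x. {..x}" by (rule extremal_sampling_atMost)
  note ints = ex.mgf_integrable[OF \<eta>0 A0]
  define R where "R = 4 * A0 / (\<eta>0\<^sup>2 * \<delta>') + 1"
  have R: "0 < R" using A0 \<eta>0 \<delta>' by (simp add: R_def add_nonneg_pos)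
  define c where "c = 2 / (\<eta>0\<^sup>2 * R)"
  have c: "0 \<le> c" "c * A0 \<le> \<delta>' / 2"
  proof -
    show "0 \<le> c" using R by (simp add: c_def)
    have "4 * A0 \<le> R * (\<eta>0\<^sup>2 * \<delta>')" using \<eta>0 \<delta>' by (simp add: R_def field_simps)
    then show "c * A0 \<le> \<delta>' / 2" using R \<eta>0 by (simp add: c_def field_simps)
  qed
  define d where "d = min (\<delta>' / (2 * R)) (1 - X.prob {..u})"
  have d: "0 < d" "R * d \<le> \<delta>' / 2" "d \<le> 1 - X.prob {..u}"
  proof -
    show "0 < d" using \<delta>' R u by (simp add: d_def)
    have "d \<le> \<delta>' / (2 * R)" by (simp add: d_def)
    then show "R * d \<le> \<delta>' / 2" using R by (simp add: field_simps)
    show "d \<le> 1 - X.prob {..u}" by (simp add: d_def)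
  qed
  have "\<forall>\<^sub>F b in at_top. 1 - d < cdf (Xdist f) b"
    using X.cdf_lim_at_top_prob d(1) by (intro order_tendstoD(1)) auto
  then have "\<forall>\<^sub>F b in at_top. 1 - d < cdf (Xdist f) b \<and> u \<le> b"
    using eventually_ge_at_top[of u] by eventually_elim auto
  then obtain b where b: "1 - d < cdf (Xdist f) b" "u \<le> b"
    by (auto simp: eventually_at_top_linorder)
  have "\<exists>x\<ge>u. x \<le> b \<and> cdf (Xdist f) x = 1 - d"
    using b d(3) by (intro IVT' cdf_Xdist_continuous) (auto simp: cdf_def)
  then obtain x0 where x0: "u \<le> x0" "X.prob {..x0} = 1 - d" by (auto simp: cdf_def)
  have P: "X.prob {x0<..} = d"
  proof -
    have "X.prob (UNIV - {..x0}) = 1 - X.prob {..x0}"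
      using X.prob_compl[of "{..x0}"] by simp
    moreover have "UNIV - {..x0} = {x0<..}" by auto
    ultimately show ?thesis using x0 by simp
  qed
  have sq: "t \<le> R + c * exp (\<eta>0 * t)" if "0 \<le> t" for t
  proof (cases "t \<le> R")
    case False
    have "(\<eta>0 * t)\<^sup>2 / 2 \<le> exp (\<eta>0 * t)"
      using exp_lower_Taylor_quadratic[of "\<eta>0 * t"] that \<eta>0 mult_nonneg_nonneg[of \<eta>0 t] by linarith
    then have "\<eta>0\<^sup>2 * t\<^sup>2 \<le> 2 * exp (\<eta>0 * t)" by (simp add: power_mult_distrib)
    moreover have "\<eta>0\<^sup>2 * (t * R) \<le> \<eta>0\<^sup>2 * t\<^sup>2"
      using False that unfolding power2_eq_square by (intro mult_left_mono) auto
    ultimately have "t * (\<eta>0\<^sup>2 * R) \<le> 2 * exp (\<eta>0 * t)" by (simp add: mult_ac)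
    then have "t \<le> c * exp (\<eta>0 * t)" using \<eta>0 R unfolding c_def by (simp add: field_simps)
    then show ?thesis using R by simp
  qed (use c in \<open>simp add: add_increasing2\<close>)
  have iI: "integrable (Xdist f) (\<lambda>t. indicator {x0<..} t :: real)"
    by (rule X.integrable_const_bound[where B=1]) (auto simp: indicator_def)
  have i1: "integrable (Xdist f) (\<lambda>t. t * indicator {..x0} t)" and i2: "integrable (Xdist f) (\<lambda>t. t * indicator {x0<..} t)"
    by (rule integrable_partial_mean[OF ints(3)]; simp)+
  have "mean_X f = (\<integral>t. t * indicator {..x0} t + t * indicator {x0<..} t \<partial>Xdist f)"
    unfolding mean_X_def by (rule Bochner_Integration.integral_cong) (auto simp: indicator_def)
  also have "\<dots> = (\<integral>t. t * indicator {..x0} t \<partial>Xdist f) + (\<integral>t. t * indicator {x0<..} t \<partial>Xdist f)"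
    using i1 i2 by simp
  also have "(\<integral>t. t * indicator {x0<..} t \<partial>Xdist f) \<le> (\<integral>t. R * indicator {x0<..} t + c * exp (\<eta>0 * t) \<partial>Xdist f)"
  proof (rule integral_mono_AE[OF i2])
    show "integrable (Xdist f) (\<lambda>t. R * indicator {x0<..} t + c * exp (\<eta>0 * t))" using iI ints(1) by simp
    show "AE t in Xdist f. t * indicator {x0<..} t \<le> R * indicator {x0<..} t + c * exp (\<eta>0 * t)"
      using AE_nonneg by eventually_elim (use sq c in \<open>auto simp: indicator_def\<close>)
  qed
  also have "\<dots> = R * d + c * (\<integral>t. exp (\<eta>0 * t) \<partial>Xdist f)"
    using iI ints(1) P by simp
  also have "\<dots> \<le> \<delta>' / 2 + \<delta>' / 2"
    using d c mult_left_mono[OF ints(2) c(1)] by (intro add_mono) auto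
  finally show ?thesis using x0 d(1) by (intro exI[of _ x0]) auto
qed

text \<open>Condition (iii) of the informal statement enters only here.\<close>

lemma ratio_le_exp:
  fixes \<eta>0 C' \<epsilon>0 :: real
  assumes \<eta>0: "0 < \<eta>0" and int: "integrable (Xdist f) (\<lambda>t. t)"
    and small: "0 < C'" "0 < \<epsilon>0" "\<And>x. x \<in> {chi_min f <..< chi_min f + \<epsilon>0} \<Longrightarrow> x \<le> C' * cond_exp_le f x"
  shows "\<exists>B\<ge>0. AE y in Xdist f. 0 \<le> y \<longrightarrow> 0 \<le> y / cond_exp_le f y \<and> y / cond_exp_le f y \<le> B * exp (\<eta>0 * y)"
proof -
  let ?F = "\<lambda>x. X.prob {..x}" and ?G = "\<lambda>x. (\<integral>t. t * indicator {..x} t \<partial>Xdist f)"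
  define xmin where "xmin = chi_min f"
  have neg: "?F x = 0" if "x < 0" for x
  proof -
    have "AE t in Xdist f. t \<notin> {..x}" using AE_nonneg by eventually_elim (use that in auto)
    then show ?thesis by (subst X.prob_eq_0) auto
  qed
  have bb: "bdd_below {x. 0 < ?F x}" by (rule bdd_belowI[of _ 0], rule ccontr) (use neg in auto)
  have ne: "{x. 0 < ?F x} \<noteq> {}"
  proof -
    have "\<forall>\<^sub>F b in at_top. 0 < cdf (Xdist f) b"
      using X.cdf_lim_at_top_prob by (intro order_tendstoD(1)) auto
    then show ?thesis by (auto simp: eventually_at_top_linorder cdf_def)
  qed
  have below: "?F x = 0" if "x < xmin" for x
  proof (rule ccontr)
    assume "?F x \<noteq> 0"
    then have "x \<in> {x. 0 < ?F x}" by (simp add: less_le)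
    then have "xmin \<le> x" unfolding xmin_def chi_min_def by (rule cInf_lower[OF _ bb])
    with that show False by simp
  qed
  define x2 where "x2 = xmin + \<epsilon>0"
  have F2: "0 < ?F x2"
  proof -
    have "xmin < x2" using small by (simp add: x2_def)
    then obtain x where "0 < ?F x" "x < x2"
      using cInf_lessD[OF ne, of x2] unfolding xmin_def chi_min_def by auto
    moreover have "?F x \<le> ?F x2" using \<open>x < x2\<close> by (intro X.finite_measure_mono) auto
    ultimately show ?thesis by simp
  qed
  define e where "e = ?G x2"
  have e: "0 < e"
  proof (rule ccontr)
    assume "\<not> 0 < e"
    then have "?G x2 = 0" using partial_mean_nonneg[of "{..x2}"] by (simp add: e_def)
    moreover have "integrable (Xdist f) (\<lambda>t. t * indicator {..x2} t)" by (rule integrable_partial_mean[OF int]) simp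
    moreover have "AE t in Xdist f. 0 \<le> t * indicator {..x2} t"
      using AE_nonneg by eventually_elim (auto simp: indicator_def)
    ultimately have "AE t in Xdist f. t * indicator {..x2} t = 0"
      using integral_nonneg_eq_0_iff_AE by blast
    moreover have "AE t in Xdist f. t \<notin> {0}" using prob_singleton[of 0] by (subst (asm) X.prob_eq_0) auto
    ultimately have "AE t in Xdist f. t \<notin> {..x2}" by eventually_elim (auto simp: indicator_def split: if_splits)
    then have "?F x2 = 0" by (subst X.prob_eq_0) auto
    then show False using F2 by simp
  qed
  \<comment> \<open>\<open>C'\<close> covers weights below \<open>x2\<close>. From \<open>x2\<close>
    on the conditional mean is at least \<open>e > 0\<close>, and
    \<open>y \<le> exp (\<eta>0 * y) / \<eta>0\<close> gives the other summand.\<close>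
  define B where "B = C' + 1 / (\<eta>0 * e)"
  have B: "0 \<le> B" using small \<eta>0 e by (simp add: B_def)
  have ce0: "0 \<le> cond_exp_le f y" for y
    unfolding cond_exp_le_def using partial_mean_nonneg[of "{..y}"] by simp
  have "AE t in Xdist f. t \<notin> {xmin}" using prob_singleton[of xmin] by (subst (asm) X.prob_eq_0) auto
  then have "AE y in Xdist f. 0 \<le> y \<longrightarrow> 0 \<le> y / cond_exp_le f y \<and> y / cond_exp_le f y \<le> B * exp (\<eta>0 * y)"
  proof (eventually_elim, intro impI conjI)
    fix y assume y: "y \<notin> {xmin}" "0 \<le> y"
    show "0 \<le> y / cond_exp_le f y" using ce0 y by simp
    have ex: "1 \<le> exp (\<eta>0 * y)" using y \<eta>0 by simp
    have B1: "C' \<le> B * exp (\<eta>0 * y)"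
    proof -
      have "C' \<le> B" using \<eta>0 e by (simp add: B_def)
      also have "B \<le> B * exp (\<eta>0 * y)" using mult_left_mono[OF ex B] by simp
      finally show ?thesis .
    qed
    show "y / cond_exp_le f y \<le> B * exp (\<eta>0 * y)"
    \<comment> \<open>With a vanishing denominator the quotient is 0 by convention.\<close>
    proof (cases "cond_exp_le f y = 0")
      case True then show ?thesis using B by simp
    next
      case False
      then have ce: "0 < cond_exp_le f y" using ce0[of y] by simp
      then have Fy: "0 < ?F y" using measure_nonneg[of "Xdist f" "{..y}"] by (auto simp: cond_exp_le_def less_le)
      then have "xmin < y" using below[of y] y by force
      show ?thesis
      proof (cases "y < x2")
        case True
        then have "y \<le> C' * cond_exp_le f y" using small(3) \<open>xmin < y\<close> by (auto simp: xmin_def x2_def)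
        then have "y / cond_exp_le f y \<le> C'" using ce by (simp add: field_simps)
        then show ?thesis using B1 by simp
      next
        case False
        have G: "e \<le> ?G y" unfolding e_def by (rule partial_mean_mono[OF int]) (use False in auto)
        have "?G y \<le> ?G y / ?F y"
          using Fy G e X.prob_le_1[of "{..y}"] by (simp add: field_simps mult_left_le)
        then have ey: "e \<le> cond_exp_le f y" using G by (simp add: cond_exp_le_def)
        have "\<eta>0 * y \<le> exp (\<eta>0 * y)" using exp_ge_add_one_self[of "\<eta>0 * y"] by linarith
        then have ye: "y \<le> exp (\<eta>0 * y) / \<eta>0" using \<eta>0 by (simp add: field_simps)
        have "y / cond_exp_le f y \<le> y / e" using ey e y by (intro divide_left_mono) auto
        also have "\<dots> \<le> exp (\<eta>0 * y) / \<eta>0 / e" using ye e by (intro divide_right_mono) auto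
        also have "\<dots> = 1 / (\<eta>0 * e) * exp (\<eta>0 * y)" by simp
        also have "\<dots> \<le> B * exp (\<eta>0 * y)"
          using small by (intro mult_right_mono) (auto simp: B_def)
        finally show ?thesis .
      qed
    qed
  qed
  then show ?thesis using B by blast
qed

text \<open>The good weights are those from \<open>x0\<close> on. Of the relative slack
  \<open>\<epsilon>'\<close> in \<open>Q\<close>, one half pays for the conditional mean being only
  \<open>m = (1 - \<epsilon>' / 2) * \<mu>\<close>, one quarter for the second-order term
  \<open>\<theta> * V\<close>, and the last quarter is the exponential rate
  \<open>\<kappa>2\<close>.\<close>

lemma phi_max_estimate:
  fixes \<epsilon> c0 a b \<eta>0 A0 C' \<epsilon>0 :: real
  assumes minor: "0 < c0" "0 \<le> a" "a < b" "\<forall>s\<in>{a..b}. c0 \<le> f s"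
    and \<eta>0: "0 < \<eta>0" and A0: "mgf (\<lambda>s. ennreal (f s)) \<eta>0 \<le> ennreal A0" "0 \<le> A0"
    and small: "0 < C'" "0 < \<epsilon>0" "\<forall>x\<in>{chi_min f <..< chi_min f + \<epsilon>0}. x \<le> C' * cond_exp_le f x"
    and eps: "0 < \<epsilon>"
  shows "\<exists>\<kappa> K. 0 < \<kappa> \<and> 0 \<le> K \<and> (\<forall>n Q. 1 \<le> n \<longrightarrow> real n powr (1/4) \<le> Q \<longrightarrow> Q \<le> (1 - \<epsilon>) * real n * mean_X f \<longrightarrow>
    \<bar>(\<integral>w. phi_max n w Q \<partial>samples f n)
       - (1 / real n) * (\<integral>w. (let x = Max (w ` {..<n}) in x / cond_exp_le f x) \<partial>samples f n)\<bar>
     \<le> K * exp (- (\<kappa> * real n powr (1/4))))"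
proof -
  interpret ex: extremal_sampling f "\<lambda>x. {..x}" by (rule extremal_sampling_atMost)
  note int = ex.mgf_integrable(3)[OF \<eta>0 A0]
  define \<mu> where "\<mu> = mean_X f"
  have \<mu>: "0 < \<mu>" unfolding \<mu>_def using mean_pos[OF int minor(2,3,1)] minor(4) by simp
  have cm: "ex.cmean x = cond_exp_le f x" for x by (simp add: ex.cmean_def cond_exp_le_def)
  define \<epsilon>' where "\<epsilon>' = min \<epsilon> (1/2)"
  have \<epsilon>': "0 < \<epsilon>'" "\<epsilon>' \<le> 1/2" "\<epsilon>' \<le> \<epsilon>" using eps by (auto simp: \<epsilon>'_def)
  \<comment> \<open>The lower half \<open>{a..q}\<close> serves as the common minorant interval; the
    mass of the upper half guarantees that \<open>{..q}\<close> has probability below 1, so that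
    truncation can start at \<open>q\<close>.\<close>
  define q where "q = (a + b) / 2"
  have q: "a < q" "q < b" using minor(3) by (auto simp: q_def)
  have lb: "c0 \<le> f s" if "s \<in> {a..q}" for s using minor(4) that q by auto
  have Fq: "X.prob {..q} < 1"
  proof -
    have "c0 * (b - q) \<le> X.prob {q<..}"
      by (rule prob_interval_ge) (use minor q in auto)
    moreover have "X.prob (UNIV - {..q}) = 1 - X.prob {..q}"
      using X.prob_compl[of "{..q}"] by simp
    moreover have "UNIV - {..q} = {q<..}" by auto
    moreover have "0 < c0 * (b - q)" using minor q by simp
    ultimately show ?thesis by simp
  qed
  have "0 < \<epsilon>' / 2 * \<mu>" using \<epsilon>' \<mu> by simp
  from ex_truncation[OF \<eta>0 A0 this Fq]
  obtain x0 where x0: "q \<le> x0" "X.prob {..x0} < 1" "\<mu> - \<epsilon>' / 2 * \<mu> \<le> (\<integral>t. t * indicator {..x0} t \<partial>Xdist f)"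
    unfolding \<mu>_def by blast
  define m where "m = \<mu> - \<epsilon>' / 2 * \<mu>"
  define \<alpha> where "\<alpha> = c0 * (q - a)"
  have \<alpha>: "0 < \<alpha>" using minor q by (simp add: \<alpha>_def)
  have "\<epsilon>' / 2 * \<mu> \<le> 1 / 4 * \<mu>" using \<epsilon>' \<mu> by (intro mult_right_mono) auto
  then have m: "3 / 4 * \<mu> \<le> m" by (simp add: m_def)
  have good: "\<alpha> \<le> X.prob {..y} \<and> {a..q} \<subseteq> {..y} \<and> m \<le> ex.cmean y" if "y \<in> {x0..}" for y
  proof (intro conjI)
    show sub: "{a..q} \<subseteq> {..y}" using that x0 by auto
    show \<alpha>y: "\<alpha> \<le> X.prob {..y}" unfolding \<alpha>_def
      by (rule prob_interval_ge) (use lb minor q sub in auto)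
    let ?G = "\<integral>t. t * indicator {..y} t \<partial>Xdist f"
    have G: "m \<le> ?G" unfolding m_def
      using x0(3) partial_mean_mono[OF int, of "{..x0}" "{..y}"] that by auto
    have F: "0 < X.prob {..y}" using \<alpha>y \<alpha> by simp
    have "?G \<le> ?G / X.prob {..y}"
      using F G m \<mu> X.prob_le_1[of "{..y}"] by (simp add: field_simps mult_left_le)
    then show "m \<le> ex.cmean y" using G by (simp add: ex.cmean_def)
  qed
  obtain B where B: "0 \<le> B" "AE y in Xdist f. 0 \<le> y \<longrightarrow> 0 \<le> y / ex.cmean y \<and> y / ex.cmean y \<le> B * exp (\<eta>0 * y)"
    using ratio_le_exp[OF \<eta>0 int small(1,2)] small(3) unfolding cm by blast
  define V where "V = A0 / \<alpha> / \<eta>0\<^sup>2"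
  have V: "0 \<le> V" using A0 \<alpha> by (simp add: V_def)
  have mpos: "0 < m" using m \<mu> by simp
  have "0 < \<epsilon>' * \<mu> / 4" using \<epsilon>' \<mu> by simp
  from ex_small_rate[OF mpos V this]
  obtain \<theta> where \<theta>: "0 < \<theta>" "\<theta> * m \<le> 1" "\<theta> * V \<le> \<epsilon>' * \<mu> / 4" by blast
  define r where "r = 1 - \<theta> * m + \<theta>\<^sup>2 * V"
  have r_eq: "r = 1 + \<theta> * (\<theta> * V - m)" by (simp add: r_def power2_eq_square algebra_simps)
  have "\<epsilon>' * \<mu> / 4 \<le> \<mu> / 8" using mult_right_mono[OF \<epsilon>'(2), of \<mu>] \<mu> by simp
  then have Vm: "\<theta> * V - m < 0" using \<theta>(3) m \<mu> by linarith
  have r: "0 \<le> r" "r < 1"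
  proof -
    show "0 \<le> r" using \<theta>(2) V by (simp add: r_def)
    show "r < 1" using mult_pos_neg[OF \<theta>(1) Vm] by (simp add: r_eq)
  qed
  define \<kappa>2 where "\<kappa>2 = \<theta> * (\<epsilon>' * \<mu> / 4)"
  have \<kappa>2: "0 < \<kappa>2" using \<theta> \<epsilon>' \<mu> by (simp add: \<kappa>2_def)
  have T: "exp (\<theta> * Q) * r ^ n / (1 - r) \<le> 1 / (1 - r) * exp (- (\<kappa>2 * real n powr (1/4)))"
    if n: "1 \<le> n" and Q: "Q \<le> (1 - \<epsilon>) * real n * \<mu>" for n :: nat and Q
  proof -
    have "(1 - \<epsilon>) * (real n * \<mu>) \<le> (1 - \<epsilon>') * (real n * \<mu>)" using \<epsilon>' \<mu> by (intro mult_right_mono) auto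
    then have "Q \<le> (1 - \<epsilon>') * (real n * \<mu>)" using Q by (simp add: mult.assoc)
    then have q1: "\<theta> * Q \<le> \<theta> * ((1 - \<epsilon>') * (real n * \<mu>))" using \<theta> by (intro mult_left_mono) auto
    have "r ^ n \<le> exp (real n * (\<theta> * (\<theta> * V - m)))"
      unfolding r_eq by (rule power_le_exp_linear) (use r in \<open>simp add: r_eq\<close>)
    then have "exp (\<theta> * Q) * r ^ n \<le> exp (\<theta> * ((1 - \<epsilon>') * (real n * \<mu>))) * exp (real n * (\<theta> * (\<theta> * V - m)))"
      using q1 r by (intro mult_mono) auto
    also have "\<dots> = exp (real n * \<theta> * ((1 - \<epsilon>') * \<mu> + (\<theta> * V - m)))"
      by (simp add: exp_add[symmetric] algebra_simps)
    also have "\<dots> \<le> exp (real n * \<theta> * (- (\<epsilon>' * \<mu> / 4)))"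
    proof -
      have "(1 - \<epsilon>') * \<mu> + (\<theta> * V - m) \<le> - (\<epsilon>' * \<mu> / 4)"
        using \<theta>(3) by (simp add: m_def algebra_simps)
      then have "real n * \<theta> * ((1 - \<epsilon>') * \<mu> + (\<theta> * V - m)) \<le> real n * \<theta> * (- (\<epsilon>' * \<mu> / 4))"
        using \<theta>(1) by (intro mult_left_mono) auto
      then show ?thesis by (simp only: exp_le_cancel_iff)
    qed
    also have "\<dots> = exp (- (\<kappa>2 * real n))" by (simp add: \<kappa>2_def)
    also have "\<dots> \<le> exp (- (\<kappa>2 * real n powr (1/4)))"
      using real_powr_quarter_le(1)[OF n] \<kappa>2 by simp
    finally have "exp (\<theta> * Q) * r ^ n \<le> exp (- (\<kappa>2 * real n powr (1/4)))" .
    then have "exp (\<theta> * Q) * r ^ n / (1 - r) \<le> exp (- (\<kappa>2 * real n powr (1/4))) / (1 - r)"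
      using r by (intro divide_right_mono) auto
    then show ?thesis by simp
  qed
  have est: "\<exists>\<kappa> K. 0 < \<kappa> \<and> 0 \<le> K \<and> (\<forall>n Q. 1 \<le> n \<longrightarrow> real n powr (1/4) \<le> Q \<longrightarrow> Q \<le> (1 - \<epsilon>) * real n * \<mu> \<longrightarrow>
    ex.discrepancy n Q
     \<le> K * exp (- (\<kappa> * real n powr (1/4))))"
  proof (rule ex.shapley_estimate_powr[OF minor(1,2) q(1) lb \<eta>0 A0 \<alpha> _ good _ _ x0(2) B _ \<kappa>2])
    show "X.prob {..y} \<le> X.prob {..x0}" if "y \<notin> {x0..}" for y
      using that by (intro X.finite_measure_mono) auto
    show "0 \<le> 1 / (1 - r)" using r by simp
    fix n :: nat and Q assume nQ: "1 \<le> n" "Q \<le> (1 - \<epsilon>) * real n * \<mu>"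
    show "(\<exists>\<theta>\<ge>0. 0 \<le> 1 - \<theta> * m + \<theta>\<^sup>2 * (A0 / \<alpha> / \<eta>0\<^sup>2) \<and> 1 - \<theta> * m + \<theta>\<^sup>2 * (A0 / \<alpha> / \<eta>0\<^sup>2) < 1 \<and>
        exp (\<theta> * Q) * (1 - \<theta> * m + \<theta>\<^sup>2 * (A0 / \<alpha> / \<eta>0\<^sup>2)) ^ n / (1 - (1 - \<theta> * m + \<theta>\<^sup>2 * (A0 / \<alpha> / \<eta>0\<^sup>2)))
        \<le> 1 / (1 - r) * exp (- (\<kappa>2 * real n powr (1/4))))"
      unfolding V_def[symmetric]
      using nQ \<theta> r T[OF nQ] unfolding r_def by (intro conjI exI[of _ \<theta>]) auto
  qed (use mpos in auto)
  have phi: "phi_max n w Q = shapley n w Q (extremal (\<lambda>x. {..x}) n w)" for n w Q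
    by (simp add: phi_max_def extremal_def)
  have Max: "Max (w ` {..<n}) = w (extremal (\<lambda>x. {..x}) n w)" if "1 \<le> n" for n w
    using ex.extremal_props(1)[of n w] ex.extremal_props(2)[of n _ w] that by (intro Max_eqI) auto
  have "ex.discrepancy n Q = \<bar>(\<integral>w. phi_max n w Q \<partial>samples f n)
       - (1 / real n) * (\<integral>w. (let x = Max (w ` {..<n}) in x / cond_exp_le f x) \<partial>samples f n)\<bar>" if "1 \<le> n" for n Q
    unfolding ex.discrepancy_def phi Max[OF that] Let_def cm ..
  with est show ?thesis unfolding \<mu>_def by simp
qed

text \<open>Conditioning on \<open>X \<ge> y\<close> cannot lower the mean, so nothing is lost
  there. For \<open>\<theta>\<close> of order \<open>n powr (-1/3)\<close> both the gain
  \<open>\<theta> * n powr (2/3) * \<mu>\<close> from the slack and the loss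
  \<open>\<theta>\<^sup>2 * n * V\<close> have order \<open>n powr (1/3)\<close>, and a small
  constant factor in \<open>\<theta>\<close> lets the gain win.\<close>

lemma phi_min_estimate:
  fixes c0 a b \<eta>0 A0 :: real
  assumes minor: "0 < c0" "0 \<le> a" "a < b" "\<forall>s\<in>{a..b}. c0 \<le> f s"
    and \<eta>0: "0 < \<eta>0" and A0: "mgf (\<lambda>s. ennreal (f s)) \<eta>0 \<le> ennreal A0" "0 \<le> A0"
  shows "\<exists>\<kappa> K. 0 < \<kappa> \<and> 0 \<le> K \<and> (\<forall>n Q. 1 \<le> n \<longrightarrow> real n powr (1/4) \<le> Q \<longrightarrow> Q \<le> (real n - real n powr (2/3)) * mean_X f \<longrightarrow>
    \<bar>(\<integral>w. phi_min n w Q \<partial>samples f n)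
       - (1 / real n) * (\<integral>w. (let x = Min (w ` {..<n}) in x / cond_exp_ge f x) \<partial>samples f n)\<bar>
     \<le> K * exp (- (\<kappa> * real n powr (1/4))))"
proof -
  interpret ex: extremal_sampling f "\<lambda>x. {x..}" by (rule extremal_sampling_atLeast)
  note int = ex.mgf_integrable(3)[OF \<eta>0 A0]
  define \<mu> where "\<mu> = mean_X f"
  have \<mu>: "0 < \<mu>" unfolding \<mu>_def using mean_pos[OF int minor(2,3,1)] minor(4) by simp
  have cm: "ex.cmean x = cond_exp_ge f x" for x by (simp add: ex.cmean_def cond_exp_ge_def)
  \<comment> \<open>The upper half \<open>{p..b}\<close> lies in \<open>{y..}\<close> for every good
    weight \<open>y \<le> p\<close>; the mass of the lower half keeps the probability of
    \<open>{p..}\<close> below 1.\<close>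
  define p where "p = (a + b) / 2"
  have p: "a < p" "p < b" using minor(3) by (auto simp: p_def)
  have p0: "0 \<le> p" using minor p by simp
  have lb: "c0 \<le> f s" if "s \<in> {p..b}" for s using minor(4) that p by auto
  have Fp: "X.prob {p..} < 1"
  proof -
    have "c0 * (p - a) \<le> X.prob {..<p}"
      by (rule prob_interval_ge) (use minor p in auto)
    moreover have "X.prob (UNIV - {..<p}) = 1 - X.prob {..<p}"
      using X.prob_compl[of "{..<p}"] by simp
    moreover have "UNIV - {..<p} = {p..}" by auto
    moreover have "0 < c0 * (p - a)" using minor p by simp
    ultimately show ?thesis by simp
  qed
  define \<alpha> where "\<alpha> = c0 * (b - p)"
  have \<alpha>: "0 < \<alpha>" using minor p by (simp add: \<alpha>_def)
  have pm: "integrable (Xdist f) (\<lambda>t. t * indicator {y..} t)" "integrable (Xdist f) (\<lambda>t. indicator {y..} t :: real)" for y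
    by (rule integrable_partial_mean[OF int], simp) (rule X.integrable_const_bound[where B=1], auto simp: indicator_def)
  have ge_y: "y * X.prob {y..} \<le> (\<integral>t. t * indicator {y..} t \<partial>Xdist f)" for y
  proof -
    have "(\<integral>t. y * indicator {y..} t \<partial>Xdist f) \<le> (\<integral>t. t * indicator {y..} t \<partial>Xdist f)"
      by (rule integral_mono) (use pm in \<open>auto simp: indicator_def\<close>)
    then show ?thesis by simp
  qed
  \<comment> \<open>For \<open>y < \<mu>\<close>, restricting to \<open>t \<ge> y\<close> discards
    only negative values of \<open>t - \<mu>\<close>, whose total integral is 0.\<close>
  have ge_\<mu>: "\<mu> * X.prob {y..} \<le> (\<integral>t. t * indicator {y..} t \<partial>Xdist f)" for y
  proof (cases "\<mu> \<le> y")
    case True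
    then have "\<mu> * X.prob {y..} \<le> y * X.prob {y..}" by (intro mult_right_mono) auto
    then show ?thesis using ge_y[of y] by simp
  next
    case False
    have i: "integrable (Xdist f) (\<lambda>t. (t - \<mu>) * indicator {y..} t)"
      using pm[of y] by (simp add: left_diff_distrib)
    have "(\<integral>t. t - \<mu> \<partial>Xdist f) \<le> (\<integral>t. (t - \<mu>) * indicator {y..} t \<partial>Xdist f)"
      by (rule integral_mono[OF _ i]) (use int False in \<open>auto simp: indicator_def\<close>)
    also have "\<dots> = (\<integral>t. t * indicator {y..} t \<partial>Xdist f) - \<mu> * X.prob {y..}"
      using pm[of y] by (simp add: left_diff_distrib)
    also have "(\<integral>t. t - \<mu> \<partial>Xdist f) = 0" using int X.prob_space by (simp add: \<mu>_def mean_X_def)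
    finally show ?thesis by simp
  qed
  have good: "\<alpha> \<le> X.prob {y..} \<and> {p..b} \<subseteq> {y..} \<and> \<mu> \<le> ex.cmean y" if "y \<in> {..p}" for y
  proof (intro conjI)
    show sub: "{p..b} \<subseteq> {y..}" using that by auto
    show \<alpha>y: "\<alpha> \<le> X.prob {y..}" unfolding \<alpha>_def
      by (rule prob_interval_ge) (use lb minor p sub in auto)
    then show "\<mu> \<le> ex.cmean y" using ge_\<mu>[of y] \<alpha> by (simp add: ex.cmean_def pos_le_divide_eq)
  qed
  \<comment> \<open>The conditional mean above \<open>y\<close> is at least \<open>y\<close>, so the
    ratio is at most 1; where the conditional mean is 0, so is the quotient.\<close>
  have B: "AE y in Xdist f. 0 \<le> y \<longrightarrow> 0 \<le> y / ex.cmean y \<and> y / ex.cmean y \<le> 1 * exp (\<eta>0 * y)"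
  proof (intro AE_I2 impI)
    fix y :: real assume y: "0 \<le> y"
    have cm0: "0 \<le> ex.cmean y" unfolding ex.cmean_def using partial_mean_nonneg[of "{y..}"] by simp
    have "y / ex.cmean y \<le> 1"
    proof (cases "ex.cmean y = 0")
      case False
      then have "0 < X.prob {y..}" using measure_nonneg[of "Xdist f" "{y..}"] by (auto simp: ex.cmean_def less_le)
      then have "y \<le> ex.cmean y" using ge_y[of y] by (simp add: ex.cmean_def pos_le_divide_eq)
      then show ?thesis using False cm0 by (simp add: divide_le_eq)
    qed simp
    moreover have "1 \<le> exp (\<eta>0 * y)" using y \<eta>0 by simp
    ultimately have "y / ex.cmean y \<le> exp (\<eta>0 * y)" by (rule order_trans)
    then show "0 \<le> y / ex.cmean y \<and> y / ex.cmean y \<le> 1 * exp (\<eta>0 * y)" using y cm0 by simp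
  qed
  define V where "V = A0 / \<alpha> / \<eta>0\<^sup>2"
  have V: "0 \<le> V" using A0 \<alpha> by (simp add: V_def)
  have "0 < \<mu> / 2" using \<mu> by simp
  from ex_small_rate[OF \<mu> V this]
  obtain \<theta>0 where \<theta>0: "0 < \<theta>0" "\<theta>0 * \<mu> \<le> 1" "\<theta>0 * V \<le> \<mu> / 2" by blast
  define c where "c = \<theta>0 * \<mu> / 2"
  have c: "0 < c" using \<theta>0 \<mu> by (simp add: c_def)
  define r where "r \<theta> = 1 - \<theta> * \<mu> + \<theta>\<^sup>2 * V" for \<theta>
  have key: "\<exists>\<theta>\<ge>0. 0 \<le> r \<theta> \<and> r \<theta> < 1 \<and> exp (\<theta> * Q) * r \<theta> ^ n / (1 - r \<theta>) \<le> (1 / c * (2 / c)) * exp (- (c / 2 * real n powr (1/4)))"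
    if n: "1 \<le> n" and Q: "Q \<le> (real n - real n powr (2/3)) * \<mu>" for n :: nat and Q
  proof -
    \<comment> \<open>The cube root fixes the scale of \<open>\<theta>\<close>. As
      \<open>1 - r \<theta>\<close> is then only of order \<open>1 / t\<close>, a factor
      \<open>t\<close> appears, which \<open>linear_mult_exp_le\<close> absorbs at the cost of half
      the exponent.\<close>
    define t where "t = real n powr (1/3)"
    have t1: "1 \<le> t" using n by (simp add: t_def ge_one_powr_ge_zero)
    have t3: "t * t * t = real n" and t2: "t * t = real n powr (2/3)"
      using n by (simp_all add: t_def powr_add[symmetric])
    define \<theta> where "\<theta> = \<theta>0 / t"
    have \<theta>: "0 < \<theta>" "\<theta> \<le> \<theta>0" using \<theta>0 t1 by (auto simp: \<theta>_def divide_le_eq_1 field_simps)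
    have \<theta>\<mu>: "\<theta> * \<mu> \<le> 1" using mult_right_mono[OF \<theta>(2), of \<mu>] \<theta>0 \<mu> by linarith
    have \<theta>V: "\<theta> * V \<le> \<mu> / 2" using mult_right_mono[OF \<theta>(2) V] \<theta>0 by linarith
    have r_eq: "r \<theta> = 1 + \<theta> * (\<theta> * V - \<mu>)" by (simp add: r_def power2_eq_square algebra_simps)
    have "\<theta> * (\<theta> * V) \<le> \<theta> * (\<mu> / 2)" using \<theta> \<theta>V by (intro mult_left_mono) auto
    then have r1: "\<theta> * \<mu> / 2 \<le> 1 - r \<theta>" by (simp add: r_eq algebra_simps)
    have "0 < \<theta> * \<mu> / 2" using \<theta> \<mu> by simp
    then have r: "0 \<le> r \<theta>" "r \<theta> < 1"
    proof -
      show "0 \<le> r \<theta>" using \<theta>\<mu> V by (simp add: r_def)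
      show "r \<theta> < 1" using r1 \<open>0 < \<theta> * \<mu> / 2\<close> by linarith
    qed
    have "exp (\<theta> * Q) * r \<theta> ^ n \<le> exp (\<theta> * ((real n - real n powr (2/3)) * \<mu>)) * exp (real n * (\<theta> * (\<theta> * V - \<mu>)))"
    proof (rule mult_mono)
      show "exp (\<theta> * Q) \<le> exp (\<theta> * ((real n - real n powr (2/3)) * \<mu>))" using Q \<theta> by simp
      show "r \<theta> ^ n \<le> exp (real n * (\<theta> * (\<theta> * V - \<mu>)))"
        unfolding r_eq by (rule power_le_exp_linear) (use r in \<open>simp add: r_eq\<close>)
    qed (use r in auto)
    also have "\<dots> = exp (\<theta> * t * t * (\<theta> * t * V - \<mu>))"
      unfolding t2[symmetric] unfolding t3[symmetric] by (simp add: exp_add[symmetric] algebra_simps)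
    also have "\<dots> = exp (\<theta>0 * t * (\<theta>0 * V - \<mu>))"
      using t1 by (simp add: \<theta>_def)
    also have "\<dots> \<le> exp (- (c * t))"
    proof -
      have "\<theta>0 * t * (\<theta>0 * V - \<mu>) \<le> \<theta>0 * t * (- \<mu> / 2)"
        using \<theta>0 t1 by (intro mult_left_mono) auto
      then show ?thesis by (simp add: c_def mult_ac)
    qed
    finally have e1: "exp (\<theta> * Q) * r \<theta> ^ n \<le> exp (- (c * t))" .
    have "1 / (1 - r \<theta>) \<le> 1 / (\<theta> * \<mu> / 2)"
      using r1 \<open>0 < \<theta> * \<mu> / 2\<close> r by (intro divide_left_mono) auto
    also have "\<dots> = t / c" using t1 by (simp add: \<theta>_def c_def)
    finally have e2: "1 / (1 - r \<theta>) \<le> t / c" .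
    have "exp (\<theta> * Q) * r \<theta> ^ n * (1 / (1 - r \<theta>)) \<le> exp (- (c * t)) * (t / c)"
      using e1 e2 r by (intro mult_mono) auto
    also have "\<dots> = 1 / c * (t * exp (- (c * t)))" by simp
    also have "\<dots> \<le> 1 / c * (2 / c * exp (- (c / 2 * t)))"
      using linear_mult_exp_le[OF c, of t] c by (intro mult_left_mono) auto
    also have "\<dots> \<le> 1 / c * (2 / c * exp (- (c / 2 * real n powr (1/4))))"
      using real_powr_quarter_le(2)[OF n] c by (intro mult_left_mono) (auto simp: t_def)
    finally show ?thesis using r \<theta> by (intro exI[of _ \<theta>]) (auto simp: mult.assoc)
  qed
  have est: "\<exists>\<kappa> K. 0 < \<kappa> \<and> 0 \<le> K \<and> (\<forall>n Q. 1 \<le> n \<longrightarrow> real n powr (1/4) \<le> Q \<longrightarrow> Q \<le> (real n - real n powr (2/3)) * \<mu> \<longrightarrow>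
    ex.discrepancy n Q
     \<le> K * exp (- (\<kappa> * real n powr (1/4))))"
  proof (rule ex.shapley_estimate_powr[OF minor(1) p0 p(2) lb \<eta>0 A0 \<alpha> _ good _ _ Fp _ B, where ?C2.0="1 / c * (2 / c)" and ?\<kappa>2.0="c / 2"])
    show "X.prob {y..} \<le> X.prob {p..}" if "y \<notin> {..p}" for y
      using that by (intro X.finite_measure_mono) auto
    fix n :: nat and Q assume nQ: "1 \<le> n" "Q \<le> (real n - real n powr (2/3)) * \<mu>"
    show "(\<exists>\<theta>\<ge>0. 0 \<le> 1 - \<theta> * \<mu> + \<theta>\<^sup>2 * (A0 / \<alpha> / \<eta>0\<^sup>2) \<and> 1 - \<theta> * \<mu> + \<theta>\<^sup>2 * (A0 / \<alpha> / \<eta>0\<^sup>2) < 1 \<and>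
        exp (\<theta> * Q) * (1 - \<theta> * \<mu> + \<theta>\<^sup>2 * (A0 / \<alpha> / \<eta>0\<^sup>2)) ^ n / (1 - (1 - \<theta> * \<mu> + \<theta>\<^sup>2 * (A0 / \<alpha> / \<eta>0\<^sup>2)))
        \<le> 1 / c * (2 / c) * exp (- (c / 2 * real n powr (1/4))))"
      using key[OF nQ] unfolding V_def[symmetric] r_def by assumption
  qed (use \<mu> c in auto)
  have phi: "phi_min n w Q = shapley n w Q (extremal (\<lambda>x. {x..}) n w)" for n w Q
    by (simp add: phi_min_def extremal_def)
  have Min: "Min (w ` {..<n}) = w (extremal (\<lambda>x. {x..}) n w)" if "1 \<le> n" for n w
    using ex.extremal_props(1)[of n w] ex.extremal_props(2)[of n _ w] that by (intro Min_eqI) auto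
  have "ex.discrepancy n Q = \<bar>(\<integral>w. phi_min n w Q \<partial>samples f n)
       - (1 / real n) * (\<integral>w. (let x = Min (w ` {..<n}) in x / cond_exp_ge f x) \<partial>samples f n)\<bar>" if "1 \<le> n" for n Q
    unfolding ex.discrepancy_def phi Min[OF that] Let_def cm ..
  with est show ?thesis unfolding \<mu>_def by simp
qed

end

theorem theorem1:
  fixes f :: "real \<Rightarrow> real"
  assumes f_meas: "f \<in> borel_measurable lborel"
    and f_nonneg: "\<And>t. 0 \<le> f t"
    and f_neg_zero: "\<And>t. t < 0 \<Longrightarrow> f t = 0"
    and f_int: "integrable lborel f"
    and f_total: "(\<integral>t. f t \<partial>lborel) = 1"
    and tail: "\<exists>C lam. 0 < C \<and> 0 < lam \<and> (\<forall>t\<ge>0. f t \<le> C * exp (- lam * t))"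
    and pieces: "\<exists>\<I>. finite \<I> \<and> (\<forall>I\<in>\<I>. is_interval I \<and> I \<noteq> {}) \<and> pairwise disjnt \<I> \<and>
                   \<Union>\<I> = {t. f t \<noteq> 0} \<and>
                   (\<forall>I\<in>\<I>. f differentiable_on I \<and> (mono_on I f \<or> antimono_on I f))"
    and small: "\<exists>C' \<epsilon>0. 0 < C' \<and> 0 < \<epsilon>0 \<and>
                  (\<forall>x\<in>{chi_min f <..< chi_min f + \<epsilon>0}. x \<le> C' * cond_exp_le f x)"
    and eps: "0 < \<epsilon>"
  shows "\<exists>\<xi> K. 0 < \<xi> \<and> \<xi> < 1 \<and>
    (\<forall>n::nat. \<forall>Q::real. 1 \<le> n \<longrightarrow>
       real n powr (1/4) \<le> Q \<longrightarrow> Q \<le> (1 - \<epsilon>) * real n * mean_X f \<longrightarrow>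
       \<bar>(\<integral>w. phi_max n w Q \<partial>samples f n)
          - (1 / real n) * (\<integral>w. (let x = Max (w ` {..<n}) in x / cond_exp_le f x) \<partial>samples f n)\<bar>
         \<le> K * \<xi> powr (real n powr (1/4))) \<and>
    (\<forall>n::nat. \<forall>Q::real. 1 \<le> n \<longrightarrow>
       real n powr (1/4) \<le> Q \<longrightarrow> Q \<le> (real n - real n powr (2/3)) * mean_X f \<longrightarrow>
       \<bar>(\<integral>w. phi_min n w Q \<partial>samples f n)
          - (1 / real n) * (\<integral>w. (let x = Min (w ` {..<n}) in x / cond_exp_ge f x) \<partial>samples f n)\<bar>
         \<le> K * \<xi> powr (real n powr (1/4)))"
proof -
  let ?dmin = "\<lambda>(n::nat) Q. \<bar>(\<integral>w. phi_min n w Q \<partial>samples f n)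
       - (1 / real n) * (\<integral>w. (let x = Min (w ` {..<n}) in x / cond_exp_ge f x) \<partial>samples f n)\<bar>"
  let ?dmax = "\<lambda>(n::nat) Q. \<bar>(\<integral>w. phi_max n w Q \<partial>samples f n)
       - (1 / real n) * (\<integral>w. (let x = Max (w ` {..<n}) in x / cond_exp_le f x) \<partial>samples f n)\<bar>"
  interpret positive_density f
    by standard (use f_meas f_nonneg f_neg_zero f_int f_total in auto)
  from pieces obtain \<I> where fin: "finite \<I>" and iv: "\<forall>I\<in>\<I>. is_interval I \<and> I \<noteq> {}"
    and un: "\<Union>\<I> = {t. f t \<noteq> 0}"
    and df: "\<forall>I\<in>\<I>. f differentiable_on I \<and> (mono_on I f \<or> antimono_on I f)"
    by (elim exE conjE) (rule that)
  have "\<exists>a b c0. 0 \<le> a \<and> a < b \<and> 0 < c0 \<and> (\<forall>s\<in>{a..b}. c0 \<le> f s)"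
    by (rule ex_interval_minorant[OF fin _ un]) (simp_all only: iv df)
  then obtain a b c0 where minor: "0 < c0" "0 \<le> a" "a < b" "\<forall>s\<in>{a..b}. c0 \<le> f s"
    by blast
  obtain C lam where C: "0 < C" and lam: "0 < lam" and tl: "\<And>t. 0 \<le> t \<Longrightarrow> f t \<le> C * exp (- lam * t)"
    using tail by blast
  have \<eta>0: "0 < lam / 2" and A0: "0 \<le> C * 2 / lam" using C lam by auto
  have mgf: "mgf (\<lambda>s. ennreal (f s)) (lam / 2) \<le> ennreal (C * 2 / lam)"
    by (rule mgf_of_tail[OF lam C]) (rule tl)
  obtain C' \<epsilon>0 where sm: "0 < C'" "0 < \<epsilon>0" "\<forall>x\<in>{chi_min f <..< chi_min f + \<epsilon>0}. x \<le> C' * cond_exp_le f x"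
    using small by blast
  note mx_ex = phi_max_estimate[OF minor \<eta>0 mgf A0 sm eps]
  note mn_ex = phi_min_estimate[OF minor \<eta>0 mgf A0]
  obtain \<kappa>1 K1 where 1: "0 < \<kappa>1" "0 \<le> K1" and mx: "\<And>n Q. 1 \<le> n \<Longrightarrow> real n powr (1/4) \<le> Q \<Longrightarrow> Q \<le> (1 - \<epsilon>) * real n * mean_X f \<Longrightarrow>
    ?dmax n Q
     \<le> K1 * exp (- (\<kappa>1 * real n powr (1/4)))"
    using mx_ex by (elim exE conjE) (rule that, assumption+, blast)
  obtain \<kappa>2 K2 where 2: "0 < \<kappa>2" "0 \<le> K2" and mn: "\<And>n Q. 1 \<le> n \<Longrightarrow> real n powr (1/4) \<le> Q \<Longrightarrow> Q \<le> (real n - real n powr (2/3)) * mean_X f \<Longrightarrow>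
    ?dmin n Q
     \<le> K2 * exp (- (\<kappa>2 * real n powr (1/4)))"
    using mn_ex by (elim exE conjE) (rule that, assumption+, blast)
  \<comment> \<open>The smaller rate and the larger constant serve both estimates; the base of the
    theorem is \<open>exp (- \<kappa>)\<close>.\<close>
  define \<kappa> K where "\<kappa> = min \<kappa>1 \<kappa>2" and "K = max K1 K2"
  have \<kappa>: "0 < \<kappa>" "\<kappa> \<le> \<kappa>1" "\<kappa> \<le> \<kappa>2" using 1 2 by (auto simp: \<kappa>_def)
  have le: "K' * exp (- (k * N)) \<le> K * exp (- \<kappa>) powr N" if "0 \<le> K'" "K' \<le> K" "\<kappa> \<le> k" "0 \<le> N" for K' k N :: real
  proof -
    have "exp (- (k * N)) \<le> exp (- (\<kappa> * N))" using that by (simp add: mult_right_mono)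
    then have "K' * exp (- (k * N)) \<le> K * exp (- (\<kappa> * N))" using that by (intro mult_mono) auto
    then show ?thesis by (simp add: powr_def mult.commute)
  qed
  show ?thesis
  proof (rule exI[of _ "exp (- \<kappa>)"], rule exI[of _ K], intro conjI allI impI)
    show "0 < exp (- \<kappa>)" "exp (- \<kappa>) < 1" using \<kappa> by auto
  next
    fix n :: nat and Q :: real
    assume "1 \<le> n" "real n powr (1/4) \<le> Q" "Q \<le> (1 - \<epsilon>) * real n * mean_X f"
    from order_trans[OF mx[OF this] le[OF 1(2) _ \<kappa>(2)]]
    show "?dmax n Q
         \<le> K * exp (- \<kappa>) powr (real n powr (1/4))" by (simp add: K_def)
  next
    fix n :: nat and Q :: real
    assume "1 \<le> n" "real n powr (1/4) \<le> Q" "Q \<le> (real n - real n powr (2/3)) * mean_X f"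
    from order_trans[OF mn[OF this] le[OF 2(2) _ \<kappa>(3)]]
    show "?dmin n Q
         \<le> K * exp (- \<kappa>) powr (real n powr (1/4))" by (simp add: K_def)
  qed
qed

end
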